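(* Let $b,c>0$, $x_0\in\mathbb{R}$ and $M>0$. Then: (1) for $\omega_m=m^{\sigma}$ ($m\in\mathbb{N}_0$) with $\sigma>1/2$, $N=\lfloor\overline{N}\rfloor$ and $\overline{N}=\ln(1/\delta)/(2\beta(c/b))$, $$\sup_{f\in\mathcal{H}^{b,c}_{\omega,x_0}(M),\ \|\xi\|_{L^2(-1,1)}\leq1}\left\|f_\delta^N-f\right\|_{L^2(\mathbb{R})}=\underset{\delta\to0}{O}\left((-\log(\delta))^{-\sigma}\right);$$ (2) for $\omega_m=e^{\kappa m}$ ($m\in\mathbb{N}_0$) with $\kappa>0$, $N=\lfloor\overline{N}\rfloor$ and $\overline{N}=\ln(1/\delta)/(\kappa+\beta(c/b))$, $$\sup_{f\in\mathcal{H}^{b,c}_{\omega,x_0}(M),\ \|\xi\|_{L^2(-1,1)}\leq1}\left\|f_\delta^N-f\right\|_{L^2(\mathbb{R})}=\underset{\delta\to0}{O}\left(\delta^{\kappa/(\kappa+\beta(c/b))}\right).$$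
   Context: Notation. $\mathbb{N}_0$ is the set of nonnegative integers, $\mathrm{sech}=1/\cosh$. $L^2(\cosh(b\cdot))$ is the space of complex functions on $\mathbb{R}$ with inner product $\langle f,g\rangle_{L^2(\cosh(b\cdot))}=\int_{\mathbb{R}}f(x)\overline{g(x)}\cosh(bx)\,dx$; $L^2(-1,1)$ and $L^2(\mathbb{R})$ are the usual spaces. The Fourier transform is $\mathcal{F}[f](t)=\int_{\mathbb{R}}e^{itx}f(x)\,dx$ (extended to $L^2(\mathbb{R})$), with inverse $\mathcal{F}^I$. Operators and SVD. $\mathcal{F}_{b,c}:L^2(\cosh(b\cdot))\to L^2(-1,1)$ is defined by $\mathcal{F}_{b,c}[f](x)=\mathcal{F}[f](cx)$, and $\mathcal{F}_{b,c}^*$ is its Hermitian adjoint. For $a>0$, $\mathcal{Q}_a$ on $L^2(-1,1)$ is $\mathcal{Q}_a[h](x)=\int_{-1}^1\pi a\,\mathrm{sech}\left(\frac{\pi a}{2}(x-y)\right)h(y)\,dy$, a trace class, symmetric, positive operator with positive eigenvalues $(\rho_m^a)_{m\in\mathbb{N}_0}$ in decreasing order repeated according to multiplicity and real valued eigenfunctions $(g_m^a)_{m\in\mathbb{N}_0}$ orthonormal in $L^2(-1,1)$. One has $c\mathcal{F}_{b,c}\mathcal{F}_{b,c}^*=\mathcal{Q}_{c/b}$, and the SVD $(\sigma_m^{b,c},\varphi_m^{b,c},g_m^{c/b})_{m\in\mathbb{N}_0}$ of $\mathcal{F}_{b,c}$ is given by $\sigma_m^{b,c}=\sqrt{\rho_m^{c/b}/c}$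 and $\varphi_m^{b,c}=\mathcal{F}_{b,c}^*g_m^{c/b}/\sigma_m^{b,c}$. Observation model. For $\delta>0$, $\xi\in L^2(-1,1)$ with $\|\xi\|_{L^2(-1,1)}\le1$, and $f\in L^2(\mathbb{R})$ with $\mathcal{F}[f]\in L^2(\cosh(b\cdot))$, one observes $f_\delta(cx+x_0)=f(cx+x_0)+\delta\xi(x)$ for a.e. $x\in(-1,1)$. Approximation. For $N\in\mathbb{N}_0$, $$F_\delta^N=\sum_{m\le N}\frac{1}{\sigma_m^{b,c}}\left\langle f_\delta(c\cdot+x_0),g_m^{c/b}\right\rangle_{L^2(-1,1)}\varphi_m^{b,c},\qquad f_\delta^N(\cdot)=2\pi\,\mathcal{F}^I\left[F_\delta^N\right](x_0-\cdot).$$ Source condition. For a sequence $\omega=(\omega_m)_{m\in\mathbb{N}_0}$, $\mathcal{H}^{b,c}_{\omega,x_0}(M)$ is the set of $f\in L^2(\mathbb{R})$ with $\mathcal{F}[f]\in L^2(\cosh(b\cdot))$ such that $$\sum_{m\in\mathbb{N}_0}\omega_m^2\left|\left\langle\mathcal{F}[f(x_0-\cdot)],\varphi_m^{b,c}\right\rangle_{L^2(\cosh(b\cdot))}\right|^2\le M^2 .$$ The function $\beta$. With $c_0=0.12059$, for $a>0$, $$\beta(a)=\log\left(\frac{7e^2\pi}{2a}\right)\text{ if }a\le c_0,\qquad \beta(a)=\frac{\pi}{4a}\text{ if }a>c_0 .$$ *)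

theory Defs
  imports "HOL-Analysis.Analysis" "HOL-Library.Landau_Symbols"
begin

section \<open>Spaces of square integrable functions\<close>

text \<open>Elements of the spaces are Borel representatives; equality in the spaces is equality
  almost everywhere.\<close>

definition L2 :: "'a measure \<Rightarrow> ('a \<Rightarrow> complex) set" where
  "L2 M = {f \<in> borel_measurable M. integrable M (\<lambda>x. (cmod (f x))\<^sup>2)}"

definition L2_inner :: "'a measure \<Rightarrow> ('a \<Rightarrow> complex) \<Rightarrow> ('a \<Rightarrow> complex) \<Rightarrow> complex" where
  "L2_inner M f g = (LINT x|M. f x * cnj (g x))"

text \<open>The norm is infinite outside the space, so that a finite value always carries
  square integrability with it.\<close>

definition L2_norm :: "'a measure \<Rightarrow> ('a \<Rightarrow> complex) \<Rightarrow> ennreal" where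
  "L2_norm M f = (if f \<in> L2 M then ennreal (sqrt (LINT x|M. (cmod (f x))\<^sup>2)) else \<infinity>)"

definition cosh_measure :: "real \<Rightarrow> real measure" where
  "cosh_measure b = density lborel (\<lambda>x. ennreal (cosh (b * x)))"

definition unit_interval_measure :: "real measure" where
  "unit_interval_measure = restrict_space lborel {-1<..<1}"


section \<open>Fourier transform\<close>

definition fourier_integral :: "(real \<Rightarrow> complex) \<Rightarrow> real \<Rightarrow> complex" where
  "fourier_integral f t = (LINT x|lborel. cis (t * x) * f x)"

text \<open>On \<open>L\<^sup>1\<close> the transform is given by the integral; elsewhere it is the continuous extension
  from \<open>L\<^sup>1 \<inter> L\<^sup>2\<close> to \<open>L\<^sup>2\<close>, which is unique almost everywhere.\<close>

definition fourier :: "(real \<Rightarrow> complex) \<Rightarrow> real \<Rightarrow> complex" where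
  "fourier f =
    (if integrable lborel f then fourier_integral f
     else (SOME h. h \<in> L2 lborel \<and>
       (\<forall>u :: nat \<Rightarrow> real \<Rightarrow> complex.
          (\<forall>n. u n \<in> L2 lborel \<and> integrable lborel (u n)) \<and>
          (\<lambda>n. L2_norm lborel (\<lambda>x. u n x - f x)) \<longlonglongrightarrow> 0 \<longrightarrow>
          (\<lambda>n. L2_norm lborel (\<lambda>t. fourier_integral (u n) t - h t)) \<longlonglongrightarrow> 0)))"

definition fourier_inv :: "(real \<Rightarrow> complex) \<Rightarrow> real \<Rightarrow> complex" where
  "fourier_inv h = (SOME f. f \<in> L2 lborel \<and> (AE t in lborel. fourier f t = h t))"


section \<open>The operators and the singular value decomposition\<close>

definition Fop :: "real \<Rightarrow> (real \<Rightarrow> complex) \<Rightarrow> real \<Rightarrow> complex" where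
  "Fop c f x = fourier f (c * x)"

text \<open>The adjoint depends on \<open>b\<close> through the weighted inner product on the domain of
  \<open>Fop c\<close>; its values are unique almost everywhere.\<close>

definition Fop_adj :: "real \<Rightarrow> real \<Rightarrow> (real \<Rightarrow> complex) \<Rightarrow> real \<Rightarrow> complex" where
  "Fop_adj b c h = (SOME u. u \<in> L2 (cosh_measure b) \<and>
     (\<forall>f \<in> L2 (cosh_measure b).
        L2_inner unit_interval_measure (Fop c f) h = L2_inner (cosh_measure b) f u))"

definition Qop :: "real \<Rightarrow> (real \<Rightarrow> complex) \<Rightarrow> real \<Rightarrow> complex" where
  "Qop a h x = (LINT y|unit_interval_measure.
     complex_of_real (pi * a / cosh (pi * a / 2 * (x - y))) * h y)"

text \<open>The last conjunct says that the eigenspace of every positive \<open>r\<close> is spanned by the \<open>g m\<close>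
  with \<open>\<rho> m = r\<close>: every positive eigenvalue is listed, as often as its multiplicity.\<close>

definition eigensystem :: "real \<Rightarrow> (nat \<Rightarrow> real) \<Rightarrow> (nat \<Rightarrow> real \<Rightarrow> real) \<Rightarrow> bool" where
  "eigensystem a \<rho> g \<longleftrightarrow>
     (\<forall>m. \<rho> m > 0) \<and> decseq \<rho> \<and>
     (\<forall>m. (\<lambda>x. complex_of_real (g m x)) \<in> L2 unit_interval_measure) \<and>
     (\<forall>m n. L2_inner unit_interval_measure
        (\<lambda>x. complex_of_real (g m x)) (\<lambda>x. complex_of_real (g n x)) = (if m = n then 1 else 0)) \<and>
     (\<forall>m. AE x in unit_interval_measure.
        Qop a (\<lambda>y. complex_of_real (g m y)) x = complex_of_real (\<rho> m * g m x)) \<and>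
     (\<forall>r > 0. \<forall>h \<in> L2 unit_interval_measure.
        (AE x in unit_interval_measure. Qop a h x = complex_of_real r * h x) \<longrightarrow>
        (\<exists>A k. finite A \<and> A \<subseteq> {m. \<rho> m = r} \<and>
           (AE x in unit_interval_measure. h x = (\<Sum>m\<in>A. k m * complex_of_real (g m x)))))"

text \<open>Below, \<open>\<rho>\<close> and \<open>g\<close> stand for an eigensystem of \<open>Qop (c / b)\<close>.\<close>

definition sing_val :: "real \<Rightarrow> (nat \<Rightarrow> real) \<Rightarrow> nat \<Rightarrow> real" where
  "sing_val c \<rho> m = sqrt (\<rho> m / c)"

definition sing_fun ::
  "real \<Rightarrow> real \<Rightarrow> (nat \<Rightarrow> real) \<Rightarrow> (nat \<Rightarrow> real \<Rightarrow> real) \<Rightarrow> nat \<Rightarrow> real \<Rightarrow> complex" where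
  "sing_fun b c \<rho> g m x =
     Fop_adj b c (\<lambda>y. complex_of_real (g m y)) x / complex_of_real (sing_val c \<rho> m)"


section \<open>Observation, approximation, source condition\<close>

text \<open>\<open>observed c x0 \<delta> f \<xi> (c * x + x0) = f (c * x + x0) + \<delta> * \<xi> x\<close> when \<open>c \<noteq> 0\<close>; only the
  values at such points with \<open>\<bar>x\<bar> < 1\<close> are used.\<close>

definition observed ::
  "real \<Rightarrow> real \<Rightarrow> real \<Rightarrow> (real \<Rightarrow> complex) \<Rightarrow> (real \<Rightarrow> complex) \<Rightarrow> real \<Rightarrow> complex" where
  "observed c x0 \<delta> f \<xi> y = f y + complex_of_real \<delta> * \<xi> ((y - x0) / c)"

definition F_approx ::
  "real \<Rightarrow> real \<Rightarrow> real \<Rightarrow> (nat \<Rightarrow> real) \<Rightarrow> (nat \<Rightarrow> real \<Rightarrow> real) \<Rightarrow> nat \<Rightarrow>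
   (real \<Rightarrow> complex) \<Rightarrow> real \<Rightarrow> complex" where
  "F_approx b c x0 \<rho> g N fd t =
     (\<Sum>m\<le>N. 1 / complex_of_real (sing_val c \<rho> m) *
        L2_inner unit_interval_measure (\<lambda>x. fd (c * x + x0)) (\<lambda>x. complex_of_real (g m x)) *
        sing_fun b c \<rho> g m t)"

definition f_approx ::
  "real \<Rightarrow> real \<Rightarrow> real \<Rightarrow> (nat \<Rightarrow> real) \<Rightarrow> (nat \<Rightarrow> real \<Rightarrow> real) \<Rightarrow> nat \<Rightarrow>
   (real \<Rightarrow> complex) \<Rightarrow> real \<Rightarrow> complex" where
  "f_approx b c x0 \<rho> g N fd x =
     complex_of_real (2 * pi) * fourier_inv (F_approx b c x0 \<rho> g N fd) (x0 - x)"

definition source_set ::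
  "real \<Rightarrow> real \<Rightarrow> real \<Rightarrow> (nat \<Rightarrow> real) \<Rightarrow> (nat \<Rightarrow> real \<Rightarrow> real) \<Rightarrow> (nat \<Rightarrow> real) \<Rightarrow> real \<Rightarrow>
   (real \<Rightarrow> complex) set" where
  "source_set b c x0 \<rho> g \<omega> M =
     {f \<in> L2 lborel. fourier f \<in> L2 (cosh_measure b) \<and>
        (\<Sum>m. ennreal ((\<omega> m)\<^sup>2 *
           (cmod (L2_inner (cosh_measure b)
              (fourier (\<lambda>x. f (x0 - x))) (sing_fun b c \<rho> g m)))\<^sup>2)) \<le> ennreal (M\<^sup>2)}"

definition beta_fun :: "real \<Rightarrow> real" where
  "beta_fun a = (if a \<le> 0.12059 then ln (7 * (exp 1)\<^sup>2 * pi / (2 * a)) else pi / (4 * a))"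

definition worst_error ::
  "real \<Rightarrow> real \<Rightarrow> real \<Rightarrow> (nat \<Rightarrow> real) \<Rightarrow> (nat \<Rightarrow> real \<Rightarrow> real) \<Rightarrow> (nat \<Rightarrow> real) \<Rightarrow> real \<Rightarrow>
   nat \<Rightarrow> real \<Rightarrow> ennreal" where
  "worst_error b c x0 \<rho> g \<omega> M N \<delta> =
     (SUP (f, \<xi>) \<in> source_set b c x0 \<rho> g \<omega> M \<times> {\<xi>. L2_norm unit_interval_measure \<xi> \<le> 1}.
        L2_norm lborel (\<lambda>x. f_approx b c x0 \<rho> g N (observed c x0 \<delta> f \<xi>) x - f x))"

text \<open>Landau notation as \<open>\<delta> \<rightarrow> 0\<close> for extended nonnegative quantities; the finiteness clause is
  needed because \<open>enn2real \<infinity> = 0\<close>.\<close>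

definition bigo_at_0 :: "(real \<Rightarrow> ennreal) \<Rightarrow> (real \<Rightarrow> real) \<Rightarrow> bool" where
  "bigo_at_0 E r \<longleftrightarrow>
     (\<forall>\<^sub>F \<delta> in at_right 0. E \<delta> < \<infinity>) \<and> (\<lambda>\<delta>. enn2real (E \<delta>)) \<in> O[at_right 0](r)"

end

theory Submission
  imports Defs "HOL-Probability.Probability" "HOL-Complex_Analysis.Complex_Analysis"
begin

text \<open>Plancherel identifies the squared error, up to a constant, with that of the transform, and the
  norm of \<open>L2 (cosh_measure b)\<close> dominates that of \<open>L2 lborel\<close>. There the singular functions are
  orthonormal, and they are total: the integral operator is compact, so that its kernel contains
  every function orthogonal to the eigenfunctions, and \<open>Fop\<close> is injective because the transform of
  \<open>u \<in> L2 (cosh_measure b)\<close> is analytic. Hence the error is at most a constant times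
  \<open>\<delta> / \<sigma>\<^sub>N + M / \<omega>\<^sub>N\<^sub>+\<^sub>1\<close>.

  The choice of \<open>N\<close> then needs \<open>\<rho>\<^sub>N \<ge> C exp (- 2 \<beta> N)\<close>. By the minimax principle it suffices to test the
  quadratic form on step functions with \<open>N + 1\<close> cells, whose transforms are essentially
  trigonometric polynomials \<open>P\<close> of degree \<open>N\<close>. Over a full period Parseval gives the rate
  \<open>\<pi> / (4 a)\<close>. For small \<open>a\<close> it is better to integrate only over an arc proportional to \<open>a\<close>, where the
  weight has decayed less; a Remez inequality bounds the loss for \<open>P\<close>.\<close>

section \<open>The space of square integrable functions\<close>

text \<open>The transform on L2, its inverse and the adjoint are choices determined only almost
  everywhere, so each is tied to an explicit representative (\<open>fourier_integral\<close>,
  \<open>Astar\<close>) before anything is computed. The eigenpairs are just as abstract: all that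
  is known of them is \<open>eigensystem\<close>, and estimates on \<open>\<rho>\<close> go through
  the quadratic form of the operator. The kernel enters because the transform of sech is again a
  sech, which makes \<open>Fop\<close> after its adjoint equal to \<open>Qop (c / b)\<close> up to
  the factor 1 / c. Constants of \<open>beta_fun\<close>, with a = c / b: testing on the arc of half
  length T costs about (4 e / T)^(2 N) in the Remez inequality and exp (T N / (2 a)) in the weight.
  The product is least at T = 4 a, where it is (e^2 / a)^(2 N). The factor 7 \<pi> / 2 left inside
  the logarithm is slack that absorbs the polynomial factor (N + 1)^2. The threshold 0.12059 is
  close to the point where the two formulas agree.\<close>

lemma borel_measurable_cnj [measurable (raw)]:
  "f \<in> borel_measurable M \<Longrightarrow> (\<lambda>x. cnj (f x)) \<in> borel_measurable M"
  by (rule borel_measurable_continuous_on[OF continuous_on_cnj[OF continuous_on_id]])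

text \<open>A real value spares the estimates any extended arithmetic. Outside \<open>L2\<close> the
  integral defaults to 0 and the value carries no information, so membership is always stated
  alongside.\<close>

definition L2n :: "'a measure \<Rightarrow> ('a \<Rightarrow> complex) \<Rightarrow> real" where
  "L2n M f = sqrt (LINT x|M. (cmod (f x))\<^sup>2)"

lemma L2I: "f \<in> borel_measurable M \<Longrightarrow> integrable M (\<lambda>x. (cmod (f x))\<^sup>2) \<Longrightarrow> f \<in> L2 M"
  by (simp add: L2_def)

lemma L2_measurable: "f \<in> L2 M \<Longrightarrow> f \<in> borel_measurable M"
  by (simp add: L2_def)

lemma L2_integrable: "f \<in> L2 M \<Longrightarrow> integrable M (\<lambda>x. (cmod (f x))\<^sup>2)"
  by (simp add: L2_def)

lemma L2_norm_eq: "f \<in> L2 M \<Longrightarrow> L2_norm M f = ennreal (L2n M f)"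
  by (simp add: L2_norm_def L2n_def)

lemma L2n_nonneg [simp]: "0 \<le> L2n M f"
  by (simp add: L2n_def)

lemma L2n_sq: "(L2n M f)\<^sup>2 = (LINT x|M. (cmod (f x))\<^sup>2)"
  by (simp add: L2n_def)

lemma L2_bound:
  assumes "f \<in> borel_measurable M" "integrable M w" "\<And>x. x \<in> space M \<Longrightarrow> (cmod (f x))\<^sup>2 \<le> w x"
  shows "f \<in> L2 M"
proof (rule L2I[OF assms(1)])
  note [measurable] = assms(1)
  show "integrable M (\<lambda>x. (cmod (f x))\<^sup>2)"
  proof (rule Bochner_Integration.integrable_bound[OF assms(2)])
    show "AE x in M. norm ((cmod (f x))\<^sup>2) \<le> norm (w x)"
    proof (rule AE_I2)
      fix x assume "x \<in> space M"
      then show "norm ((cmod (f x))\<^sup>2) \<le> norm (w x)"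
        using assms(3)[of x] by auto
    qed
  qed measurable
qed

lemma L2_integrable_mult:
  assumes "f \<in> L2 M" "g \<in> L2 M"
  shows "integrable M (\<lambda>x. f x * g x)"
proof (rule Bochner_Integration.integrable_bound)
  show "integrable M (\<lambda>x. (cmod (f x))\<^sup>2 + (cmod (g x))\<^sup>2)"
    using assms by (intro Bochner_Integration.integrable_add L2_integrable)
  show "(\<lambda>x. f x * g x) \<in> borel_measurable M"
    using assms[THEN L2_measurable] by measurable
  show "AE x in M. norm (f x * g x) \<le> norm ((cmod (f x))\<^sup>2 + (cmod (g x))\<^sup>2)"
  proof (rule AE_I2)
    fix x
    have "0 \<le> (cmod (f x) - cmod (g x))\<^sup>2 + (cmod (f x))\<^sup>2 + (cmod (g x))\<^sup>2"
      by simp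
    then show "norm (f x * g x) \<le> norm ((cmod (f x))\<^sup>2 + (cmod (g x))\<^sup>2)"
      by (simp add: norm_mult power2_eq_square algebra_simps)
  qed
qed

lemma L2_cnj: "f \<in> L2 M \<Longrightarrow> (\<lambda>x. cnj (f x)) \<in> L2 M"
  by (auto simp: L2_def)

lemma L2_integrable_cnj: "f \<in> L2 M \<Longrightarrow> g \<in> L2 M \<Longrightarrow> integrable M (\<lambda>x. f x * cnj (g x))"
  by (intro L2_integrable_mult L2_cnj)

lemma cmod_add_sq_le: "(cmod (a + b))\<^sup>2 \<le> 2 * (cmod a)\<^sup>2 + 2 * (cmod b)\<^sup>2"
proof -
  have "(cmod (a + b))\<^sup>2 \<le> (cmod a + cmod b)\<^sup>2"
    by (intro power_mono norm_triangle_ineq) simp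
  also have "\<dots> \<le> (cmod a + cmod b)\<^sup>2 + (cmod a - cmod b)\<^sup>2" by simp
  also have "\<dots> = 2 * (cmod a)\<^sup>2 + 2 * (cmod b)\<^sup>2"
    by (simp add: power2_eq_square algebra_simps)
  finally show ?thesis .
qed

lemma L2_add:
  assumes "f \<in> L2 M" "g \<in> L2 M"
  shows "(\<lambda>x. f x + g x) \<in> L2 M"
proof (rule L2_bound)
  show "integrable M (\<lambda>x. 2 * (cmod (f x))\<^sup>2 + 2 * (cmod (g x))\<^sup>2)"
    using assms[THEN L2_integrable] by auto
  show "(\<lambda>x. f x + g x) \<in> borel_measurable M"
    using assms[THEN L2_measurable] by measurable
qed (rule cmod_add_sq_le)

lemma L2_cmult:
  assumes "f \<in> L2 M"
  shows "(\<lambda>x. k * f x) \<in> L2 M"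
proof (rule L2_bound)
  show "integrable M (\<lambda>x. (cmod k)\<^sup>2 * (cmod (f x))\<^sup>2)"
    using assms[THEN L2_integrable] by auto
  show "(\<lambda>x. k * f x) \<in> borel_measurable M"
    using assms[THEN L2_measurable] by measurable
qed (simp add: norm_mult power_mult_distrib)

lemma L2_zero: "(\<lambda>x. 0) \<in> L2 M"
  by (simp add: L2_def)

lemma L2_diff: "f \<in> L2 M \<Longrightarrow> g \<in> L2 M \<Longrightarrow> (\<lambda>x. f x - g x) \<in> L2 M"
  using L2_add[of f M "\<lambda>x. -1 * g x"] L2_cmult[of g M "-1"] by simp

lemma L2_sum: "(\<And>i. i \<in> I \<Longrightarrow> f i \<in> L2 M) \<Longrightarrow> (\<lambda>x. \<Sum>i\<in>I. f i x) \<in> L2 M"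
proof (induction I rule: infinite_finite_induct)
  case (insert i I)
  then show ?case using L2_add[of "f i" M "\<lambda>x. \<Sum>i\<in>I. f i x"] by simp
qed (auto intro: L2_zero)

lemma L2_inner_commute: "L2_inner M g f = cnj (L2_inner M f g)"
proof -
  have "cnj (L2_inner M f g) = (LINT x|M. cnj (f x * cnj (g x)))"
    unfolding L2_inner_def by (rule Bochner_Integration.integral_cnj[symmetric])
  then show ?thesis by (simp add: L2_inner_def mult.commute)
qed

lemma L2_inner_add:
  "f \<in> L2 M \<Longrightarrow> g \<in> L2 M \<Longrightarrow> h \<in> L2 M \<Longrightarrow>
    L2_inner M (\<lambda>x. f x + g x) h = L2_inner M f h + L2_inner M g h"
  by (simp add: L2_inner_def ring_distribs L2_integrable_cnj)

lemma L2_inner_diff: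
  "f \<in> L2 M \<Longrightarrow> g \<in> L2 M \<Longrightarrow> h \<in> L2 M \<Longrightarrow>
    L2_inner M (\<lambda>x. f x - g x) h = L2_inner M f h - L2_inner M g h"
  by (simp add: L2_inner_def left_diff_distrib L2_integrable_cnj)

lemma L2_inner_cmult: "L2_inner M (\<lambda>x. k * f x) h = k * L2_inner M f h"
  by (simp add: L2_inner_def mult.assoc)

lemma L2_inner_sum:
  "(\<And>i. i \<in> I \<Longrightarrow> f i \<in> L2 M) \<Longrightarrow> h \<in> L2 M \<Longrightarrow>
    L2_inner M (\<lambda>x. \<Sum>i\<in>I. f i x) h = (\<Sum>i\<in>I. L2_inner M (f i) h)"
  by (simp add: L2_inner_def sum_distrib_right L2_integrable_cnj)

lemma L2_inner_add_right:
  "f \<in> L2 M \<Longrightarrow> g \<in> L2 M \<Longrightarrow> h \<in> L2 M \<Longrightarrow>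
    L2_inner M h (\<lambda>x. f x + g x) = L2_inner M h f + L2_inner M h g"
  by (simp add: L2_inner_def ring_distribs L2_integrable_cnj)

lemma L2_inner_diff_right:
  "f \<in> L2 M \<Longrightarrow> g \<in> L2 M \<Longrightarrow> h \<in> L2 M \<Longrightarrow>
    L2_inner M h (\<lambda>x. f x - g x) = L2_inner M h f - L2_inner M h g"
  by (simp add: L2_inner_def right_diff_distrib L2_integrable_cnj)

lemma L2_inner_cmult_right: "L2_inner M h (\<lambda>x. k * f x) = cnj k * L2_inner M h f"
  using L2_inner_cmult[of M k f h] L2_inner_commute[of M h f] L2_inner_commute[of M h "\<lambda>x. k * f x"]
  by simp

lemma L2_inner_sum_right:
  "(\<And>i. i \<in> I \<Longrightarrow> f i \<in> L2 M) \<Longrightarrow> h \<in> L2 M \<Longrightarrow>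
    L2_inner M h (\<lambda>x. \<Sum>i\<in>I. f i x) = (\<Sum>i\<in>I. L2_inner M h (f i))"
proof -
  assume "\<And>i. i \<in> I \<Longrightarrow> f i \<in> L2 M" "h \<in> L2 M"
  then have "cnj (L2_inner M (\<lambda>x. \<Sum>i\<in>I. f i x) h) = cnj (\<Sum>i\<in>I. L2_inner M (f i) h)"
    using L2_inner_sum by metis
  then show ?thesis
    unfolding cnj_sum L2_inner_commute[symmetric] .
qed

lemma L2_inner_cong_AE:
  assumes "AE x in M. f x = f' x" "AE x in M. g x = g' x"
    and "f \<in> borel_measurable M" "f' \<in> borel_measurable M"
    and "g \<in> borel_measurable M" "g' \<in> borel_measurable M"
  shows "L2_inner M f g = L2_inner M f' g'"
  unfolding L2_inner_def
proof (rule integral_cong_AE)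
  show "AE x in M. f x * cnj (g x) = f' x * cnj (g' x)"
    using assms(1,2) by eventually_elim simp
qed (use assms in measurable)

lemma L2n_cong_AE:
  assumes "AE x in M. f x = f' x" "f \<in> borel_measurable M" "f' \<in> borel_measurable M"
  shows "L2n M f = L2n M f'"
proof -
  have "(LINT x|M. (cmod (f x))\<^sup>2) = (LINT x|M. (cmod (f' x))\<^sup>2)"
  proof (rule integral_cong_AE)
    show "AE x in M. (cmod (f x))\<^sup>2 = (cmod (f' x))\<^sup>2"
      using assms(1) by eventually_elim simp
  qed (use assms in measurable)
  then show ?thesis by (simp add: L2n_def)
qed

lemma L2_cong_AE:
  assumes "AE x in M. f x = f' x" "f \<in> L2 M" "f' \<in> borel_measurable M"
  shows "f' \<in> L2 M"
proof (rule L2I[OF assms(3)])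
  note [measurable] = L2_measurable[OF assms(2)] assms(3)
  show "integrable M (\<lambda>x. (cmod (f' x))\<^sup>2)"
  proof (rule integrable_cong_AE_imp[OF L2_integrable[OF assms(2)]])
    show "AE x in M. (cmod (f x))\<^sup>2 = (cmod (f' x))\<^sup>2"
      using assms(1) by eventually_elim simp
  qed measurable
qed

lemma L2_inner_self: "L2_inner M f f = of_real ((L2n M f)\<^sup>2)"
  unfolding L2_inner_def complex_norm_square[symmetric] L2n_sq by (rule integral_complex_of_real)

lemma L2n_diff_sq:
  assumes "f \<in> L2 M" "g \<in> L2 M"
  shows "(L2n M (\<lambda>x. f x - g x))\<^sup>2 = (L2n M f)\<^sup>2 + (L2n M g)\<^sup>2 - 2 * Re (L2_inner M f g)"
proof -
  have fg: "(\<lambda>x. f x - g x) \<in> L2 M" by (rule L2_diff[OF assms])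
  have "complex_of_real ((L2n M (\<lambda>x. f x - g x))\<^sup>2) =
      L2_inner M f f - L2_inner M g f - (L2_inner M f g - L2_inner M g g)"
    unfolding L2_inner_self[symmetric]
    by (simp add: L2_inner_diff L2_inner_diff_right assms fg)
  then have "(L2n M (\<lambda>x. f x - g x))\<^sup>2 =
      Re (L2_inner M f f - L2_inner M g f - (L2_inner M f g - L2_inner M g g))"
    by (metis Re_complex_of_real)
  also have "L2_inner M g f = cnj (L2_inner M f g)" by (rule L2_inner_commute)
  finally show ?thesis by (simp add: L2_inner_self)
qed

lemma L2n_add_sq:
  assumes "f \<in> L2 M" "g \<in> L2 M"
  shows "(L2n M (\<lambda>x. f x + g x))\<^sup>2 = (L2n M f)\<^sup>2 + (L2n M g)\<^sup>2 + 2 * Re (L2_inner M f g)"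
proof -
  have "(L2n M (\<lambda>x. -1 * g x))\<^sup>2 = (L2n M g)\<^sup>2" by (simp add: L2n_def)
  moreover have "L2_inner M f (\<lambda>x. -1 * g x) = - L2_inner M f g"
    by (subst L2_inner_cmult_right) simp
  ultimately show ?thesis
    using L2n_diff_sq[OF assms(1) L2_cmult[OF assms(2), of "-1"]] by simp
qed

lemma L2n_cmult: "L2n M (\<lambda>x. k * f x) = cmod k * L2n M f"
  by (simp add: L2n_def norm_mult power_mult_distrib real_sqrt_mult)

lemma L2n_minus_commute: "L2n M (\<lambda>x. f x - g x) = L2n M (\<lambda>x. g x - f x)"
  by (simp add: L2n_def norm_minus_commute)

text \<open>Integrating the square of |f| - t |g| gives a quadratic in t that is never negative; for
  G > 0 its minimiser t = I / G yields the inequality.\<close>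

lemma L2_Cauchy_Schwarz:
  assumes "f \<in> L2 M" "g \<in> L2 M"
  shows "(LINT x|M. cmod (f x * g x)) \<le> L2n M f * L2n M g"
proof -
  define F G I where "F = (LINT x|M. (cmod (f x))\<^sup>2)" "G = (LINT x|M. (cmod (g x))\<^sup>2)"
    "I = (LINT x|M. cmod (f x * g x))"
  have int: "integrable M (\<lambda>x. cmod (f x * g x))"
    using L2_integrable_mult[OF assms] by auto
  note ints = assms[THEN L2_integrable]
  have nn: "F \<ge> 0" "G \<ge> 0" "I \<ge> 0" by (auto simp: F_G_I_def)
  have q: "2 * t * I \<le> F + t\<^sup>2 * G" for t
  proof -
    have "2 * t * I = (LINT x|M. 2 * t * cmod (f x * g x))"
      by (simp add: F_G_I_def)
    also have "\<dots> \<le> (LINT x|M. (cmod (f x))\<^sup>2 + t\<^sup>2 * (cmod (g x))\<^sup>2)"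
    proof (rule integral_mono)
      fix x
      have "0 \<le> (cmod (f x) - t * cmod (g x))\<^sup>2" by simp
      then show "2 * t * cmod (f x * g x) \<le> (cmod (f x))\<^sup>2 + t\<^sup>2 * (cmod (g x))\<^sup>2"
        by (simp add: power2_eq_square algebra_simps norm_mult)
    qed (use int ints in auto)
    also have "\<dots> = F + t\<^sup>2 * G" using ints by (simp add: F_G_I_def)
    finally show ?thesis .
  qed
  have "I\<^sup>2 \<le> F * G"
  proof (cases "G = 0")
    case True
    have "I = 0"
    proof (rule ccontr)
      assume "I \<noteq> 0"
      with nn have "I > 0" by simp
      \<comment> \<open>With G = 0 the bound reads 2 t I <= F for every t; this t turns it into F +
        1 <= F.\<close>
      from q[of "(F + 1) / (2 * I)"] True \<open>I > 0\<close> show False by (simp add: field_simps)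
    qed
    with True show ?thesis by simp
  next
    case False
    with nn have G: "G > 0" by simp
    from q[of "I / G"] G show ?thesis
      by (simp add: power2_eq_square field_simps)
  qed
  then have "I \<le> sqrt (F * G)" by (simp add: real_le_rsqrt)
  then show ?thesis by (simp add: F_G_I_def L2n_def real_sqrt_mult)
qed

lemma L2_inner_bound:
  assumes "f \<in> L2 M" "g \<in> L2 M"
  shows "cmod (L2_inner M f g) \<le> L2n M f * L2n M g"
proof -
  have "cmod (L2_inner M f g) \<le> (LINT x|M. cmod (f x * cnj (g x)))"
    unfolding L2_inner_def by (rule integral_norm_bound)
  also have "\<dots> \<le> L2n M f * L2n M (\<lambda>x. cnj (g x))"
    by (rule L2_Cauchy_Schwarz[OF assms(1) L2_cnj[OF assms(2)]])
  finally show ?thesis by (simp add: L2n_def)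
qed

lemma L2n_triangle:
  assumes "f \<in> L2 M" "g \<in> L2 M"
  shows "L2n M (\<lambda>x. f x + g x) \<le> L2n M f + L2n M g"
proof (rule power2_le_imp_le)
  have "Re (L2_inner M f g) \<le> L2n M f * L2n M g"
    using L2_inner_bound[OF assms] complex_Re_le_cmod order_trans by blast
  then show "(L2n M (\<lambda>x. f x + g x))\<^sup>2 \<le> (L2n M f + L2n M g)\<^sup>2"
    unfolding L2n_add_sq[OF assms] by (simp add: power2_sum)
qed simp

lemma L2n_triangle_diff:
  assumes "f \<in> L2 M" "g \<in> L2 M"
  shows "L2n M (\<lambda>x. f x - g x) \<le> L2n M f + L2n M g"
  using L2n_triangle[OF assms(1) L2_cmult[OF assms(2), of "-1"]] L2n_cmult[of M "-1" g] by simp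

lemma L2n_triangle_via:
  assumes "f \<in> L2 M" "g \<in> L2 M" "h \<in> L2 M"
  shows "L2n M (\<lambda>x. f x - g x) \<le> L2n M (\<lambda>x. f x - h x) + L2n M (\<lambda>x. h x - g x)"
  using L2n_triangle[OF L2_diff[OF assms(1,3)] L2_diff[OF assms(3,2)]] by simp

lemma L2n_reverse_triangle:
  assumes "f \<in> L2 M" "g \<in> L2 M"
  shows "\<bar>L2n M f - L2n M g\<bar> \<le> L2n M (\<lambda>x. f x - g x)"
  using L2n_triangle[OF L2_diff[OF assms] assms(2)]
    L2n_triangle[OF L2_diff[OF assms(2,1)] assms(1)] L2n_minus_commute[of M f g] by simp

lemma L2n_eq_0_iff:
  assumes "f \<in> L2 M"
  shows "L2n M f = 0 \<longleftrightarrow> (AE x in M. f x = 0)"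
  using integral_nonneg_eq_0_iff_AE[OF L2_integrable[OF assms]] by (simp add: L2n_def)

lemma L2_inner_tendsto:
  assumes "\<And>n. f n \<in> L2 M" "f' \<in> L2 M" "\<And>n. g n \<in> L2 M" "g' \<in> L2 M"
    and "(\<lambda>n. L2n M (\<lambda>x. f n x - f' x)) \<longlonglongrightarrow> 0" "(\<lambda>n. L2n M (\<lambda>x. g n x - g' x)) \<longlonglongrightarrow> 0"
  shows "(\<lambda>n. L2_inner M (f n) (g n)) \<longlonglongrightarrow> L2_inner M f' g'"
proof -
  let ?B = "\<lambda>n. L2n M (\<lambda>x. f n x - f' x) * L2n M (\<lambda>x. g n x - g' x) +
     L2n M (\<lambda>x. f n x - f' x) * L2n M g' + L2n M f' * L2n M (\<lambda>x. g n x - g' x)"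
  have "(\<lambda>n. L2_inner M (f n) (g n) - L2_inner M f' g') \<longlonglongrightarrow> 0"
  proof (rule Lim_null_comparison)
    show "\<forall>\<^sub>F n in sequentially. norm (L2_inner M (f n) (g n) - L2_inner M f' g') \<le> ?B n"
    proof (rule always_eventually, rule allI)
      fix n
      let ?d = "\<lambda>x. f n x - f' x" and ?e = "\<lambda>x. g n x - g' x"
      have d: "?d \<in> L2 M" and e: "?e \<in> L2 M" using assms by (auto intro: L2_diff)
      have "L2_inner M (f n) (g n) = L2_inner M (\<lambda>x. ?d x + f' x) (\<lambda>x. ?e x + g' x)" by simp
      also have "\<dots> = L2_inner M ?d ?e + L2_inner M ?d g' + (L2_inner M f' ?e + L2_inner M f' g')"
        using d e assms L2_add[OF e assms(4)]
        by (simp only: L2_inner_add L2_inner_add_right)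
      finally have "norm (L2_inner M (f n) (g n) - L2_inner M f' g') =
          norm (L2_inner M ?d ?e + L2_inner M ?d g' + L2_inner M f' ?e)" by (simp add: algebra_simps)
      also have "\<dots> \<le> norm (L2_inner M ?d ?e) + norm (L2_inner M ?d g') + norm (L2_inner M f' ?e)"
        by (rule norm_triangle_le, intro add_mono norm_triangle_ineq order_refl)
      also have "\<dots> \<le> ?B n"
        using d e assms by (intro add_mono L2_inner_bound)
      finally show "norm (L2_inner M (f n) (g n) - L2_inner M f' g') \<le> ?B n" .
    qed
    show "?B \<longlonglongrightarrow> 0"
      using tendsto_add[OF tendsto_add[OF tendsto_mult[OF assms(5,6)]
        tendsto_mult[OF assms(5) tendsto_const[of "L2n M g'"]]]
        tendsto_mult[OF tendsto_const[of "L2n M f'"] assms(6)]] by simp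
  qed
  then show ?thesis by (simp add: LIM_zero_iff)
qed

lemma L2n_tendsto:
  assumes "\<And>n. f n \<in> L2 M" "f' \<in> L2 M" "(\<lambda>n. L2n M (\<lambda>x. f n x - f' x)) \<longlonglongrightarrow> 0"
  shows "(\<lambda>n. L2n M (f n)) \<longlonglongrightarrow> L2n M f'"
proof -
  have "(\<lambda>n. L2n M (f n) - L2n M f') \<longlonglongrightarrow> 0"
    by (rule Lim_null_comparison[OF _ assms(3)])
       (auto intro!: always_eventually L2n_reverse_triangle assms(1,2))
  then show ?thesis by (simp add: LIM_zero_iff)
qed

lemma L2_limit_unique:
  assumes "\<And>n. f n \<in> L2 M" "g \<in> L2 M" "h \<in> L2 M"
    and "(\<lambda>n. L2n M (\<lambda>x. f n x - g x)) \<longlonglongrightarrow> 0" "(\<lambda>n. L2n M (\<lambda>x. f n x - h x)) \<longlonglongrightarrow> 0"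
  shows "AE x in M. g x = h x"
proof -
  have "(\<lambda>n. L2n M (\<lambda>x. f n x - g x) + L2n M (\<lambda>x. f n x - h x)) \<longlonglongrightarrow> 0"
    using tendsto_add[OF assms(4,5)] by simp
  moreover have "L2n M (\<lambda>x. g x - h x) \<le> L2n M (\<lambda>x. f n x - g x) + L2n M (\<lambda>x. f n x - h x)" for n
    using L2n_triangle_via[OF assms(2,3) assms(1)[of n]] L2n_minus_commute[of M g "f n"] by simp
  ultimately have "L2n M (\<lambda>x. g x - h x) \<le> 0"
    by (intro tendsto_lowerbound[of _ 0 sequentially]) auto
  then have "L2n M (\<lambda>x. g x - h x) = 0" using L2n_nonneg order_antisym by blast
  then show ?thesis using L2n_eq_0_iff[OF L2_diff[OF assms(2,3)]] by simp
qed

text \<open>Riesz-Fischer: a subsequence with geometrically small steps converges almost everywhere,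
  and Fatou's lemma turns the pointwise limit into a limit in norm of the whole sequence.\<close>

lemma L2_complete:
  assumes f: "\<And>n. f n \<in> L2 M"
    and C: "\<And>e. e > 0 \<Longrightarrow> \<exists>N. \<forall>m\<ge>N. \<forall>n\<ge>N. L2n M (\<lambda>x. f m x - f n x) < e"
  shows "\<exists>h\<in>L2 M. (\<lambda>n. L2n M (\<lambda>x. f n x - h x)) \<longlonglongrightarrow> 0"
proof -
  have [measurable]: "f n \<in> borel_measurable M" for n using L2_measurable[OF f] .
  have "\<exists>N. \<forall>j. \<forall>m\<ge>N j. \<forall>n\<ge>N j. L2n M (\<lambda>x. f m x - f n x) < (1/2) ^ j"
    using C by (intro choice) simp
  then obtain N where N: "\<And>j m n. m \<ge> N j \<Longrightarrow> n \<ge> N j \<Longrightarrow> L2n M (\<lambda>x. f m x - f n x) < (1/2) ^ j"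
    by blast
  \<comment> \<open>Partial sums make \<open>k\<close> monotone and at least \<open>N j\<close>; the
    summand j makes it unbounded even if all \<open>N i\<close> are 0.\<close>
  define k where "k j = (\<Sum>i\<le>j. N i) + j" for j
  have kN: "k j \<ge> N j" for j
    unfolding k_def by (simp add: member_le_sum trans_le_add1)
  have kS: "k (Suc j) \<ge> k j" for j by (simp add: k_def)
  have k_id: "k j \<ge> j" for j by (simp add: k_def)
  \<comment> \<open>The squares have integral at most (1/4)^j. A weight 2^j still leaves a
    convergent series, and finiteness of the weighted sum at a point forces \<open>d j x\<close>
    below a geometric sequence, so the telescoping series converges there.\<close>
  define d where "d j x = cmod (f (k (Suc j)) x - f (k j) x)" for j x
  have d_int: "(\<integral>\<^sup>+ x. ennreal ((d j x)\<^sup>2) \<partial>M) \<le> ennreal ((1/4) ^ j)" for j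
  proof -
    have L: "(\<lambda>x. f (k (Suc j)) x - f (k j) x) \<in> L2 M" by (intro L2_diff f)
    have "(\<integral>\<^sup>+ x. ennreal ((d j x)\<^sup>2) \<partial>M) = ennreal ((L2n M (\<lambda>x. f (k (Suc j)) x - f (k j) x))\<^sup>2)"
      unfolding d_def L2n_sq by (rule nn_integral_eq_integral[OF L2_integrable[OF L]]) simp
    also have "\<dots> \<le> ennreal (((1/2) ^ j)\<^sup>2)"
      using N[of j "k (Suc j)" "k j"] kN[of j] kS[of j]
      by (intro ennreal_leI power_mono) auto
    finally show ?thesis by (simp add: power2_eq_square flip: power_mult_distrib)
  qed
  have "(\<integral>\<^sup>+ x. (\<Sum>j. ennreal (2 ^ j * (d j x)\<^sup>2)) \<partial>M) = (\<Sum>j. \<integral>\<^sup>+ x. ennreal (2 ^ j * (d j x)\<^sup>2) \<partial>M)"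
    by (rule nn_integral_suminf) (simp add: d_def)
  also have "\<dots> \<le> (\<Sum>j. ennreal ((1/2) ^ j))"
  proof (intro suminf_le)
    fix j
    have "(\<integral>\<^sup>+ x. ennreal (2 ^ j * (d j x)\<^sup>2) \<partial>M) = ennreal (2 ^ j) * (\<integral>\<^sup>+ x. ennreal ((d j x)\<^sup>2) \<partial>M)"
      by (subst nn_integral_cmult[symmetric]) (auto simp: d_def ennreal_mult)
    also have "\<dots> \<le> ennreal (2 ^ j) * ennreal ((1/4) ^ j)"
      by (intro mult_left_mono d_int) simp
    also have "\<dots> = ennreal ((1/2) ^ j)"
      by (simp flip: ennreal_mult' power_mult_distrib)
    finally show "(\<integral>\<^sup>+ x. ennreal (2 ^ j * (d j x)\<^sup>2) \<partial>M) \<le> ennreal ((1/2) ^ j)" .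
  qed auto
  also have "\<dots> = ennreal (\<Sum>j. (1/2) ^ j)"
    by (intro suminf_ennreal2) (auto intro: summable_geometric)
  also have "\<dots> < \<infinity>" by simp
  finally have fin: "(\<integral>\<^sup>+ x. (\<Sum>j. ennreal (2 ^ j * (d j x)\<^sup>2)) \<partial>M) \<noteq> \<infinity>" by simp
  have AE1: "AE x in M. (\<Sum>j. ennreal (2 ^ j * (d j x)\<^sup>2)) \<noteq> \<infinity>"
    by (rule nn_integral_noteq_infinite[OF _ fin]) (simp add: d_def)
  \<comment> \<open>Defined at every point, so that measurability is automatic; off the set of
    convergence the value is arbitrary.\<close>
  define h where "h x = lim (\<lambda>j. f (k j) x)" for x
  have hm [measurable]: "h \<in> borel_measurable M" unfolding h_def by measurable
  have AE2: "AE x in M. (\<lambda>j. f (k j) x) \<longlonglongrightarrow> h x"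
    using AE1
  proof eventually_elim
    fix x assume A: "(\<Sum>j. ennreal (2 ^ j * (d j x)\<^sup>2)) \<noteq> \<infinity>"
    have sm: "summable (\<lambda>j. 2 ^ j * (d j x)\<^sup>2)"
      by (rule summable_suminf_not_top) (use A in auto)
    then obtain K where K: "\<And>j. 2 ^ j * (d j x)\<^sup>2 \<le> K"
      using summable_imp_Bseq[OF sm] unfolding Bseq_def by (auto simp: abs_le_iff)
    have dn: "d j x \<ge> 0" for j by (simp add: d_def)
    have "d j x \<le> sqrt K * (sqrt (1/2)) ^ j" for j
    proof -
      have "(d j x)\<^sup>2 \<le> K * (1/2) ^ j" using K[of j] by (simp add: field_simps)
      then have "d j x \<le> sqrt (K * (1/2) ^ j)" by (rule real_le_rsqrt)
      then show ?thesis by (simp add: real_sqrt_mult real_sqrt_power)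
    qed
    then have dle: "norm (d j x) \<le> sqrt K * (sqrt (1/2)) ^ j" for j
      using dn[of j] by (metis abs_of_nonneg real_norm_def)
    have "summable (\<lambda>j. sqrt K * (sqrt (1/2)) ^ j)"
      by (rule summable_mult, rule summable_geometric) simp
    then have "summable (\<lambda>j. d j x)"
      by (rule summable_comparison_test') (rule dle)
    then have "summable (\<lambda>j. f (k (Suc j)) x - f (k j) x)"
      unfolding d_def by (rule summable_norm_cancel)
    then have "convergent (\<lambda>j. \<Sum>i<j. f (k (Suc i)) x - f (k i) x)"
      by (simp add: summable_iff_convergent)
    then have "convergent (\<lambda>j. f (k j) x - f (k 0) x)"
      by (simp only: sum_lessThan_telescope[of "\<lambda>j. f (k j) x"])
    then have "convergent (\<lambda>j. f (k j) x - f (k 0) x + f (k 0) x)"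
      by (intro convergent_add convergent_const)
    then show "(\<lambda>j. f (k j) x) \<longlonglongrightarrow> h x"
      unfolding h_def by (simp add: convergent_LIMSEQ_iff)
  qed
  \<comment> \<open>Fatou in the second index: the distance of \<open>f n\<close> to the limit is at
    most the limes inferior of its distances to the subsequence.\<close>
  have key: "(\<integral>\<^sup>+ x. ennreal ((cmod (f n x - h x))\<^sup>2) \<partial>M) \<le> ennreal (((1/2) ^ i)\<^sup>2)" if n: "n \<ge> N i" for n i
  proof -
    have "(\<integral>\<^sup>+ x. ennreal ((cmod (f n x - h x))\<^sup>2) \<partial>M) =
        (\<integral>\<^sup>+ x. liminf (\<lambda>j. ennreal ((cmod (f n x - f (k j) x))\<^sup>2)) \<partial>M)"
    proof (rule nn_integral_cong_AE)
      show "AE x in M. ennreal ((cmod (f n x - h x))\<^sup>2) = liminf (\<lambda>j. ennreal ((cmod (f n x - f (k j) x))\<^sup>2))"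
        using AE2
      proof eventually_elim
        fix x assume A: "(\<lambda>j. f (k j) x) \<longlonglongrightarrow> h x"
        have "(\<lambda>j. ennreal ((cmod (f n x - f (k j) x))\<^sup>2)) \<longlonglongrightarrow> ennreal ((cmod (f n x - h x))\<^sup>2)"
          by (intro tendsto_ennrealI tendsto_power tendsto_norm tendsto_diff tendsto_const A)
        then show "ennreal ((cmod (f n x - h x))\<^sup>2) = liminf (\<lambda>j. ennreal ((cmod (f n x - f (k j) x))\<^sup>2))"
          using lim_imp_Liminf[OF sequentially_bot] by metis
      qed
    qed
    also have "\<dots> \<le> liminf (\<lambda>j. \<integral>\<^sup>+ x. ennreal ((cmod (f n x - f (k j) x))\<^sup>2) \<partial>M)"
      by (rule nn_integral_liminf) measurable
    also have "\<dots> \<le> limsup (\<lambda>j. \<integral>\<^sup>+ x. ennreal ((cmod (f n x - f (k j) x))\<^sup>2) \<partial>M)"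
      by (rule Liminf_le_Limsup) simp
    also have "\<dots> \<le> ennreal (((1/2) ^ i)\<^sup>2)"
    proof (rule Limsup_bounded, rule eventually_sequentiallyI[of "N i"])
      fix j assume "j \<ge> N i"
      with k_id[of j] have kj: "k j \<ge> N i" by simp
      have L: "(\<lambda>x. f n x - f (k j) x) \<in> L2 M" by (intro L2_diff f)
      have "(\<integral>\<^sup>+ x. ennreal ((cmod (f n x - f (k j) x))\<^sup>2) \<partial>M) = ennreal ((L2n M (\<lambda>x. f n x - f (k j) x))\<^sup>2)"
        unfolding L2n_sq by (rule nn_integral_eq_integral[OF L2_integrable[OF L]]) simp
      also have "\<dots> \<le> ennreal (((1/2) ^ i)\<^sup>2)"
        using N[OF n kj] by (intro ennreal_leI power_mono) auto
      finally show "(\<integral>\<^sup>+ x. ennreal ((cmod (f n x - f (k j) x))\<^sup>2) \<partial>M) \<le> ennreal (((1/2) ^ i)\<^sup>2)" .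
    qed
    finally show ?thesis .
  qed
  have dL: "(\<lambda>x. f n x - h x) \<in> L2 M" if n: "n \<ge> N i" for n i
  proof (rule L2I)
    show "integrable M (\<lambda>x. (cmod (f n x - h x))\<^sup>2)"
      using key[OF n] by (intro integrableI_bounded) (auto simp: top_unique less_top intro: le_less_trans)
  qed measurable
  have dn: "L2n M (\<lambda>x. f n x - h x) \<le> (1/2) ^ i" if n: "n \<ge> N i" for n i
  proof -
    have "ennreal ((L2n M (\<lambda>x. f n x - h x))\<^sup>2) = (\<integral>\<^sup>+ x. ennreal ((cmod (f n x - h x))\<^sup>2) \<partial>M)"
      unfolding L2n_sq by (rule nn_integral_eq_integral[OF L2_integrable[OF dL[OF n]], symmetric]) simp
    also note key[OF n]
    finally have "(L2n M (\<lambda>x. f n x - h x))\<^sup>2 \<le> ((1/2) ^ i)\<^sup>2"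
      by (subst (asm) ennreal_le_iff) auto
    then show ?thesis by (rule power2_le_imp_le) simp
  qed
  have hL: "h \<in> L2 M"
    using L2_diff[OF f[of "N 0"] dL[of 0 "N 0"]] by simp
  moreover have "(\<lambda>n. L2n M (\<lambda>x. f n x - h x)) \<longlonglongrightarrow> 0"
  proof (rule LIMSEQ_I)
    fix e :: real assume "e > 0"
    then obtain i where "(1/2) ^ i < e" using real_arch_pow_inv[of e "1/2"] by auto
    then show "\<exists>n0. \<forall>n\<ge>n0. norm (L2n M (\<lambda>x. f n x - h x) - 0) < e"
      using dn[of i] by (intro exI[of _ "N i"]) (auto intro: le_less_trans)
  qed
  ultimately show ?thesis by blast
qed

section \<open>Orthonormal sequences\<close>

definition L2_orthonormal :: "'a measure \<Rightarrow> (nat \<Rightarrow> 'a \<Rightarrow> complex) \<Rightarrow> bool" where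
  "L2_orthonormal M e \<longleftrightarrow> (\<forall>m. e m \<in> L2 M) \<and> (\<forall>m n. L2_inner M (e m) (e n) = (if m = n then 1 else 0))"

lemma L2_orthonormal_inner_sum:
  assumes "L2_orthonormal M e" "finite A"
  shows "L2_inner M (\<lambda>x. \<Sum>m\<in>A. k m * e m x) (e n) = (if n \<in> A then k n else 0)"
proof -
  have e: "e m \<in> L2 M" and o: "L2_inner M (e m) (e n) = (if m = n then 1 else 0)" for m n
    using assms(1) by (auto simp: L2_orthonormal_def)
  have "L2_inner M (\<lambda>x. \<Sum>m\<in>A. k m * e m x) (e n) = (\<Sum>m\<in>A. k m * (if m = n then 1 else 0))"
    by (subst L2_inner_sum) (auto intro: L2_cmult e simp: L2_inner_cmult o)
  then show ?thesis using assms(2) by (simp add: if_distrib cong: if_cong)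
qed

lemma L2_orthonormal_sum_L2:
  "L2_orthonormal M e \<Longrightarrow> (\<lambda>x. \<Sum>m\<in>A. k m * e m x) \<in> L2 M"
  by (intro L2_sum L2_cmult) (auto simp: L2_orthonormal_def)

lemma L2_orthonormal_norm_sum:
  assumes "L2_orthonormal M e" "finite A"
  shows "(L2n M (\<lambda>x. \<Sum>m\<in>A. k m * e m x))\<^sup>2 = (\<Sum>m\<in>A. (cmod (k m))\<^sup>2)"
proof -
  let ?s = "\<lambda>x. \<Sum>m\<in>A. k m * e m x"
  have e: "e m \<in> L2 M" for m using assms(1) by (auto simp: L2_orthonormal_def)
  have s: "?s \<in> L2 M" by (rule L2_orthonormal_sum_L2[OF assms(1)])
  have "L2_inner M ?s ?s = (\<Sum>m\<in>A. cnj (k m) * L2_inner M ?s (e m))"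
    by (subst L2_inner_sum_right) (auto intro: L2_cmult e s simp: L2_inner_cmult_right)
  also have "\<dots> = (\<Sum>m\<in>A. complex_of_real ((cmod (k m))\<^sup>2))"
    by (rule sum.cong) (simp_all only: L2_orthonormal_inner_sum[OF assms] complex_norm_square mult.commute if_True)
  finally have "complex_of_real ((L2n M ?s)\<^sup>2) = of_real (\<Sum>m\<in>A. (cmod (k m))\<^sup>2)"
    by (simp add: L2_inner_self)
  then show ?thesis by (simp only: of_real_eq_iff)
qed

lemma L2_Bessel:
  assumes o: "L2_orthonormal M e" and A: "finite A" and u: "u \<in> L2 M"
  shows "(L2n M (\<lambda>x. u x - (\<Sum>m\<in>A. L2_inner M u (e m) * e m x)))\<^sup>2 =
           (L2n M u)\<^sup>2 - (\<Sum>m\<in>A. (cmod (L2_inner M u (e m)))\<^sup>2)"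
proof -
  let ?s = "\<lambda>x. \<Sum>m\<in>A. L2_inner M u (e m) * e m x"
  have e: "e m \<in> L2 M" for m using o by (auto simp: L2_orthonormal_def)
  have s: "?s \<in> L2 M" by (rule L2_orthonormal_sum_L2[OF o])
  have "L2_inner M u ?s = (\<Sum>m\<in>A. cnj (L2_inner M u (e m)) * L2_inner M u (e m))"
    by (subst L2_inner_sum_right) (auto intro: L2_cmult e u simp: L2_inner_cmult_right)
  also have "\<dots> = of_real (\<Sum>m\<in>A. (cmod (L2_inner M u (e m)))\<^sup>2)"
    unfolding of_real_sum by (rule sum.cong) (simp_all only: complex_norm_square mult.commute)
  finally have "Re (L2_inner M u ?s) = (\<Sum>m\<in>A. (cmod (L2_inner M u (e m)))\<^sup>2)"
    by (simp only: Re_complex_of_real)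
  then show ?thesis
    by (simp add: L2n_diff_sq[OF u s] L2_orthonormal_norm_sum[OF o A])
qed

lemma L2_Bessel_le:
  assumes "L2_orthonormal M e" "finite A" "u \<in> L2 M"
  shows "(\<Sum>m\<in>A. (cmod (L2_inner M u (e m)))\<^sup>2) \<le> (L2n M u)\<^sup>2"
  using L2_Bessel[OF assms] zero_le_power2[of "L2n M (\<lambda>x. u x - (\<Sum>m\<in>A. L2_inner M u (e m) * e m x))"]
  by linarith

text \<open>By Bessel the partial sums form a Cauchy sequence. Their limit has the same coefficients
  as \<open>u\<close>, so the difference is orthogonal to every \<open>e m\<close> and vanishes by
  totality.\<close>

lemma L2_total_expansion:
  assumes o: "L2_orthonormal M e" and u: "u \<in> L2 M"
    and total: "\<And>v. v \<in> L2 M \<Longrightarrow> (\<And>m. L2_inner M v (e m) = 0) \<Longrightarrow> AE x in M. v x = 0"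
  shows "(\<lambda>n. L2n M (\<lambda>x. u x - (\<Sum>m<n. L2_inner M u (e m) * e m x))) \<longlonglongrightarrow> 0"
proof -
  let ?c = "\<lambda>m. L2_inner M u (e m)"
  define s where "s n x = (\<Sum>m<n. ?c m * e m x)" for n x
  have e: "e m \<in> L2 M" for m using o by (auto simp: L2_orthonormal_def)
  have s: "s n \<in> L2 M" for n
    unfolding s_def by (rule L2_orthonormal_sum_L2[OF o])
  have sm: "summable (\<lambda>m. (cmod (?c m))\<^sup>2)"
    by (rule summableI_nonneg_bounded[where x="(L2n M u)\<^sup>2"]) (auto intro: L2_Bessel_le[OF o _ u])
  have le: "(L2n M (\<lambda>x. s n x - s m x))\<^sup>2 = (\<Sum>i\<in>{m..<n}. (cmod (?c i))\<^sup>2)" if "m \<le> n" for m n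
  proof -
    have "s n x - s m x = (\<Sum>i\<in>{m..<n}. ?c i * e i x)" for x
      using that sum_diff_nat_ivl[of 0 m n "\<lambda>i. ?c i * e i x"] by (simp add: s_def atLeast0LessThan)
    then show ?thesis using L2_orthonormal_norm_sum[OF o, of "{m..<n}" ?c] by simp
  qed
  have C: "\<exists>N. \<forall>m\<ge>N. \<forall>n\<ge>N. L2n M (\<lambda>x. s m x - s n x) < r" if r: "r > 0" for r
  proof -
    obtain N where N: "\<And>m n. m \<ge> N \<Longrightarrow> norm (\<Sum>i\<in>{m..<n}. (cmod (?c i))\<^sup>2) < r\<^sup>2"
      using sm[unfolded summable_Cauchy] r by (metis zero_less_power)
    have *: "L2n M (\<lambda>x. s n x - s m x) < r" if "m \<ge> N" "m \<le> n" for m n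
    proof -
      have "(L2n M (\<lambda>x. s n x - s m x))\<^sup>2 < r\<^sup>2"
        using N[OF that(1), of n] le[OF that(2)] by simp
      then show ?thesis using r by (simp add: power_less_imp_less_base)
    qed
    show ?thesis
    proof (intro exI[of _ N] allI impI)
      fix m n assume "m \<ge> N" "n \<ge> N"
      then show "L2n M (\<lambda>x. s m x - s n x) < r"
        using *[of n m] *[of m n] L2n_minus_commute[of M "s m" "s n"] by (cases "m \<le> n") auto
    qed
  qed
  obtain v where v: "v \<in> L2 M" and lim: "(\<lambda>n. L2n M (\<lambda>x. s n x - v x)) \<longlonglongrightarrow> 0"
    using L2_complete[of s M, OF s C] by blast
  have z: "L2_inner M (\<lambda>x. u x - v x) (e m) = 0" for m
  proof -
    have "(\<lambda>n. L2_inner M (s n) (e m)) \<longlonglongrightarrow> L2_inner M v (e m)"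
      by (rule L2_inner_tendsto[OF s v e e lim]) (simp add: L2n_def)
    moreover have "(\<lambda>n. L2_inner M (s n) (e m)) \<longlonglongrightarrow> ?c m"
    proof (rule tendsto_eventually, rule eventually_sequentiallyI[of "Suc m"])
      fix n assume "Suc m \<le> n"
      then show "L2_inner M (s n) (e m) = ?c m"
        using L2_orthonormal_inner_sum[OF o, of "{..<n}" ?c m] by (simp add: s_def[abs_def])
    qed
    ultimately have "L2_inner M v (e m) = ?c m" by (rule LIMSEQ_unique)
    then show ?thesis by (simp add: L2_inner_diff u v e)
  qed
  have AE: "AE x in M. u x - v x = 0"
    by (rule total[OF L2_diff[OF u v] z])
  have "L2n M (\<lambda>x. u x - s n x) = L2n M (\<lambda>x. s n x - v x)" for n
  proof -
    have "L2n M (\<lambda>x. u x - s n x) = L2n M (\<lambda>x. v x - s n x)"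
    proof (rule L2n_cong_AE)
      show "AE x in M. u x - s n x = v x - s n x" using AE by eventually_elim simp
    qed (use u v s L2_measurable in \<open>auto intro: borel_measurable_diff\<close>)
    then show ?thesis by (simp add: L2n_minus_commute)
  qed
  with lim show ?thesis by (simp add: s_def)
qed

section \<open>The Fourier transform\<close>

lemma borel_measurable_cis [measurable (raw)]:
  "f \<in> borel_measurable M \<Longrightarrow> (\<lambda>x. cis (f x)) \<in> borel_measurable M"
  by (rule borel_measurable_continuous_on[of cis]) (simp_all add: continuous_on_cis)

text \<open>One exchange of integrals for all uses below (multiplication formula, Gaussian means,
  adjoint, composition with the adjoint): a bounded kernel between two integrable functions is
  dominated by their product.\<close>

lemma Fubini_kernel:
  fixes f :: "'a \<Rightarrow> complex" and g :: "'b \<Rightarrow> complex" and k :: "'a \<Rightarrow> 'b \<Rightarrow> complex"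
  assumes "sigma_finite_measure M" "sigma_finite_measure N"
    and f: "integrable M f" and g: "integrable N g"
    and k: "(\<lambda>(x, y). k x y) \<in> borel_measurable (M \<Otimes>\<^sub>M N)"
    and B: "\<And>x y. cmod (k x y) \<le> B"
  shows "(LINT x|M. f x * (LINT y|N. k x y * g y)) = (LINT y|N. g y * (LINT x|M. k x y * f x))"
proof -
  interpret M: sigma_finite_measure M by fact
  interpret N: sigma_finite_measure N by fact
  interpret P: pair_sigma_finite M N ..
  note [measurable] = borel_measurable_integrable[OF f] borel_measurable_integrable[OF g] k
  have fg: "integrable (M \<Otimes>\<^sub>M N) (\<lambda>(x, y). f x * g y)"
  proof (rule P.Fubini_integrable)
    have "(\<lambda>x. LINT y|N. norm (case (x, y) of (x, y) \<Rightarrow> f x * g y)) = (\<lambda>x. norm (f x) * (LINT y|N. norm (g y)))"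
      by (simp add: norm_mult)
    then show "integrable M (\<lambda>x. LINT y|N. norm (case (x, y) of (x, y) \<Rightarrow> f x * g y))"
      using f by simp
    show "AE x in M. integrable N (\<lambda>y. case (x, y) of (x, y) \<Rightarrow> f x * g y)" using g by simp
  qed measurable
  have i: "integrable (M \<Otimes>\<^sub>M N) (\<lambda>(x, y). k x y * (f x * g y))"
  proof (rule Bochner_Integration.integrable_bound)
    show "integrable (M \<Otimes>\<^sub>M N) (\<lambda>z. B * norm (case z of (x, y) \<Rightarrow> f x * g y))"
      using fg by (intro integrable_mult_right integrable_norm)
    show "AE z in M \<Otimes>\<^sub>M N. norm (case z of (x, y) \<Rightarrow> k x y * (f x * g y)) \<le>
        norm (B * norm (case z of (x, y) \<Rightarrow> f x * g y))"
    proof (rule AE_I2, clarify)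
      fix x y
      have "0 \<le> B" using B[of x y] norm_ge_zero order_trans by blast
      then show "norm (k x y * (f x * g y)) \<le> norm (B * norm (f x * g y))"
        using B[of x y] by (simp add: norm_mult mult_right_mono)
    qed
  qed measurable
  have "(LINT x|M. f x * (LINT y|N. k x y * g y)) = (LINT x|M. LINT y|N. k x y * (f x * g y))"
    by (simp flip: integral_mult_right_zero add: mult_ac)
  also have "\<dots> = (LINT y|N. LINT x|M. k x y * (f x * g y))"
    by (rule P.Fubini_integral[OF i, symmetric])
  also have "\<dots> = (LINT y|N. g y * (LINT x|M. k x y * f x))"
    by (simp flip: integral_mult_right_zero add: mult_ac)
  finally show "(LINT x|M. f x * (LINT y|N. k x y * g y)) = (LINT y|N. g y * (LINT x|M. k x y * f x))" .
qed

lemma integrable_cis_mult: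
  "integrable M f \<Longrightarrow> h \<in> borel_measurable M \<Longrightarrow> integrable M (\<lambda>x. cis (h x) * f x)"
  by (rule Bochner_Integration.integrable_bound[of M f])
     (auto simp: norm_mult intro!: borel_measurable_times borel_measurable_cis)

lemma fourier_integral_measurable [measurable]:
  assumes [measurable]: "f \<in> borel_measurable lborel"
  shows "fourier_integral f \<in> borel_measurable borel"
proof -
  have "(\<lambda>t. LINT x|lborel. cis (t * x) * f x) \<in> borel_measurable borel"
    by measurable
  then show ?thesis by (simp add: fourier_integral_def[abs_def])
qed

lemma fourier_integral_bound:
  assumes "integrable lborel f"
  shows "cmod (fourier_integral f t) \<le> (LINT x|lborel. cmod (f x))"
proof -
  have "cmod (fourier_integral f t) \<le> (LINT x|lborel. cmod (cis (t * x) * f x))"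
    unfolding fourier_integral_def by (rule integral_norm_bound)
  then show ?thesis by (simp add: norm_mult)
qed

lemma fourier_integral_lin:
  assumes "integrable lborel f" "integrable lborel g"
  shows "fourier_integral (\<lambda>x. f x + k * g x) t = fourier_integral f t + k * fourier_integral g t"
proof -
  have "integrable lborel (\<lambda>x. cis (t * x) * f x)" "integrable lborel (\<lambda>x. cis (t * x) * g x)"
    using assms by (auto intro: integrable_cis_mult)
  then show ?thesis
    unfolding fourier_integral_def by (simp add: ring_distribs mult.left_commute)
qed

lemma fourier_integral_diff:
  assumes "integrable lborel f" "integrable lborel g"
  shows "fourier_integral (\<lambda>x. f x - g x) t = fourier_integral f t - fourier_integral g t"
  using fourier_integral_lin[OF assms, of "-1"] by simp

lemma fourier_integral_mult:
  assumes "integrable lborel f" "integrable lborel g"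
  shows "(LINT t|lborel. fourier_integral f t * g t) = (LINT x|lborel. f x * fourier_integral g x)"
proof -
  have "(LINT x|lborel. f x * (LINT t|lborel. cis (x * t) * g t)) =
        (LINT t|lborel. g t * (LINT x|lborel. cis (x * t) * f x))"
  proof (rule Fubini_kernel[OF sigma_finite_lborel sigma_finite_lborel assms])
    show "(\<lambda>(x, y). cis (x * y)) \<in> borel_measurable (lborel \<Otimes>\<^sub>M lborel)" by measurable
    show "\<And>x y. cmod (cis (x * y)) \<le> 1" by simp
  qed
  then show ?thesis by (simp add: fourier_integral_def mult.commute)
qed

section \<open>Gaussian means and Plancherel's identity on the intersection of L1 and L2\<close>

lemma std_gaussian_transform:
  "(LINT x|lborel. cis (t * x) * complex_of_real (std_normal_density x)) = complex_of_real (exp (- t\<^sup>2 / 2))"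
proof -
  have "complex_of_real (exp (- t\<^sup>2 / 2)) = char std_normal_distribution t"
    by (simp add: char_std_normal_distribution)
  also have "\<dots> = (LINT x|lborel. std_normal_density x *\<^sub>R iexp (t * x))"
    unfolding char_def by (subst integral_density) (auto simp: normal_density_nonneg)
  finally show ?thesis by (simp add: cis_conv_exp scaleR_conv_of_real mult.commute)
qed

lemma integrable_gaussian: "integrable lborel (\<lambda>t::real. exp (- t\<^sup>2 / 2))"
proof -
  have "integrable lborel (\<lambda>t. sqrt (2 * pi) * std_normal_density t)"
    by (intro integrable_mult_right integrable_normal_density) simp
  then show ?thesis by (simp add: std_normal_density_def)
qed

lemma integrable_gaussian_scaled:
  assumes "e > 0"
  shows "integrable lborel (\<lambda>t. complex_of_real (exp (- (e * t)\<^sup>2 / 2)))"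
  using lborel_integrable_real_affine[OF integrable_gaussian, of e 0] assms by (simp del: of_real_exp)

lemma gaussian_transform:
  assumes e: "e > 0"
  shows "(LINT t|lborel. cis (s * t) * complex_of_real (exp (- (e * t)\<^sup>2 / 2))) =
           complex_of_real (2 * pi / e * std_normal_density (s / e))"
proof -
  let ?F = "\<lambda>x. cis (s / e * x) * complex_of_real (exp (- x\<^sup>2 / 2))"
  have "(LINT x|lborel. ?F x) = complex_of_real (sqrt (2 * pi)) *
      (LINT x|lborel. cis (s / e * x) * complex_of_real (std_normal_density x))"
    by (subst integral_mult_right_zero[symmetric], intro Bochner_Integration.integral_cong)
       (auto simp: std_normal_density_def simp del: of_real_exp)
  also have "\<dots> = complex_of_real (2 * pi * std_normal_density (s / e))"
    unfolding std_gaussian_transform by (simp add: std_normal_density_def field_simps flip: of_real_mult)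
  finally have *: "(LINT x|lborel. ?F x) = complex_of_real (2 * pi * std_normal_density (s / e))" .
  have "(LINT x|lborel. ?F x) = \<bar>e\<bar> *\<^sub>R (LINT x|lborel. ?F (0 + e * x))"
    using e by (intro lborel_integral_real_affine) simp
  then have "complex_of_real e * (LINT x|lborel. ?F (e * x)) = complex_of_real (2 * pi * std_normal_density (s / e))"
    using e * by (simp add: scaleR_conv_of_real)
  then show ?thesis using e by (simp add: field_simps)
qed

text \<open>The multiplication formula is applied to the damped conjugate transform, whose own
  transform is 2 \<pi> times a Gaussian mean of the conjugate of f. As e tends to 0 the two sides
  approach the two sides of Plancherel's identity.\<close>

lemma gaussian_regularisation:
  assumes f: "integrable lborel f" and e: "e > 0"
  shows "(LINT t|lborel. fourier_integral f t * (complex_of_real (exp (- (e * t)\<^sup>2 / 2)) * cnj (fourier_integral f t))) =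
    (LINT x|lborel. f x * (2 * pi * (LINT z|lborel. complex_of_real (std_normal_density z) * cnj (f (x - e * z)))))"
proof -
  note [measurable] = borel_measurable_integrable[OF f]
  let ?w = "\<lambda>t. complex_of_real (exp (- (e * t)\<^sup>2 / 2))"
  let ?g = "\<lambda>t. ?w t * cnj (fourier_integral f t)"
  have w: "integrable lborel ?w" by (rule integrable_gaussian_scaled[OF e])
  have "integrable lborel ?g"
  proof (rule Bochner_Integration.integrable_bound)
    show "integrable lborel (\<lambda>t. ?w t * complex_of_real (LINT x|lborel. cmod (f x)))"
      using w by simp
    show "AE t in lborel. norm (?g t) \<le> norm (?w t * complex_of_real (LINT x|lborel. cmod (f x)))"
      using fourier_integral_bound[OF f]
      by (intro AE_I2) (auto simp: norm_mult intro!: mult_left_mono)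
  qed measurable
  then have "(LINT t|lborel. fourier_integral f t * ?g t) = (LINT x|lborel. f x * fourier_integral ?g x)"
    by (rule fourier_integral_mult[OF f])
  moreover have "fourier_integral ?g x =
      2 * pi * (LINT z|lborel. complex_of_real (std_normal_density z) * cnj (f (x - e * z)))" for x
  proof -
    have "fourier_integral ?g x =
        (LINT t|lborel. (cis (x * t) * ?w t) * (LINT y|lborel. cis (- (t * y)) * cnj (f y)))"
      unfolding fourier_integral_def Bochner_Integration.integral_cnj[symmetric] by (simp add: cis_cnj mult_ac)
    also have "\<dots> = (LINT y|lborel. cnj (f y) * (LINT t|lborel. cis (- (t * y)) * (cis (x * t) * ?w t)))"
    proof (rule Fubini_kernel[where B=1, OF sigma_finite_lborel sigma_finite_lborel])
      show "integrable lborel (\<lambda>t. cis (x * t) * ?w t)"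
        using w by (intro integrable_cis_mult) auto
      show "integrable lborel (\<lambda>y. cnj (f y))" using f by simp
    qed auto
    also have "\<dots> = (LINT y|lborel. cnj (f y) * complex_of_real (2 * pi / e * std_normal_density ((x - y) / e)))"
    proof -
      have "cis (- (t * y)) * (cis (x * t) * ?w t) = cis ((x - y) * t) * ?w t" for t y
        by (simp add: cis_mult algebra_simps flip: mult.assoc)
      then show ?thesis by (simp only: gaussian_transform[OF e])
    qed
    \<comment> \<open>The substitution y = x - e z turns the kernel of width e into the standard
      normal density, so that e moves into the argument of f.\<close>
    also have "\<dots> = \<bar>- e\<bar> *\<^sub>R (LINT z|lborel. cnj (f (x + - e * z)) *
        complex_of_real (2 * pi / e * std_normal_density ((x - (x + - e * z)) / e)))"
      using e by (intro lborel_integral_real_affine) simp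
    also have "\<dots> = (LINT z|lborel. 2 * pi * (complex_of_real (std_normal_density z) * cnj (f (x - e * z))))"
      unfolding integral_scaleR_right[symmetric] using e
      by (intro Bochner_Integration.integral_cong) (auto simp: scaleR_conv_of_real)
    also have "\<dots> = 2 * pi * (LINT z|lborel. complex_of_real (std_normal_density z) * cnj (f (x - e * z)))"
      by (rule integral_mult_right_zero)
    finally show ?thesis .
  qed
  ultimately show ?thesis by simp
qed

text \<open>A property of a single function, to be passed on to limits in several rounds. Membership
  is included because the equation of norms alone would not give it.\<close>

definition Plancherel :: "(real \<Rightarrow> complex) \<Rightarrow> bool" where
  "Plancherel f \<longleftrightarrow> fourier_integral f \<in> L2 lborel \<and> L2n lborel (fourier_integral f) = sqrt (2 * pi) * L2n lborel f"

text \<open>Continuity and boundedness make the Gaussian means converge at every point and dominate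
  them, so the right side of \<open>gaussian_regularisation\<close> converges; the left side
  increases to its limit.\<close>

lemma Plancherel_continuous:
  assumes cont: "continuous_on UNIV f" and bd: "\<And>x. cmod (f x) \<le> B"
    and int: "integrable lborel f"
  shows "Plancherel f"
proof -
  note [measurable] = borel_measurable_integrable[OF int]
  define e :: "nat \<Rightarrow> real" where "e n = inverse (real (Suc n))" for n
  have e0: "e n > 0" for n by (simp add: e_def)
  have elim: "e \<longlonglongrightarrow> 0" unfolding e_def by (rule LIMSEQ_inverse_real_of_nat)
  let ?\<phi> = "\<lambda>z. complex_of_real (std_normal_density z)"
  have \<phi>: "integrable lborel ?\<phi>" "(LINT z|lborel. ?\<phi> z) = 1"
    by (auto simp: integral_normal_density integrable_normal_density)
  have B0: "B \<ge> 0" using bd[of 0] norm_ge_zero order_trans by blast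
  define G where "G n x = 2 * pi * (LINT z|lborel. ?\<phi> z * cnj (f (x - e n * z)))" for n x
  have Glim: "(\<lambda>n. G n x) \<longlonglongrightarrow> 2 * pi * cnj (f x)" for x
  proof -
    have "(\<lambda>n. LINT z|lborel. ?\<phi> z * cnj (f (x - e n * z))) \<longlonglongrightarrow> (LINT z|lborel. ?\<phi> z * cnj (f x))"
    proof (rule integral_dominated_convergence)
      show "integrable lborel (\<lambda>z. std_normal_density z * B)"
        using integrable_normal_density[of 1 0] by simp
      show "AE z in lborel. (\<lambda>n. ?\<phi> z * cnj (f (x - e n * z))) \<longlonglongrightarrow> ?\<phi> z * cnj (f x)"
      proof (intro AE_I2 tendsto_mult tendsto_const tendsto_cnj)
        fix z
        have "(\<lambda>n. x - e n * z) \<longlonglongrightarrow> x - 0 * z" by (intro tendsto_intros elim)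
        then show "(\<lambda>n. f (x - e n * z)) \<longlonglongrightarrow> f x"
          using continuous_on_tendsto_compose[OF cont, of "\<lambda>n. x - e n * z" x sequentially] by simp
      qed
      show "AE z in lborel. norm (?\<phi> z * cnj (f (x - e n * z))) \<le> std_normal_density z * B" for n
        using bd by (intro AE_I2) (auto simp: norm_mult intro!: mult_left_mono)
    qed auto
    then show ?thesis
      unfolding G_def using \<phi>(2) by (intro tendsto_mult tendsto_const) simp
  qed
  have Gb: "cmod (G n x) \<le> 2 * pi * B" for n x
  proof -
    have "cmod (LINT z|lborel. ?\<phi> z * cnj (f (x - e n * z))) \<le> (LINT z|lborel. std_normal_density z * B)"
    proof (rule order_trans[OF integral_norm_bound], rule integral_mono)
      show "integrable lborel (\<lambda>z. norm (?\<phi> z * cnj (f (x - e n * z))))"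
        by (rule Bochner_Integration.integrable_bound[of _ "\<lambda>z. std_normal_density z * B"])
           (use bd B0 integrable_normal_density[of 1 0] in \<open>auto simp: norm_mult intro!: mult_left_mono\<close>)
      show "integrable lborel (\<lambda>z. std_normal_density z * B)"
        using integrable_normal_density[of 1 0] by simp
      show "norm (?\<phi> z * cnj (f (x - e n * z))) \<le> std_normal_density z * B" for z
        using bd by (auto simp: norm_mult intro!: mult_left_mono)
    qed
    also have "\<dots> = B" using integral_normal_density[of 1 0] by simp
    finally show ?thesis by (simp add: G_def norm_mult)
  qed
  have Gm [measurable]: "G n \<in> borel_measurable lborel" for n
    unfolding G_def[abs_def] by measurable
  have sq: "integrable lborel (\<lambda>x. (cmod (f x))\<^sup>2)"
  proof (rule Bochner_Integration.integrable_bound[of _ "\<lambda>x. B * cmod (f x)"])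
    show "AE x in lborel. norm ((cmod (f x))\<^sup>2) \<le> norm (B * cmod (f x))"
      using bd B0 by (intro AE_I2) (auto simp: power2_eq_square intro!: mult_right_mono)
  qed (use int in auto)
  have "(\<lambda>n. LINT x|lborel. f x * G n x) \<longlonglongrightarrow> (LINT x|lborel. f x * (2 * pi * cnj (f x)))"
  proof (rule integral_dominated_convergence)
    show "integrable lborel (\<lambda>x. cmod (f x) * (2 * pi * B))" using int by simp
    show "AE x in lborel. (\<lambda>n. f x * G n x) \<longlonglongrightarrow> f x * (2 * pi * cnj (f x))"
      by (intro AE_I2 tendsto_mult tendsto_const Glim)
    show "AE x in lborel. norm (f x * G n x) \<le> cmod (f x) * (2 * pi * B)" for n
      by (intro AE_I2) (auto simp: norm_mult intro!: mult_left_mono Gb)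
  qed measurable
  also have "(LINT x|lborel. f x * (2 * pi * cnj (f x))) = complex_of_real (2 * pi * (L2n lborel f)\<^sup>2)"
  proof -
    have "(LINT x|lborel. f x * (2 * pi * cnj (f x))) = (LINT x|lborel. complex_of_real (2 * pi * (cmod (f x))\<^sup>2))"
      by (intro Bochner_Integration.integral_cong) (auto simp: complex_norm_square mult_ac simp del: of_real_power)
    then show ?thesis by (simp add: L2n_sq del: of_real_mult of_real_power)
  qed
  finally have lim1: "(\<lambda>n. LINT x|lborel. f x * G n x) \<longlonglongrightarrow> complex_of_real (2 * pi * (L2n lborel f)\<^sup>2)" .
  define E where "E n t = (cmod (fourier_integral f t))\<^sup>2 * exp (- (e n * t)\<^sup>2 / 2)" for n t
  have Eint: "integrable lborel (E n)" for n
  proof (rule Bochner_Integration.integrable_bound)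
    show "integrable lborel (\<lambda>t. (LINT x|lborel. cmod (f x))\<^sup>2 * exp (- (e n * t)\<^sup>2 / 2))"
      using lborel_integrable_real_affine[OF integrable_gaussian, of "e n" 0] e0[of n] by simp
    show "AE t in lborel. norm (E n t) \<le> norm ((LINT x|lborel. cmod (f x))\<^sup>2 * exp (- (e n * t)\<^sup>2 / 2))"
      using fourier_integral_bound[OF int]
      by (intro AE_I2) (auto simp: E_def abs_mult intro!: mult_right_mono power_mono)
  qed (simp_all add: E_def[abs_def])
  have "complex_of_real (LINT t|lborel. E n t) = (LINT x|lborel. f x * G n x)" for n
  proof -
    have "complex_of_real (LINT t|lborel. E n t) = (LINT t|lborel. complex_of_real (E n t))" by simp
    also have "\<dots> = (LINT t|lborel. fourier_integral f t * (complex_of_real (exp (- (e n * t)\<^sup>2 / 2)) * cnj (fourier_integral f t)))"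
      by (intro Bochner_Integration.integral_cong) (auto simp: E_def complex_norm_square mult_ac simp del: of_real_power of_real_exp)
    finally show ?thesis
      unfolding G_def gaussian_regularisation[OF int e0] .
  qed
  with lim1 have "(\<lambda>n. complex_of_real (LINT t|lborel. E n t)) \<longlonglongrightarrow> complex_of_real (2 * pi * (L2n lborel f)\<^sup>2)"
    by simp
  then have lim2: "(\<lambda>n. LINT t|lborel. E n t) \<longlonglongrightarrow> 2 * pi * (L2n lborel f)\<^sup>2"
    by (simp only: tendsto_of_real_iff)
  \<comment> \<open>Monotone convergence also delivers the integrability of the squared transform,
    for which no majorant is available.\<close>
  have mono: "AE t in lborel. mono (\<lambda>n. E n t)"
  proof (intro AE_I2 monoI)
    fix t and m n :: nat assume "m \<le> n"
    then have "e n \<le> e m" by (simp add: e_def)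
    then have "(e n * t)\<^sup>2 \<le> (e m * t)\<^sup>2"
      using e0[of n] by (auto simp: power_mult_distrib intro!: mult_right_mono power_mono)
    then show "E m t \<le> E n t" by (auto simp: E_def intro!: mult_left_mono)
  qed
  have Elim: "AE t in lborel. (\<lambda>n. E n t) \<longlonglongrightarrow> (cmod (fourier_integral f t))\<^sup>2"
  proof (rule AE_I2)
    fix t
    have "(\<lambda>n. (cmod (fourier_integral f t))\<^sup>2 * exp (- (e n * t)\<^sup>2 / 2)) \<longlonglongrightarrow>
        (cmod (fourier_integral f t))\<^sup>2 * exp (- (0 * t)\<^sup>2 / 2)"
      by (intro tendsto_intros elim) auto
    then show "(\<lambda>n. E n t) \<longlonglongrightarrow> (cmod (fourier_integral f t))\<^sup>2" by (simp add: E_def)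
  qed
  have "fourier_integral f \<in> borel_measurable lborel" by measurable
  note * = integrable_monotone_convergence[OF Eint mono Elim lim2]
    integral_monotone_convergence[OF Eint mono Elim lim2]
  have "integrable lborel (\<lambda>t. (cmod (fourier_integral f t))\<^sup>2)"
    by (rule *(1)) measurable
  moreover have "(LINT t|lborel. (cmod (fourier_integral f t))\<^sup>2) = 2 * pi * (L2n lborel f)\<^sup>2"
    by (rule *(2)) measurable
  ultimately show ?thesis
    by (simp add: Plancherel_def L2_def L2n_def[of lborel "fourier_integral f"] real_sqrt_mult)
qed

text \<open>A map that multiplies all distances by \<open>K\<close> carries Cauchy sequences to
  Cauchy sequences, and completeness supplies the limit.\<close>

lemma L2_isometric_limit:
  assumes u: "\<And>n. u n \<in> L2 M" "f \<in> L2 M" "(\<lambda>n. L2n M (\<lambda>x. u n x - f x)) \<longlonglongrightarrow> 0"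
    and v: "\<And>n. v n \<in> L2 M'" and K: "K > 0"
    and iso: "\<And>m n. L2n M' (\<lambda>x. v m x - v n x) = K * L2n M (\<lambda>x. u m x - u n x)"
  shows "\<exists>h\<in>L2 M'. (\<lambda>n. L2n M' (\<lambda>x. v n x - h x)) \<longlonglongrightarrow> 0"
proof (rule L2_complete[OF v])
  fix r :: real assume r: "r > 0"
  define r' where "r' = r / (2 * K)"
  have r': "r' > 0" using r K by (simp add: r'_def)
  obtain N where N: "\<And>n. n \<ge> N \<Longrightarrow> L2n M (\<lambda>x. u n x - f x) < r'"
    using LIMSEQ_D[OF u(3) r'] by auto
  show "\<exists>N. \<forall>m\<ge>N. \<forall>n\<ge>N. L2n M' (\<lambda>x. v m x - v n x) < r"
  proof (intro exI[of _ N] allI impI)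
    fix m n assume mn: "m \<ge> N" "n \<ge> N"
    have "L2n M (\<lambda>x. u m x - u n x) \<le> L2n M (\<lambda>x. u m x - f x) + L2n M (\<lambda>x. u n x - f x)"
      using L2n_triangle_via[OF u(1)[of m] u(1)[of n] u(2)] L2n_minus_commute[of M f "u n"] by simp
    also have "\<dots> < 2 * r'" using N[OF mn(1)] N[OF mn(2)] by linarith
    finally have "K * L2n M (\<lambda>x. u m x - u n x) < K * (2 * r')"
      by (rule mult_strict_left_mono[OF _ K])
    then show "L2n M' (\<lambda>x. v m x - v n x) < r" using K by (simp add: iso r'_def)
  qed
qed

text \<open>By Fatou the distance between the two limits is at most the limes inferior of a null
  sequence.\<close>

lemma L2_limit_pointwise:
  assumes G: "\<And>n. G n \<in> L2 M" and H: "H \<in> L2 M" and lim: "(\<lambda>n. L2n M (\<lambda>x. G n x - H x)) \<longlonglongrightarrow> 0"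
    and g [measurable]: "g \<in> borel_measurable M" and pt: "AE x in M. (\<lambda>n. G n x) \<longlonglongrightarrow> g x"
  shows "AE x in M. H x = g x"
proof -
  note [measurable] = L2_measurable[OF G] L2_measurable[OF H]
  have "(\<integral>\<^sup>+ x. ennreal ((cmod (g x - H x))\<^sup>2) \<partial>M) = (\<integral>\<^sup>+ x. liminf (\<lambda>n. ennreal ((cmod (G n x - H x))\<^sup>2)) \<partial>M)"
  proof (rule nn_integral_cong_AE)
    show "AE x in M. ennreal ((cmod (g x - H x))\<^sup>2) = liminf (\<lambda>n. ennreal ((cmod (G n x - H x))\<^sup>2))"
      using pt
    proof eventually_elim
      fix x assume A: "(\<lambda>n. G n x) \<longlonglongrightarrow> g x"
      have "(\<lambda>n. ennreal ((cmod (G n x - H x))\<^sup>2)) \<longlonglongrightarrow> ennreal ((cmod (g x - H x))\<^sup>2)"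
        by (intro tendsto_ennrealI tendsto_power tendsto_norm tendsto_diff tendsto_const A)
      then show "ennreal ((cmod (g x - H x))\<^sup>2) = liminf (\<lambda>n. ennreal ((cmod (G n x - H x))\<^sup>2))"
        using lim_imp_Liminf[OF sequentially_bot] by metis
    qed
  qed
  also have "\<dots> \<le> liminf (\<lambda>n. \<integral>\<^sup>+ x. ennreal ((cmod (G n x - H x))\<^sup>2) \<partial>M)"
    by (rule nn_integral_liminf) measurable
  also have "(\<lambda>n. \<integral>\<^sup>+ x. ennreal ((cmod (G n x - H x))\<^sup>2) \<partial>M) = (\<lambda>n. ennreal ((L2n M (\<lambda>x. G n x - H x))\<^sup>2))"
    unfolding L2n_sq by (intro ext nn_integral_eq_integral L2_integrable L2_diff G H) simp
  also have "liminf \<dots> = 0"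
  proof -
    have "(\<lambda>n. ennreal ((L2n M (\<lambda>x. G n x - H x))\<^sup>2)) \<longlonglongrightarrow> ennreal (0\<^sup>2)"
      by (intro tendsto_ennrealI tendsto_power lim)
    then have "liminf (\<lambda>n. ennreal ((L2n M (\<lambda>x. G n x - H x))\<^sup>2)) = ennreal (0\<^sup>2)"
      by (rule lim_imp_Liminf[OF sequentially_bot])
    then show ?thesis by simp
  qed
  finally have "(\<integral>\<^sup>+ x. ennreal ((cmod (g x - H x))\<^sup>2) \<partial>M) = 0" by simp
  then have "AE x in M. ennreal ((cmod (g x - H x))\<^sup>2) = 0"
    by (subst (asm) nn_integral_0_iff_AE) auto
  then show ?thesis by eventually_elim simp
qed

text \<open>Plancherel for the differences makes the transforms a Cauchy sequence in L2. Convergence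
  of \<open>u\<close> in L1 makes the same transforms converge pointwise to
  \<open>fourier_integral f\<close>, which identifies the limit in L2.\<close>

lemma Plancherel_closure:
  assumes f: "integrable lborel f" "f \<in> L2 lborel"
    and u: "\<And>n. integrable lborel (u n)" "\<And>n. u n \<in> L2 lborel"
    and P: "\<And>m n. Plancherel (\<lambda>x. u m x - u n x)" "\<And>n. Plancherel (u n)"
    and lim1: "(\<lambda>n. LINT x|lborel. cmod (u n x - f x)) \<longlonglongrightarrow> 0"
    and lim2: "(\<lambda>n. L2n lborel (\<lambda>x. u n x - f x)) \<longlonglongrightarrow> 0"
  shows "Plancherel f"
proof -
  let ?U = "\<lambda>n. fourier_integral (u n)"
  have U: "?U n \<in> L2 lborel" for n using P(2) by (simp add: Plancherel_def)
  have iso: "L2n lborel (\<lambda>t. ?U m t - ?U n t) = sqrt (2 * pi) * L2n lborel (\<lambda>x. u m x - u n x)" for m n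
    using P(1)[of m n] by (simp add: Plancherel_def fourier_integral_diff[OF u(1) u(1), abs_def])
  from L2_isometric_limit[OF u(2) f(2) lim2 U _ iso]
  obtain H where H: "H \<in> L2 lborel" and HL: "(\<lambda>n. L2n lborel (\<lambda>t. ?U n t - H t)) \<longlonglongrightarrow> 0"
    by auto
  have [measurable]: "fourier_integral f \<in> borel_measurable lborel"
    using borel_measurable_integrable[OF f(1)] by simp
  have AE: "AE t in lborel. H t = fourier_integral f t"
  proof (rule L2_limit_pointwise[OF U H HL])
    show "AE t in lborel. (\<lambda>n. ?U n t) \<longlonglongrightarrow> fourier_integral f t"
    proof (rule AE_I2)
      fix t
      have "(\<lambda>n. ?U n t - fourier_integral f t) \<longlonglongrightarrow> 0"
      proof (rule Lim_null_comparison[OF always_eventually lim1], rule allI)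
        fix n
        show "norm (?U n t - fourier_integral f t) \<le> (LINT x|lborel. cmod (u n x - f x))"
          using fourier_integral_bound[of "\<lambda>x. u n x - f x" t] u(1)[of n] f(1)
          by (simp add: fourier_integral_diff)
      qed
      then show "(\<lambda>n. ?U n t) \<longlonglongrightarrow> fourier_integral f t" by (simp add: LIM_zero_iff)
    qed
  qed measurable
  have "L2n lborel H = sqrt (2 * pi) * L2n lborel f"
  proof (rule LIMSEQ_unique)
    show "(\<lambda>n. L2n lborel (?U n)) \<longlonglongrightarrow> L2n lborel H" by (rule L2n_tendsto[OF U H HL])
    have "L2n lborel (?U n) = sqrt (2 * pi) * L2n lborel (u n)" for n
      using P(2) by (simp add: Plancherel_def)
    then show "(\<lambda>n. L2n lborel (?U n)) \<longlonglongrightarrow> sqrt (2 * pi) * L2n lborel f"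
      by (simp only:) (intro tendsto_mult tendsto_const L2n_tendsto[OF u(2) f(2) lim2])
  qed
  moreover have "L2n lborel H = L2n lborel (fourier_integral f)"
    by (rule L2n_cong_AE[OF AE L2_measurable[OF H]]) measurable
  moreover have "fourier_integral f \<in> L2 lborel"
    by (rule L2_cong_AE[OF AE H]) measurable
  ultimately show ?thesis by (simp add: Plancherel_def)
qed

lemma L2n_dominated:
  assumes u [measurable]: "\<And>n. u n \<in> borel_measurable M" and f [measurable]: "f \<in> borel_measurable M"
    and pt: "AE x in M. (\<lambda>n. u n x) \<longlonglongrightarrow> f x"
    and w: "integrable M (\<lambda>x. (w x)\<^sup>2)" and b: "\<And>n. AE x in M. cmod (u n x - f x) \<le> w x"
  shows "(\<lambda>n. L2n M (\<lambda>x. u n x - f x)) \<longlonglongrightarrow> 0"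
proof -
  have "(\<lambda>n. LINT x|M. (cmod (u n x - f x))\<^sup>2) \<longlonglongrightarrow> (LINT x|M. 0)"
  proof (rule integral_dominated_convergence[OF _ _ w])
    show "AE x in M. (\<lambda>n. (cmod (u n x - f x))\<^sup>2) \<longlonglongrightarrow> 0"
      using pt
    proof eventually_elim
      fix x assume "(\<lambda>n. u n x) \<longlonglongrightarrow> f x"
      then have "(\<lambda>n. (cmod (u n x - f x))\<^sup>2) \<longlonglongrightarrow> (cmod (f x - f x))\<^sup>2"
        by (intro tendsto_intros)
      then show "(\<lambda>n. (cmod (u n x - f x))\<^sup>2) \<longlonglongrightarrow> 0" by simp
    qed
    show "AE x in M. norm ((cmod (u n x - f x))\<^sup>2) \<le> (w x)\<^sup>2" for n
      using b[of n] by eventually_elim (simp add: power_mono)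
  qed auto
  then have "(\<lambda>n. sqrt (LINT x|M. (cmod (u n x - f x))\<^sup>2)) \<longlonglongrightarrow> sqrt 0"
    by (intro tendsto_real_sqrt) simp
  then show ?thesis by (simp add: L2n_def)
qed

lemma L1_dominated:
  fixes f :: "'a \<Rightarrow> complex"
  assumes u [measurable]: "\<And>n. u n \<in> borel_measurable M" and f [measurable]: "f \<in> borel_measurable M"
    and pt: "AE x in M. (\<lambda>n. u n x) \<longlonglongrightarrow> f x"
    and w: "integrable M w" and b: "\<And>n. AE x in M. cmod (u n x - f x) \<le> w x"
  shows "(\<lambda>n. LINT x|M. cmod (u n x - f x)) \<longlonglongrightarrow> 0"
proof -
  have "(\<lambda>n. LINT x|M. cmod (u n x - f x)) \<longlonglongrightarrow> (LINT x|M. 0)"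
  proof (rule integral_dominated_convergence[OF _ _ w])
    show "AE x in M. (\<lambda>n. cmod (u n x - f x)) \<longlonglongrightarrow> 0"
      using pt by eventually_elim (simp add: LIM_zero tendsto_norm_zero)
  qed (use b in auto)
  then show ?thesis by simp
qed

lemma integrable_indicator_interval: "integrable lborel (\<lambda>x. indicator {- R..R} x * B :: real)" for R B :: real
  by (intro integrable_mult_left) (simp add: integrable_indicator_iff emeasure_lborel_Icc_eq)

lemma bounded_support_L12:
  fixes f :: "real \<Rightarrow> complex"
  assumes [measurable]: "f \<in> borel_measurable borel" and b: "\<And>x. cmod (f x) \<le> indicator {-R..R} x * B"
  shows "integrable lborel f" "f \<in> L2 lborel"
proof -
  show "integrable lborel f"
  proof (rule Bochner_Integration.integrable_bound[OF integrable_indicator_interval[of R B]])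
    show "AE x in lborel. norm (f x) \<le> norm (indicator {-R..R} x * B)"
      using b by (intro AE_I2) (metis abs_ge_self order_trans real_norm_def)
  qed measurable
  show "f \<in> L2 lborel"
  proof (rule L2_bound[OF _ integrable_indicator_interval[of R "B\<^sup>2"]])
    fix x
    have "(cmod (f x))\<^sup>2 \<le> (indicator {-R..R} x * B)\<^sup>2" using b by (intro power_mono) auto
    then show "(cmod (f x))\<^sup>2 \<le> indicator {-R..R} x * B\<^sup>2"
      by (auto simp: indicator_def power_mult_distrib)
  qed measurable
qed

text \<open>A measurable function is an almost everywhere limit of continuous ones. These are
  modified so as to stay bounded and supported in a fixed interval, which gives convergence in L1
  and in L2 by domination.\<close>

lemma Plancherel_bounded_support:
  assumes [measurable]: "f \<in> borel_measurable borel" and b: "\<And>x. cmod (f x) \<le> indicator {-R..R} x * B"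
    and B: "B \<ge> 0"
  shows "Plancherel f"
proof -
  note f = bounded_support_L12[OF assms(1) b]
  have "f \<in> borel_measurable lebesgue"
    using assms(1) by (intro measurable_completion) simp
  then have "f measurable_on UNIV"
    by (rule lebesgue_measurable_imp_measurable_on) simp
  then obtain N g where N: "negligible N" and g: "\<And>n. continuous_on UNIV (g n)"
      and gl: "\<And>x. x \<notin> N \<Longrightarrow> (\<lambda>n. g n x) \<longlonglongrightarrow> f x"
    unfolding measurable_on_def by auto
  have "AE x in lebesgue. x \<notin> N"
    using N by (simp add: negligible_iff_null_sets AE_not_in)
  then have AEN: "AE x in lborel. x \<notin> N" by (simp add: AE_completion_iff)
  \<comment> \<open>A continuous plateau: 1 on [-R, R] and 0 outside [-(R + 1), R + 1].\<close>
  define cut :: "real \<Rightarrow> real" where "cut x = max 0 (min 1 (R + 1 - \<bar>x\<bar>))" for x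
  \<comment> \<open>The projection to the nearest point of the ball of radius \<open>B\<close> is
    continuous, caps the approximants at \<open>B\<close> and fixes the values of
    \<open>f\<close>.\<close>
  define cp where "cp = closest_point (cball 0 B :: complex set)"
  have cpc: "continuous_on UNIV cp"
    unfolding cp_def using B by (intro continuous_on_closest_point) auto
  have cpb: "cmod (cp z) \<le> B" for z
    using closest_point_in_set[of "cball 0 B :: complex set" z] B by (auto simp: cp_def)
  have fB: "cmod (f x) \<le> B" for x
    using b[of x] B by (cases "x \<in> {-R..R}") auto
  have cpf: "cp (f x) = f x" for x
    using fB[of x] unfolding cp_def by (intro closest_point_self) simp
  define u where "u n x = complex_of_real (cut x) * cp (g n x)" for n x
  have uc: "continuous_on UNIV (u n)" for n
    unfolding u_def cut_def
    by (intro continuous_intros continuous_on_compose2[OF cpc g]) auto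
  have [measurable]: "u n \<in> borel_measurable borel" for n
    by (rule borel_measurable_continuous_onI[OF uc])
  have ub: "cmod (u n x) \<le> indicator {-(R+1)..R+1} x * B" for n x
  proof (cases "\<bar>x\<bar> \<le> R + 1")
    case True
    have "cmod (u n x) \<le> 1 * B"
      unfolding u_def norm_mult by (intro mult_mono cpb) (auto simp: cut_def)
    moreover have "x \<in> {-(R+1)..R+1}" using True by auto
    ultimately show ?thesis by simp
  next
    case False
    then have "u n x = 0" by (simp add: u_def cut_def)
    then show ?thesis using B by (simp only: norm_zero) simp
  qed
  have uB: "cmod (u n x) \<le> B" for n x
    using ub[of n x] B by (cases "x \<in> {-(R+1)..R+1}") auto
  have pt: "AE x in lborel. (\<lambda>n. u n x) \<longlonglongrightarrow> f x"
    using AEN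
  proof eventually_elim
    fix x assume "x \<notin> N"
    then have "(\<lambda>n. cp (g n x)) \<longlonglongrightarrow> cp (f x)"
      using continuous_on_tendsto_compose[OF cpc gl[of x]] by simp
    then have "(\<lambda>n. u n x) \<longlonglongrightarrow> complex_of_real (cut x) * f x"
      unfolding u_def cpf by (intro tendsto_intros)
    also have "complex_of_real (cut x) * f x = f x"
    proof (cases "\<bar>x\<bar> \<le> R")
      case True
      then show ?thesis by (simp add: cut_def)
    next
      case False
      then have "x \<notin> {-R..R}" by auto
      then have "f x = 0" using b[of x] by simp
      then show ?thesis by simp
    qed
    finally show "(\<lambda>n. u n x) \<longlonglongrightarrow> f x" .
  qed
  define w where "w x = indicator {-(R+1)..R+1} x * (2 * B)" for x :: real
  have wb: "AE x in lborel. cmod (u n x - f x) \<le> w x" for n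
  proof (rule AE_I2)
    fix x
    have "cmod (u n x - f x) \<le> cmod (u n x) + cmod (f x)" by (rule norm_triangle_ineq4)
    also have "\<dots> \<le> indicator {-(R+1)..R+1} x * B + indicator {-R..R} x * B"
      by (intro add_mono ub b)
    also have "\<dots> \<le> w x" using B by (auto simp: w_def indicator_def)
    finally show "cmod (u n x - f x) \<le> w x" .
  qed
  have w1: "integrable lborel w" unfolding w_def by (rule integrable_indicator_interval)
  have "(\<lambda>x. (w x)\<^sup>2) = (\<lambda>x. indicator {-(R+1)..R+1} x * (2 * B)\<^sup>2)"
    by (auto simp: w_def fun_eq_iff indicator_def)
  then have w2: "integrable lborel (\<lambda>x. (w x)\<^sup>2)" by (simp only: integrable_indicator_interval)
  show ?thesis
  proof (rule Plancherel_closure[OF f])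
    show ui: "integrable lborel (u n)" "u n \<in> L2 lborel" for n
      by (auto intro: bounded_support_L12 ub)
    show "Plancherel (u n)" for n
      by (rule Plancherel_continuous[OF uc _ ui(1), of _ B])
        (rule uB)
    show "Plancherel (\<lambda>x. u m x - u n x)" for m n
    proof (rule Plancherel_continuous[where B="B + B"])
      show "cmod (u m x - u n x) \<le> B + B" for x
        by (intro order_trans[OF norm_triangle_ineq4 add_mono] uB)
    qed (intro continuous_intros uc, use ui in auto)
    show "(\<lambda>n. LINT x|lborel. cmod (u n x - f x)) \<longlonglongrightarrow> 0"
      by (rule L1_dominated[OF _ _ pt w1 wb]) auto
    show "(\<lambda>n. L2n lborel (\<lambda>x. u n x - f x)) \<longlonglongrightarrow> 0"
      by (rule L2n_dominated[OF _ _ pt w2 wb]) auto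
  qed
qed

text \<open>Cutting off both the domain and the large values at level n reduces to bounded functions
  of bounded support, with |f| itself as majorant.\<close>

theorem Plancherel_L1_L2:
  assumes f: "integrable lborel f" "f \<in> L2 lborel"
  shows "Plancherel f"
proof -
  note [measurable] = borel_measurable_integrable[OF f(1)]
  define u where "u n x = (if \<bar>x\<bar> \<le> real n \<and> cmod (f x) \<le> real n then f x else 0)" for n x
  have [measurable]: "u n \<in> borel_measurable borel" for n
    unfolding u_def[abs_def] by measurable
  have ub: "cmod (u n x) \<le> indicator {- real n..real n} x * real n" for n x
    by (auto simp: u_def indicator_def)
  have pt: "AE x in lborel. (\<lambda>n. u n x) \<longlonglongrightarrow> f x"
  proof (intro AE_I2 tendsto_eventually)
    fix x
    obtain n0 :: nat where "real n0 \<ge> max \<bar>x\<bar> (cmod (f x))" using real_arch_simple by blast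
    then show "\<forall>\<^sub>F n in sequentially. u n x = f x"
      by (intro eventually_sequentiallyI[of n0]) (auto simp: u_def)
  qed
  have wb: "AE x in lborel. cmod (u n x - f x) \<le> cmod (f x)" for n
    by (intro AE_I2) (auto simp: u_def)
  show ?thesis
  proof (rule Plancherel_closure[OF f])
    show ui: "integrable lborel (u n)" "u n \<in> L2 lborel" for n
      by (auto intro: bounded_support_L12 ub)
    show "Plancherel (u n)" for n
      by (rule Plancherel_bounded_support[OF _ ub]) auto
    show "Plancherel (\<lambda>x. u m x - u n x)" for m n
    proof (rule Plancherel_bounded_support)
      show "cmod (u m x - u n x) \<le> indicator {- (real m + real n)..real m + real n} x * (real m + real n)" for x
        using ub[of m x] ub[of n x]
        by (intro order_trans[OF norm_triangle_ineq4 order_trans[OF add_mono]]) (auto simp: indicator_def)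
    qed auto
    show "(\<lambda>n. LINT x|lborel. cmod (u n x - f x)) \<longlonglongrightarrow> 0"
      by (rule L1_dominated[OF _ _ pt _ wb]) (use f in auto)
    show "(\<lambda>n. L2n lborel (\<lambda>x. u n x - f x)) \<longlonglongrightarrow> 0"
      by (rule L2n_dominated[OF _ _ pt L2_integrable[OF f(2)] wb]) auto
  qed
qed

section \<open>The continuous extension of the transform to L2\<close>

lemma L2n_fourier_integral_diff:
  assumes "integrable lborel f" "f \<in> L2 lborel" "integrable lborel g" "g \<in> L2 lborel"
  shows "L2n lborel (\<lambda>t. fourier_integral f t - fourier_integral g t) = sqrt (2 * pi) * L2n lborel (\<lambda>x. f x - g x)"
proof -
  have "Plancherel (\<lambda>x. f x - g x)"
    using assms by (intro Plancherel_L1_L2 L2_diff) auto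
  then show ?thesis by (simp add: Plancherel_def fourier_integral_diff[OF assms(1,3), abs_def])
qed

lemma fourier_integral_L2:
  "integrable lborel f \<Longrightarrow> f \<in> L2 lborel \<Longrightarrow> fourier_integral f \<in> L2 lborel"
  using Plancherel_L1_L2 by (simp add: Plancherel_def)

text \<open>Only the domain is cut: on a bounded interval square integrability implies
  integrability, so this is an approximating sequence in the intersection of L1 and L2.\<close>

definition trunc :: "nat \<Rightarrow> (real \<Rightarrow> complex) \<Rightarrow> real \<Rightarrow> complex" where
  "trunc n f x = indicator {- real n..real n} x * f x"

lemma
  assumes f: "f \<in> L2 lborel"
  shows trunc_L2: "trunc n f \<in> L2 lborel"
    and trunc_L1: "integrable lborel (trunc n f)"
    and trunc_tendsto: "(\<lambda>n. L2n lborel (\<lambda>x. trunc n f x - f x)) \<longlonglongrightarrow> 0"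
proof -
  have fm [measurable]: "f \<in> borel_measurable lborel" by (rule L2_measurable[OF f])
  have tm [measurable]: "trunc n f \<in> borel_measurable lborel" for n
    unfolding trunc_def[abs_def] by measurable
  have le: "cmod (trunc n f x) \<le> cmod (f x)" for n x by (simp add: trunc_def indicator_def norm_mult)
  show t2: "trunc n f \<in> L2 lborel" for n
    by (rule L2_bound[OF tm L2_integrable[OF f]]) (auto intro: power_mono le)
  have i2: "(\<lambda>x. indicator {- real n..real n} x :: complex) \<in> L2 lborel" for n
    by (rule bounded_support_L12[of _ "real n" 1]) (auto simp: indicator_def)
  show "integrable lborel (trunc n f)"
    using L2_integrable_mult[OF i2[of n] f] by (simp add: trunc_def[abs_def])
  show "(\<lambda>n. L2n lborel (\<lambda>x. trunc n f x - f x)) \<longlonglongrightarrow> 0"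
  proof (rule L2n_dominated[OF tm fm _ L2_integrable[OF f]])
    show "AE x in lborel. (\<lambda>n. trunc n f x) \<longlonglongrightarrow> f x"
    proof (intro AE_I2 tendsto_eventually)
      fix x
      obtain n0 :: nat where "real n0 \<ge> \<bar>x\<bar>" using real_arch_simple by blast
      then show "\<forall>\<^sub>F n in sequentially. trunc n f x = f x"
        by (intro eventually_sequentiallyI[of n0]) (auto simp: trunc_def indicator_def)
    qed
    show "AE x in lborel. cmod (trunc n f x - f x) \<le> cmod (f x)" for n
      by (intro AE_I2) (auto simp: trunc_def indicator_def)
  qed
qed

text \<open>The condition under the choice operator in \<open>fourier\<close>, restated with real
  valued norms.\<close>

definition fourier_limit :: "(real \<Rightarrow> complex) \<Rightarrow> (real \<Rightarrow> complex) \<Rightarrow> bool" where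
  "fourier_limit f h \<longleftrightarrow> h \<in> L2 lborel \<and>
     (\<forall>u. (\<forall>n. u n \<in> L2 lborel \<and> integrable lborel (u n)) \<longrightarrow>
        (\<lambda>n. L2n lborel (\<lambda>x. u n x - f x)) \<longlonglongrightarrow> 0 \<longrightarrow>
        (\<lambda>n. L2n lborel (\<lambda>t. fourier_integral (u n) t - h t)) \<longlonglongrightarrow> 0)"

lemma fourier_limit_self:
  assumes "integrable lborel f" "f \<in> L2 lborel"
  shows "fourier_limit f (fourier_integral f)"
  unfolding fourier_limit_def
proof (intro conjI allI impI fourier_integral_L2 assms)
  fix u :: "nat \<Rightarrow> real \<Rightarrow> complex"
  assume u: "\<forall>n. u n \<in> L2 lborel \<and> integrable lborel (u n)"
    and lim: "(\<lambda>n. L2n lborel (\<lambda>x. u n x - f x)) \<longlonglongrightarrow> 0"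
  have "(\<lambda>n. sqrt (2 * pi) * L2n lborel (\<lambda>x. u n x - f x)) \<longlonglongrightarrow> sqrt (2 * pi) * 0"
    by (intro tendsto_mult tendsto_const lim)
  then show "(\<lambda>n. L2n lborel (\<lambda>t. fourier_integral (u n) t - fourier_integral f t)) \<longlonglongrightarrow> 0"
    using u assms by (simp add: L2n_fourier_integral_diff)
qed

text \<open>The limit is taken along the truncations. Any other admissible sequence is close to the
  truncations, and Plancherel carries this closeness over to the transforms.\<close>

lemma fourier_limit_exists:
  assumes f: "f \<in> L2 lborel"
  shows "\<exists>h. fourier_limit f h"
proof -
  let ?t = "\<lambda>n. trunc n f"
  let ?T = "\<lambda>n. fourier_integral (?t n)"
  note t = trunc_L1[OF f] trunc_L2[OF f] trunc_tendsto[OF f]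
  have T: "?T n \<in> L2 lborel" for n by (intro fourier_integral_L2 t)
  from L2_isometric_limit[OF t(2) f t(3) T _ L2n_fourier_integral_diff[OF t(1,2) t(1,2)]]
  obtain h where h: "h \<in> L2 lborel" and hl: "(\<lambda>n. L2n lborel (\<lambda>x. ?T n x - h x)) \<longlonglongrightarrow> 0"
    by auto
  have "fourier_limit f h"
    unfolding fourier_limit_def
  proof (intro conjI allI impI h)
    fix u :: "nat \<Rightarrow> real \<Rightarrow> complex"
    assume u: "\<forall>n. u n \<in> L2 lborel \<and> integrable lborel (u n)"
      and lim: "(\<lambda>n. L2n lborel (\<lambda>x. u n x - f x)) \<longlonglongrightarrow> 0"
    have u1: "integrable lborel (u n)" and u2: "u n \<in> L2 lborel" for n using u by auto
    let ?B = "\<lambda>n. sqrt (2 * pi) * (L2n lborel (\<lambda>x. u n x - f x) + L2n lborel (\<lambda>x. ?t n x - f x))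
        + L2n lborel (\<lambda>x. ?T n x - h x)"
    show "(\<lambda>n. L2n lborel (\<lambda>t. fourier_integral (u n) t - h t)) \<longlonglongrightarrow> 0"
    proof (rule Lim_null_comparison[OF always_eventually], rule allI)
      fix n
      have "L2n lborel (\<lambda>x. u n x - ?t n x) \<le> L2n lborel (\<lambda>x. u n x - f x) + L2n lborel (\<lambda>x. ?t n x - f x)"
        using L2n_triangle_via[OF u2[of n] t(2)[of n] f] L2n_minus_commute[of lborel f "?t n"] by simp
      moreover have "L2n lborel (\<lambda>t. fourier_integral (u n) t - h t) \<le>
          sqrt (2 * pi) * L2n lborel (\<lambda>x. u n x - ?t n x) + L2n lborel (\<lambda>x. ?T n x - h x)"
        using L2n_triangle_via[OF fourier_integral_L2[OF u1 u2, of n] h T[of n]]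
        by (simp add: L2n_fourier_integral_diff u1 u2 t)
      moreover have "sqrt (2 * pi) * L2n lborel (\<lambda>x. u n x - ?t n x) \<le>
          sqrt (2 * pi) * (L2n lborel (\<lambda>x. u n x - f x) + L2n lborel (\<lambda>x. ?t n x - f x))"
        using calculation(1) by (rule mult_left_mono) simp
      ultimately show "norm (L2n lborel (\<lambda>t. fourier_integral (u n) t - h t)) \<le> ?B n"
        unfolding real_norm_def abs_of_nonneg[OF L2n_nonneg] by linarith
    next
      have "?B \<longlonglongrightarrow> sqrt (2 * pi) * (0 + 0) + 0"
        by (intro tendsto_intros lim hl t(3))
      then show "?B \<longlonglongrightarrow> 0" by simp
    qed
  qed
  then show ?thesis by blast
qed

lemma L2_norm_tendsto_0_iff:
  assumes "\<And>n. u n \<in> L2 M"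
  shows "(\<lambda>n. L2_norm M (u n)) \<longlonglongrightarrow> 0 \<longleftrightarrow> (\<lambda>n. L2n M (u n)) \<longlonglongrightarrow> 0"
proof -
  have "(\<lambda>n. ennreal (L2n M (u n))) \<longlonglongrightarrow> ennreal 0 \<longleftrightarrow> (\<lambda>n. L2n M (u n)) \<longlonglongrightarrow> 0"
    by (rule tendsto_ennreal_iff) auto
  then show ?thesis using assms by (simp add: L2_norm_eq)
qed

text \<open>Both branches of \<open>fourier\<close> meet the same characterisation, so integrable
  and non-integrable functions need no distinction from here on.\<close>

lemma fourier_limit_fourier:
  assumes f: "f \<in> L2 lborel"
  shows "fourier_limit f (fourier f)"
proof (cases "integrable lborel f")
  case True
  then show ?thesis using fourier_limit_self[OF True f] by (simp add: fourier_def)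
next
  case False
  let ?P = "\<lambda>h. h \<in> L2 lborel \<and>
       (\<forall>u :: nat \<Rightarrow> real \<Rightarrow> complex.
          (\<forall>n. u n \<in> L2 lborel \<and> integrable lborel (u n)) \<and>
          (\<lambda>n. L2_norm lborel (\<lambda>x. u n x - f x)) \<longlonglongrightarrow> 0 \<longrightarrow>
          (\<lambda>n. L2_norm lborel (\<lambda>t. fourier_integral (u n) t - h t)) \<longlonglongrightarrow> 0)"
  have eq: "?P h \<longleftrightarrow> fourier_limit f h" for h
  proof (cases "h \<in> L2 lborel")
    case True
    have "(\<lambda>n. L2_norm lborel (\<lambda>x. u n x - f x)) \<longlonglongrightarrow> 0 \<longleftrightarrow> (\<lambda>n. L2n lborel (\<lambda>x. u n x - f x)) \<longlonglongrightarrow> 0"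
      "(\<lambda>n. L2_norm lborel (\<lambda>t. fourier_integral (u n) t - h t)) \<longlonglongrightarrow> 0 \<longleftrightarrow>
        (\<lambda>n. L2n lborel (\<lambda>t. fourier_integral (u n) t - h t)) \<longlonglongrightarrow> 0"
      if "\<forall>n. u n \<in> L2 lborel \<and> integrable lborel (u n)" for u :: "nat \<Rightarrow> real \<Rightarrow> complex"
      using that by (intro L2_norm_tendsto_0_iff L2_diff f True fourier_integral_L2; simp)+
    then show ?thesis unfolding fourier_limit_def by blast
  qed (simp add: fourier_limit_def)
  have "fourier f = (SOME h. ?P h)" using False by (simp add: fourier_def)
  also have "\<dots> = (SOME h. fourier_limit f h)" by (simp only: eq)
  finally show ?thesis using someI_ex[OF fourier_limit_exists[OF f]] by simp
qed

lemma fourier_L2: "f \<in> L2 lborel \<Longrightarrow> fourier f \<in> L2 lborel"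
  using fourier_limit_fourier by (simp add: fourier_limit_def)

lemma fourier_tendsto:
  assumes "f \<in> L2 lborel" "\<And>n. u n \<in> L2 lborel" "\<And>n. integrable lborel (u n)"
    and "(\<lambda>n. L2n lborel (\<lambda>x. u n x - f x)) \<longlonglongrightarrow> 0"
  shows "(\<lambda>n. L2n lborel (\<lambda>t. fourier_integral (u n) t - fourier f t)) \<longlonglongrightarrow> 0"
  using fourier_limit_fourier[OF assms(1)] assms(2-) unfolding fourier_limit_def by blast

text \<open>The way to compute a transform in L2: it is enough to know the limit of the transforms
  along one approximating sequence, in practice a modification of the truncations.\<close>

lemma fourier_AE_eqI:
  assumes "f \<in> L2 lborel" "\<And>n. u n \<in> L2 lborel" "\<And>n. integrable lborel (u n)"
    and "(\<lambda>n. L2n lborel (\<lambda>x. u n x - f x)) \<longlonglongrightarrow> 0"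
    and "h \<in> L2 lborel" "(\<lambda>n. L2n lborel (\<lambda>t. fourier_integral (u n) t - h t)) \<longlonglongrightarrow> 0"
  shows "AE t in lborel. fourier f t = h t"
  by (rule L2_limit_unique[OF fourier_integral_L2 fourier_L2 _ fourier_tendsto])
     (use assms in auto)

lemma L2n_fourier:
  assumes f: "f \<in> L2 lborel"
  shows "L2n lborel (fourier f) = sqrt (2 * pi) * L2n lborel f"
proof (rule LIMSEQ_unique)
  note t = trunc_L1[OF f] trunc_L2[OF f] trunc_tendsto[OF f]
  have "L2n lborel (fourier_integral (trunc n f)) = sqrt (2 * pi) * L2n lborel (trunc n f)" for n
    using Plancherel_L1_L2[OF t(1,2)] by (simp add: Plancherel_def)
  moreover have "(\<lambda>n. sqrt (2 * pi) * L2n lborel (trunc n f)) \<longlonglongrightarrow> sqrt (2 * pi) * L2n lborel f"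
    by (intro tendsto_mult tendsto_const L2n_tendsto t f)
  ultimately show "(\<lambda>n. L2n lborel (fourier_integral (trunc n f))) \<longlonglongrightarrow> sqrt (2 * pi) * L2n lborel f"
    by simp
  show "(\<lambda>n. L2n lborel (fourier_integral (trunc n f))) \<longlonglongrightarrow> L2n lborel (fourier f)"
    by (intro L2n_tendsto fourier_integral_L2 t fourier_L2 f fourier_tendsto)
qed

lemma L2_tendsto_lin:
  assumes "\<And>n. u n \<in> L2 M" "f \<in> L2 M" "\<And>n. v n \<in> L2 M" "g \<in> L2 M"
    and "(\<lambda>n. L2n M (\<lambda>x. u n x - f x)) \<longlonglongrightarrow> 0" "(\<lambda>n. L2n M (\<lambda>x. v n x - g x)) \<longlonglongrightarrow> 0"
  shows "(\<lambda>n. L2n M (\<lambda>x. (u n x + k * v n x) - (f x + k * g x))) \<longlonglongrightarrow> 0"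
proof (rule Lim_null_comparison[OF always_eventually], rule allI)
  fix n
  have "L2n M (\<lambda>x. (u n x - f x) + k * (v n x - g x)) \<le> L2n M (\<lambda>x. u n x - f x) + L2n M (\<lambda>x. k * (v n x - g x))"
    by (intro L2n_triangle L2_cmult L2_diff assms)
  then show "norm (L2n M (\<lambda>x. (u n x + k * v n x) - (f x + k * g x)))
      \<le> L2n M (\<lambda>x. u n x - f x) + cmod k * L2n M (\<lambda>x. v n x - g x)"
    unfolding L2n_cmult by (simp add: algebra_simps)
next
  have "(\<lambda>n. L2n M (\<lambda>x. u n x - f x) + cmod k * L2n M (\<lambda>x. v n x - g x)) \<longlonglongrightarrow> 0 + cmod k * 0"
    by (intro tendsto_intros assms)
  then show "(\<lambda>n. L2n M (\<lambda>x. u n x - f x) + cmod k * L2n M (\<lambda>x. v n x - g x)) \<longlonglongrightarrow> 0" by simp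
qed

section \<open>Rules for the transform on L2, and its inversion\<close>

lemma fourier_lin:
  assumes f: "f \<in> L2 lborel" and g: "g \<in> L2 lborel"
  shows "AE t in lborel. fourier (\<lambda>x. f x + k * g x) t = fourier f t + k * fourier g t"
proof (rule fourier_AE_eqI)
  let ?u = "\<lambda>n x. trunc n f x + k * trunc n g x"
  note t = trunc_L1[OF f] trunc_L2[OF f] trunc_tendsto[OF f]
  note t' = trunc_L1[OF g] trunc_L2[OF g] trunc_tendsto[OF g]
  show "(\<lambda>x. f x + k * g x) \<in> L2 lborel" by (intro L2_add L2_cmult f g)
  show "?u n \<in> L2 lborel" for n by (intro L2_add L2_cmult t t')
  show "integrable lborel (?u n)" for n using t(1) t'(1) by auto
  show "(\<lambda>n. L2n lborel (\<lambda>x. ?u n x - (f x + k * g x))) \<longlonglongrightarrow> 0"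
    by (intro L2_tendsto_lin t t' f g)
  show "(\<lambda>t. fourier f t + k * fourier g t) \<in> L2 lborel" by (intro L2_add L2_cmult fourier_L2 f g)
  have "fourier_integral (?u n) t = fourier_integral (trunc n f) t + k * fourier_integral (trunc n g) t" for n t
    by (intro fourier_integral_lin t t')
  then show "(\<lambda>n. L2n lborel (\<lambda>t. fourier_integral (?u n) t - (fourier f t + k * fourier g t))) \<longlonglongrightarrow> 0"
    by (simp only:) (intro L2_tendsto_lin fourier_integral_L2 t t' fourier_L2 f g fourier_tendsto)
qed

lemma
  fixes f :: "real \<Rightarrow> complex" and a :: real
  assumes f: "f \<in> L2 lborel"
  shows L2_reflect: "(\<lambda>x. f (a - x)) \<in> L2 lborel"
    and L2n_reflect: "L2n lborel (\<lambda>x. f (a - x)) = L2n lborel f"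
proof -
  note [measurable] = L2_measurable[OF f]
  show "(\<lambda>x. f (a - x)) \<in> L2 lborel"
    using lborel_integrable_real_affine[OF L2_integrable[OF f], of "-1" a]
    by (intro L2I) auto
  show "L2n lborel (\<lambda>x. f (a - x)) = L2n lborel f"
    using lborel_integral_real_affine[of "-1" "\<lambda>x. (cmod (f x))\<^sup>2" a] by (simp add: L2n_def)
qed

lemma AE_lborel_reflect:
  fixes f g :: "real \<Rightarrow> complex" and a :: real
  assumes "AE x in lborel. f x = g x" "f \<in> borel_measurable lborel" "g \<in> borel_measurable lborel"
  shows "AE x in lborel. f (a - x) = g (a - x)"
proof -
  have [measurable]: "f \<in> borel_measurable borel" "g \<in> borel_measurable borel" using assms(2,3) by auto
  have "AE x in lborel. f (a + -1 * x) = g (a + -1 * x)"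
    by (rule AE_borel_affine[OF _ _ assms(1)]) (simp, measurable)
  then show ?thesis by simp
qed

text \<open>Reflection about a point, rather than about 0 alone, because data and approximation both
  involve the argument x0 - x. The substitution is made in the integrals of the truncations.\<close>

lemma fourier_reflect:
  assumes f: "f \<in> L2 lborel"
  shows "AE t in lborel. fourier (\<lambda>x. f (a - x)) t = cis (a * t) * fourier f (0 - t)"
proof (rule fourier_AE_eqI)
  let ?u = "\<lambda>n x. trunc n f (a - x)"
  note t = trunc_L1[OF f] trunc_L2[OF f] trunc_tendsto[OF f]
  note [measurable] = L2_measurable[OF f] L2_measurable[OF fourier_L2[OF f]]
  show "(\<lambda>x. f (a - x)) \<in> L2 lborel" by (rule L2_reflect[OF f])
  show "?u n \<in> L2 lborel" for n by (rule L2_reflect[OF t(2)])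
  show "integrable lborel (?u n)" for n
    using lborel_integrable_real_affine[OF t(1)[of n], of "-1" a] by simp
  show "(\<lambda>n. L2n lborel (\<lambda>x. ?u n x - f (a - x))) \<longlonglongrightarrow> 0"
    using t(3) L2n_reflect[OF L2_diff[OF t(2) f], where a=a] by simp
  have uni: "L2n lborel (\<lambda>t. cis (a * t) * h t) = L2n lborel h" for h
    by (simp add: L2n_def norm_mult)
  have "(\<lambda>t. fourier f (0 - t)) \<in> L2 lborel" by (rule L2_reflect[OF fourier_L2[OF f]])
  then show "(\<lambda>t. cis (a * t) * fourier f (0 - t)) \<in> L2 lborel"
    by (intro L2I) (auto simp: norm_mult dest: L2_integrable)
  have "fourier_integral (?u n) s = cis (a * s) * fourier_integral (trunc n f) (0 - s)" for n s
  proof -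
    have "fourier_integral (?u n) s = \<bar>-1\<bar> *\<^sub>R (LINT x|lborel. cis (s * (a + -1 * x)) * ?u n (a + -1 * x))"
      unfolding fourier_integral_def by (rule lborel_integral_real_affine) simp
    also have "\<dots> = (LINT x|lborel. cis (a * s) * (cis ((0 - s) * x) * trunc n f x))"
    proof -
      have "cis (s * (a + -1 * x)) = cis (a * s) * cis ((0 - s) * x)" for x
        by (simp add: cis_mult algebra_simps)
      then show ?thesis by (simp add: mult.assoc)
    qed
    also have "\<dots> = cis (a * s) * fourier_integral (trunc n f) (0 - s)"
      unfolding fourier_integral_def by (rule integral_mult_right_zero)
    finally show ?thesis .
  qed
  then have "L2n lborel (\<lambda>s. fourier_integral (?u n) s - cis (a * s) * fourier f (0 - s)) =
      L2n lborel (\<lambda>s. cis (a * s) * (fourier_integral (trunc n f) (0 - s) - fourier f (0 - s)))" for n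
    by (simp add: right_diff_distrib)
  also have "\<dots> n = L2n lborel (\<lambda>s. fourier_integral (trunc n f) s - fourier f s)" for n
    unfolding uni by (rule L2n_reflect[OF L2_diff[OF fourier_integral_L2[OF t(1,2)] fourier_L2[OF f]]])
  finally have *: "L2n lborel (\<lambda>s. fourier_integral (?u n) s - cis (a * s) * fourier f (0 - s)) =
      L2n lborel (\<lambda>s. fourier_integral (trunc n f) s - fourier f s)" for n .
  show "(\<lambda>n. L2n lborel (\<lambda>s. fourier_integral (?u n) s - cis (a * s) * fourier f (0 - s))) \<longlonglongrightarrow> 0"
    unfolding * by (rule fourier_tendsto[OF f t(2,1,3)])
qed

lemma fourier_cnj:
  assumes f: "f \<in> L2 lborel"
  shows "AE t in lborel. fourier (\<lambda>x. cnj (f x)) t = cnj (fourier f (0 - t))"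
proof (rule fourier_AE_eqI)
  let ?u = "\<lambda>n x. cnj (trunc n f x)"
  note t = trunc_L1[OF f] trunc_L2[OF f] trunc_tendsto[OF f]
  have cn: "L2n lborel (\<lambda>x. cnj (p x) - cnj (q x)) = L2n lborel (\<lambda>x. p x - q x)" for p q
    by (simp add: L2n_def flip: complex_cnj_diff)
  show "(\<lambda>x. cnj (f x)) \<in> L2 lborel" by (rule L2_cnj[OF f])
  show "?u n \<in> L2 lborel" for n by (rule L2_cnj[OF t(2)])
  show "integrable lborel (?u n)" for n using t(1) by simp
  show "(\<lambda>n. L2n lborel (\<lambda>x. ?u n x - cnj (f x))) \<longlonglongrightarrow> 0"
    using t(3) by (simp add: cn)
  show "(\<lambda>t. cnj (fourier f (0 - t))) \<in> L2 lborel" by (intro L2_cnj L2_reflect fourier_L2 f)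
  have "fourier_integral (?u n) s = cnj (fourier_integral (trunc n f) (0 - s))" for n s
    unfolding fourier_integral_def Bochner_Integration.integral_cnj[symmetric] by (simp add: cis_cnj)
  then have *: "L2n lborel (\<lambda>s. fourier_integral (?u n) s - cnj (fourier f (0 - s))) =
      L2n lborel (\<lambda>s. fourier_integral (trunc n f) s - fourier f s)" for n
    using L2n_reflect[OF L2_diff[OF fourier_integral_L2[OF t(1,2)] fourier_L2[OF f]], where a=0] by (simp add: cn)
  show "(\<lambda>n. L2n lborel (\<lambda>s. fourier_integral (?u n) s - cnj (fourier f (0 - s)))) \<longlonglongrightarrow> 0"
    unfolding * by (rule fourier_tendsto[OF f t(2,1,3)])
qed

lemma fourier_mult:
  assumes f: "f \<in> L2 lborel" and g: "g \<in> L2 lborel"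
  shows "(LINT t|lborel. fourier f t * g t) = (LINT x|lborel. f x * fourier g x)"
proof (rule LIMSEQ_unique)
  note t = trunc_L1[OF f] trunc_L2[OF f] trunc_tendsto[OF f]
  note t' = trunc_L1[OF g] trunc_L2[OF g] trunc_tendsto[OF g]
  have conv: "(\<lambda>n. LINT x|lborel. p n x * q n x) \<longlonglongrightarrow> (LINT x|lborel. p' x * q' x)"
    if "\<And>n. p n \<in> L2 lborel" "p' \<in> L2 lborel" "\<And>n. q n \<in> L2 lborel" "q' \<in> L2 lborel"
      "(\<lambda>n. L2n lborel (\<lambda>x. p n x - p' x)) \<longlonglongrightarrow> 0" "(\<lambda>n. L2n lborel (\<lambda>x. q n x - q' x)) \<longlonglongrightarrow> 0"
    for p q :: "nat \<Rightarrow> real \<Rightarrow> complex" and p' q'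
  proof -
    have "(\<lambda>n. L2n lborel (\<lambda>x. cnj (q n x) - cnj (q' x))) \<longlonglongrightarrow> 0"
      using that(6) by (simp add: L2n_def flip: complex_cnj_diff)
    then show ?thesis
      using L2_inner_tendsto[OF that(1,2) L2_cnj[OF that(3)] L2_cnj[OF that(4)] that(5)]
      by (simp add: L2_inner_def)
  qed
  show "(\<lambda>n. LINT t|lborel. fourier_integral (trunc n f) t * trunc n g t) \<longlonglongrightarrow> (LINT t|lborel. fourier f t * g t)"
    by (intro conv fourier_integral_L2 fourier_L2 t t' f g fourier_tendsto)
  have "(\<lambda>n. LINT x|lborel. trunc n f x * fourier_integral (trunc n g) x) \<longlonglongrightarrow> (LINT x|lborel. f x * fourier g x)"
    by (intro conv fourier_integral_L2 fourier_L2 t t' f g fourier_tendsto)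
  then show "(\<lambda>n. LINT t|lborel. fourier_integral (trunc n f) t * trunc n g t) \<longlonglongrightarrow> (LINT x|lborel. f x * fourier g x)"
    by (simp add: fourier_integral_mult[OF t(1) t'(1)])
qed

lemma L2n_fourier_lin:
  assumes f: "f \<in> L2 lborel" and g: "g \<in> L2 lborel"
  shows "L2n lborel (\<lambda>t. fourier f t + k * fourier g t) = sqrt (2 * pi) * L2n lborel (\<lambda>x. f x + k * g x)"
proof -
  have L: "(\<lambda>x. f x + k * g x) \<in> L2 lborel" "(\<lambda>t. fourier f t + k * fourier g t) \<in> L2 lborel"
    by (intro L2_add L2_cmult fourier_L2 f g)+
  have "L2n lborel (\<lambda>t. fourier f t + k * fourier g t) = L2n lborel (fourier (\<lambda>x. f x + k * g x))"
    by (rule L2n_cong_AE[symmetric, OF fourier_lin[OF f g]]) (intro L2_measurable fourier_L2 L)+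
  then show ?thesis by (simp add: L2n_fourier L)
qed

text \<open>Polarisation: Plancherel for f + k g determines the real part of the inner product
  multiplied by the conjugate of k.\<close>

lemma L2_inner_fourier:
  assumes f: "f \<in> L2 lborel" and g: "g \<in> L2 lborel"
  shows "L2_inner lborel (fourier f) (fourier g) = complex_of_real (2 * pi) * L2_inner lborel f g"
proof -
  have R: "Re (cnj k * L2_inner lborel (fourier f) (fourier g)) = 2 * pi * Re (cnj k * L2_inner lborel f g)" for k
  proof -
    have "(L2n lborel (\<lambda>t. fourier f t + k * fourier g t))\<^sup>2 = 2 * pi * (L2n lborel (\<lambda>x. f x + k * g x))\<^sup>2"
      by (simp add: L2n_fourier_lin[OF f g] power_mult_distrib)
    then show ?thesis
      unfolding L2n_add_sq[OF fourier_L2[OF f] L2_cmult[OF fourier_L2[OF g]]] L2n_add_sq[OF f L2_cmult[OF g]]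
        L2_inner_cmult_right L2n_cmult L2n_fourier[OF f] L2n_fourier[OF g]
      by (simp add: power_mult_distrib algebra_simps)
  qed
  \<comment> \<open>k = 1 gives the real part, k = i the imaginary part.\<close>
  show ?thesis
    using R[of 1] R[of \<i>] by (simp add: complex_eq_iff)
qed

text \<open>The difference of the two sides is tested against an arbitrary g. The multiplication
  formula moves the outer transform to the conjugate of g, where conjugation amounts to transforming
  the reflected g, and Plancherel for inner products removes the remaining transforms. Choosing g as
  the difference itself finishes the proof.\<close>

theorem fourier_fourier:
  assumes f: "f \<in> L2 lborel"
  shows "AE x in lborel. fourier (fourier f) x = complex_of_real (2 * pi) * f (0 - x)"
proof -
  let ?d = "\<lambda>x. fourier (fourier f) x - complex_of_real (2 * pi) * f (0 - x)"
  have rf: "(\<lambda>x. f (0 - x)) \<in> L2 lborel" by (rule L2_reflect[OF f])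
  have ff: "fourier (fourier f) \<in> L2 lborel" by (intro fourier_L2 f)
  have d: "?d \<in> L2 lborel" by (intro L2_diff L2_cmult rf ff)
  have z: "L2_inner lborel ?d g = 0" if g: "g \<in> L2 lborel" for g
  proof -
    let ?h = "\<lambda>x. cnj (g x)"
    have h: "?h \<in> L2 lborel" by (rule L2_cnj[OF g])
    let ?k = "\<lambda>x. g (0 - x)"
    have k: "?k \<in> L2 lborel" by (rule L2_reflect[OF g])
    have AEk: "AE t in lborel. cnj (fourier ?h t) = fourier ?k t"
    proof -
      have 1: "AE t in lborel. fourier ?h t = cnj (fourier g (0 - t))" by (rule fourier_cnj[OF g])
      have 2: "AE t in lborel. fourier ?k t = cis (0 * t) * fourier g (0 - t)" by (rule fourier_reflect[OF g])
      show ?thesis using 1 2 by eventually_elim simp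
    qed
    have "L2_inner lborel (fourier (fourier f)) g = (LINT x|lborel. fourier (fourier f) x * ?h x)"
      by (simp add: L2_inner_def)
    also have "\<dots> = (LINT x|lborel. fourier f x * fourier ?h x)"
      by (rule fourier_mult[OF fourier_L2[OF f] h])
    also have "\<dots> = L2_inner lborel (fourier f) (\<lambda>t. cnj (fourier ?h t))"
      by (simp add: L2_inner_def)
    also have "\<dots> = L2_inner lborel (fourier f) (fourier ?k)"
      by (rule L2_inner_cong_AE[OF _ AEk]) (intro L2_measurable L2_cnj fourier_L2 f h k AE_I2 refl)+
    also have "\<dots> = complex_of_real (2 * pi) * L2_inner lborel f ?k" by (rule L2_inner_fourier[OF f k])
    also have "L2_inner lborel f ?k = L2_inner lborel (\<lambda>x. f (0 - x)) g"
      using lborel_integral_real_affine[of "-1" "\<lambda>x. f x * cnj (g (0 - x))" 0] by (simp add: L2_inner_def)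
    finally show ?thesis
      unfolding L2_inner_diff[OF ff L2_cmult[OF rf] g] L2_inner_cmult by simp
  qed
  have "(L2n lborel ?d)\<^sup>2 = 0"
    using z[OF d] unfolding L2_inner_self by (simp only: of_real_eq_0_iff)
  then have "AE x in lborel. ?d x = 0" using L2n_eq_0_iff[OF d] by simp
  then show ?thesis by eventually_elim simp
qed

text \<open>By the inversion theorem the reflected transform of h, divided by 2 \<pi>, is a
  preimage; hence the choice in \<open>fourier_inv\<close> is not empty.\<close>

lemma fourier_inv_props:
  assumes h: "h \<in> L2 lborel"
  shows "fourier_inv h \<in> L2 lborel" "AE t in lborel. fourier (fourier_inv h) t = h t"
proof -
  let ?c = "complex_of_real (1 / (2 * pi))"
  let ?f = "\<lambda>x. fourier h (0 - x)"
  have f: "?f \<in> L2 lborel" by (intro L2_reflect fourier_L2 h)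
  \<comment> \<open>The summand 0 only brings the scalar multiple into the shape of
    \<open>fourier_lin\<close>.\<close>
  have L: "(\<lambda>x. 0 + ?c * ?f x) \<in> L2 lborel" by (intro L2_add L2_zero L2_cmult f)
  have 1: "AE t in lborel. fourier (\<lambda>x. 0 + ?c * ?f x) t = fourier (\<lambda>x. 0) t + ?c * fourier ?f t"
    by (rule fourier_lin[OF L2_zero f])
  have 2: "AE t in lborel. fourier ?f t = cis (0 * t) * fourier (fourier h) (0 - t)"
    by (rule fourier_reflect[OF fourier_L2[OF h]])
  have 3: "AE t in lborel. fourier (fourier h) (0 - t) = complex_of_real (2 * pi) * h (0 - (0 - t))"
    using L2_measurable[OF fourier_L2[OF fourier_L2[OF h]]] L2_measurable[OF L2_cmult[OF L2_reflect[OF h]]]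
    by (rule AE_lborel_reflect[OF fourier_fourier[OF h]])
  have 4: "fourier (\<lambda>x. 0) t = 0" for t by (simp add: fourier_def fourier_integral_def)
  have "AE t in lborel. fourier (\<lambda>x. 0 + ?c * ?f x) t = h t"
    using 1 2 3 by eventually_elim (simp add: 4)
  with L have "\<exists>f. f \<in> L2 lborel \<and> (AE t in lborel. fourier f t = h t)" by blast
  from someI_ex[OF this] show "fourier_inv h \<in> L2 lborel" "AE t in lborel. fourier (fourier_inv h) t = h t"
    unfolding fourier_inv_def by auto
qed

section \<open>The Fourier transform of the hyperbolic secant\<close>

text \<open>An exponential probability density added to its mirror image dominates the function
  after division by \<open>a\<close>.\<close>

lemma integrable_exp_abs:
  assumes "a > 0"
  shows "integrable lborel (\<lambda>t::real. exp (- a * \<bar>t\<bar>))"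
proof -
  interpret prob_space "density lborel (exponential_density a)"
    by (rule prob_space_exponential_density[OF assms])
  have i: "integrable lborel (exponential_density a)"
  proof (rule integrableI_nonneg)
    show "AE x in lborel. 0 \<le> exponential_density a x"
      using assms by (simp add: exponential_density_nonneg)
    have "(\<integral>\<^sup>+ x. ennreal (exponential_density a x) \<partial>lborel) = 1"
      using emeasure_space_1 by (simp add: emeasure_density)
    then show "(\<integral>\<^sup>+ x. ennreal (exponential_density a x) \<partial>lborel) < \<infinity>" by simp
  qed simp
  have j: "integrable lborel (\<lambda>t. exponential_density a t + exponential_density a (0 + -1 * t))"
    by (intro Bochner_Integration.integrable_add i lborel_integrable_real_affine) simp
  show ?thesis
  proof (rule Bochner_Integration.integrable_bound[OF integrable_mult_right[OF j, of "1 / a"]])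
    show "AE t in lborel. norm (exp (- a * \<bar>t\<bar>)) \<le>
        norm (1 / a * (exponential_density a t + exponential_density a (0 + -1 * t)))"
      using assms by (intro AE_I2) (auto simp: exponential_density_def mult.commute)
  qed simp
qed

lemma cosh_ge_exp_abs: "exp \<bar>t\<bar> / 2 \<le> cosh (t::real)"
  by (auto simp: cosh_field_def abs_if)

lemma inverse_cosh_le: "1 / cosh (t::real) \<le> 2 * exp (- \<bar>t\<bar>)"
proof -
  have "1 / cosh t \<le> 1 / (exp \<bar>t\<bar> / 2)"
    by (rule divide_left_mono[OF cosh_ge_exp_abs]) auto
  then show ?thesis by (simp add: exp_minus field_simps)
qed

lemma integrable_sech:
  assumes "b > 0"
  shows "integrable lborel (\<lambda>t. 1 / cosh (b * t :: real))"
proof (rule Bochner_Integration.integrable_bound[OF integrable_mult_right[OF integrable_exp_abs[OF assms], of 2]])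
  have [measurable]: "(\<lambda>t::real. cosh (b * t)) \<in> borel_measurable borel"
    by (intro borel_measurable_continuous_onI continuous_intros)
  show "(\<lambda>t. 1 / cosh (b * t)) \<in> borel_measurable lborel" by measurable
  show "AE t in lborel. norm (1 / cosh (b * t)) \<le> norm (2 * exp (- b * \<bar>t\<bar>))"
    using assms inverse_cosh_le[of "b * t" for t] by (intro AE_I2) (auto simp: abs_mult)
qed

lemma Re_cosh: "Re (cosh z) = cosh (Re z) * cos (Im z)"
  and Im_cosh: "Im (cosh z) = sinh (Re z) * sin (Im z)"
  by (simp_all add: cosh_field_def sinh_field_def Re_exp Im_exp field_simps)

text \<open>The squared modulus is cosh^2 x cos^2 y + sinh^2 x sin^2 y, in which cosh^2 is replaced
  by the smaller sinh^2. This controls the vertical sides of the contour.\<close>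

lemma cmod_cosh_ge: "\<bar>sinh (Re z)\<bar> \<le> cmod (cosh z)"
proof -
  have "(sinh (Re z))\<^sup>2 = (sinh (Re z))\<^sup>2 * ((cos (Im z))\<^sup>2 + (sin (Im z))\<^sup>2)" by simp
  also have "\<dots> \<le> (cosh (Re z))\<^sup>2 * (cos (Im z))\<^sup>2 + (sinh (Re z))\<^sup>2 * (sin (Im z))\<^sup>2"
    unfolding distrib_left by (intro add_right_mono mult_right_mono) (simp_all add: cosh_square_eq)
  also have "\<dots> = (cmod (cosh z))\<^sup>2"
    by (simp add: cmod_power2 Re_cosh Im_cosh power_mult_distrib)
  finally show ?thesis by (metis abs_le_square_iff abs_norm_cancel)
qed

lemma holomorphic_cosh: "cosh holomorphic_on (A :: complex set)"
  using analytic_imp_holomorphic[OF analytic_on_cosh[OF analytic_on_ident]] .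

lemma cosh_zero_in_strip:
  assumes "cosh z = 0" "-1 < Im z" "Im z < pi + 1"
  shows "z = \<i> * (pi / 2)"
proof -
  have "cosh (Re z) * cos (Im z) = 0" "sinh (Re z) * sin (Im z) = 0"
    using assms(1) by (simp_all flip: Re_cosh Im_cosh)
  then have c: "cos (Im z) = 0" using cosh_real_nonzero by simp
  then have "sin (Im z) \<noteq> 0" using sin_cos_squared_add[of "Im z"] by auto
  then have r: "Re z = 0" using \<open>sinh (Re z) * sin (Im z) = 0\<close> by simp
  have p: "pi > 3" by (rule pi_gt3)
  have "Im z = pi / 2"
  proof (rule ccontr)
    assume "Im z \<noteq> pi / 2"
    then consider "Im z < pi / 2" | "Im z > pi / 2" by linarith
    then show False
    proof cases
      case 1
      then have "cos (Im z) > 0" using assms p by (intro cos_gt_zero_pi) auto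
      with c show False by simp
    next
      case 2
      then have "cos (Im z - pi) > 0" using assms p by (intro cos_gt_zero_pi) auto
      with c show False by (simp add: cos_diff)
    qed
  qed
  with r show ?thesis by (simp add: complex_eq_iff)
qed

text \<open>Residue theorem on the rectangle with corners -R, R, R + i \<pi>, -R + i \<pi>. Since
  cosh (z + i \<pi>) = - cosh z, the top side repeats the bottom side up to exp (- \<pi> s); the
  only pole inside is i \<pi> / 2, and the vertical sides give the error.\<close>

lemma sech_contour:
  fixes s R :: real
  assumes R: "R > 0"
  defines "f \<equiv> \<lambda>z. exp (\<i> * s * z) / cosh z"
  shows "cmod ((1 + exp (- pi * s)) * integral {-R..R} (\<lambda>t. cis (s * t) / complex_of_real (cosh t)) - 2 * pi * exp (- pi * s / 2))
     \<le> 2 * pi * exp (pi * \<bar>s\<bar>) / sinh R"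
proof -
  define A B C D where "A = complex_of_real (-R)" "B = complex_of_real R"
    "C = Complex R pi" "D = Complex (-R) pi"
  \<comment> \<open>An open convex neighbourhood of the rectangle. Its margin 1 is below \<pi> / 2,
    so the neighbouring zeros of cosh stay outside.\<close>
  define S where "S = {z. -1 < Im z \<and> Im z < pi + 1}"
  define p where "p = \<i> * complex_of_real (pi / 2)"
  have Sc: "S = {z. Im z > -1} \<inter> {z. Im z < pi + 1}" by (auto simp: S_def)
  have So: "open S" unfolding Sc by (intro open_Int open_halfspace_Im_gt open_halfspace_Im_lt)
  have Sv: "convex S" unfolding Sc by (intro convex_Int convex_halfspace_Im_gt convex_halfspace_Im_lt)
  have pS: "p \<in> S" using pi_gt3 by (simp add: S_def p_def)
  have cp: "cosh p = 0" by (simp add: complex_eq_iff Re_cosh Im_cosh p_def)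
  have sp: "sinh p = \<i>" by (simp add: p_def complex_eq_iff sinh_field_def Re_exp Im_exp)
  have cnz: "cosh z \<noteq> 0" if "z \<in> S" "z \<noteq> p" for z
    using cosh_zero_in_strip[of z] that by (auto simp: S_def p_def)
  have holo: "f holomorphic_on S - {p}"
    unfolding f_def using cnz by (intro holomorphic_intros holomorphic_cosh) auto
  have rp: "rectpath A C = linepath A B +++ linepath B C +++ linepath C D +++ linepath D A"
    by (simp add: rectpath_def A_B_C_D_def Let_def complex_of_real_def)
  have pin: "path_image (rectpath A C) = cbox A C - box A C"
    using R by (intro path_image_rectpath_cbox_minus_box) (auto simp: A_B_C_D_def)
  have cb: "cbox A C \<subseteq> S" using pi_gt_zero by (auto simp: A_B_C_D_def S_def in_cbox_complex_iff)
  have pbox: "p \<in> box A C" using R by (auto simp: A_B_C_D_def p_def in_box_complex_iff)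
  have pi_sub: "path_image (rectpath A C) \<subseteq> S - {p}" using pin cb pbox by auto
  have res: "contour_integral (rectpath A C) f = 2 * pi * \<i> * (\<Sum>q\<in>{p}. winding_number (rectpath A C) q * residue f q)"
  proof (rule Residue_theorem[OF So convex_connected[OF Sv] _ holo _ _ pi_sub])
    show "\<forall>z. z \<notin> S \<longrightarrow> winding_number (rectpath A C) z = 0"
      using cb R by (intro allI impI winding_number_rectpath_outside) (auto simp: A_B_C_D_def)
  qed auto
  have wn: "winding_number (rectpath A C) p = 1" by (rule winding_number_rectpath[OF pbox])
  have rs: "residue f p = exp (\<i> * s * p) / \<i>"
    unfolding f_def
  proof (rule residue_simple_pole_deriv[of _ UNIV])
    show "(cosh has_field_derivative \<i>) (at p)"
      using has_field_derivative_cosh[OF DERIV_ident, of p] sp by simp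
  qed (auto intro!: holomorphic_intros holomorphic_cosh simp: cp)
  have val: "contour_integral (rectpath A C) f = 2 * pi * exp (- pi * s / 2)"
  proof -
    have "exp (\<i> * s * p) = complex_of_real (exp (- pi * s / 2))"
    proof -
      have "\<i> * s * p = complex_of_real (- pi * s / 2)" by (simp add: p_def complex_eq_iff)
      then show ?thesis by (simp only: exp_of_real)
    qed
    then have r: "residue f p = complex_of_real (exp (- pi * s / 2)) / \<i>" by (simp only: rs)
    have "2 * pi * \<i> * (\<Sum>q\<in>{p}. winding_number (rectpath A C) q * residue f q) = 2 * pi * \<i> * (z / \<i>)"
      if "residue f p = z / \<i>" for z
      using that by (simp add: wn)
    moreover have "complex_of_real (2 * pi) * \<i> * (complex_of_real E / \<i>) = complex_of_real (2 * pi * E)" for E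
      by simp
    ultimately show ?thesis unfolding res using r by presburger
  qed
  have cf: "continuous_on (path_image (rectpath A C)) f"
    using holomorphic_on_imp_continuous_on[OF holo] pi_sub continuous_on_subset by blast
  have segs: "path_image (rectpath A C) = closed_segment A B \<union> closed_segment B C \<union> closed_segment C D \<union> closed_segment D A"
    by (simp add: rp path_image_join Un_assoc)
  have ci: "f contour_integrable_on linepath A B" "f contour_integrable_on linepath B C"
    "f contour_integrable_on linepath C D" "f contour_integrable_on linepath D A"
    by (rule contour_integrable_continuous_linepath, rule continuous_on_subset[OF cf], use segs in blast)+
  have sum: "contour_integral (rectpath A C) f = contour_integral (linepath A B) f + contour_integral (linepath B C) f
      + contour_integral (linepath C D) f + contour_integral (linepath D A) f"
    by (simp add: rp ci add.assoc)
  let ?I = "contour_integral (linepath A B) f"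
  \<comment> \<open>Two signs cancel: one from cosh (z + i \<pi>) = - cosh z, one from running
    through the top side backwards.\<close>
  have top: "contour_integral (linepath C D) f = exp (- pi * s) * ?I"
  proof -
    have "(f has_contour_integral ?I) (linepath A B)" by (rule has_contour_integral_integral[OF ci(1)])
    then have "(f has_contour_integral - ?I) (reversepath (linepath A B))"
      by (intro has_contour_integral_reversepath) auto
    then have "(f has_contour_integral - ?I) (linepath B A)" by simp
    then have *: "((\<lambda>x. f (linepath B A x) * (A - B)) has_integral - ?I) {0..1}"
      by (simp only: has_contour_integral_linepath)
    have "((\<lambda>x. - exp (- pi * s) * (f (linepath B A x) * (A - B))) has_integral - exp (- pi * s) * - ?I) {0..1}"
      by (rule has_integral_mult_right[OF *])
    moreover have "- exp (- pi * s) * (f (linepath B A x) * (A - B)) = f (linepath C D x) * (D - C)" for x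
    proof -
      have l: "linepath C D x = linepath B A x + \<i> * pi"
        by (simp add: linepath_def A_B_C_D_def complex_eq_iff algebra_simps)
      have "cosh (linepath B A x + \<i> * pi) = - cosh (linepath B A x)"
        by (simp add: complex_eq_iff Re_cosh Im_cosh)
      moreover have "exp (\<i> * s * (linepath B A x + \<i> * pi)) = exp (- pi * s) * exp (\<i> * s * linepath B A x)"
      proof -
        have "\<i> * s * (linepath B A x + \<i> * pi) = complex_of_real (- pi * s) + \<i> * s * linepath B A x"
          by (simp add: complex_eq_iff algebra_simps)
        then show ?thesis by (simp only: exp_add exp_of_real)
      qed
      moreover have "D - C = A - B" by (simp add: A_B_C_D_def complex_eq_iff)
      ultimately show ?thesis by (simp add: l f_def)
    qed
    ultimately have "(f has_contour_integral exp (- pi * s) * ?I) (linepath C D)"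
      by (simp add: has_contour_integral_linepath)
    then show ?thesis by (rule contour_integral_unique)
  qed
  have side: "cmod (contour_integral (linepath P Q) f) \<le> pi * exp (pi * \<bar>s\<bar>) / sinh R"
    if PQ: "f contour_integrable_on linepath P Q" "cmod (Q - P) = pi"
      and seg: "\<And>z. z \<in> closed_segment P Q \<Longrightarrow> \<bar>Re z\<bar> = R \<and> \<bar>Im z\<bar> \<le> pi" for P Q
  proof -
    have sR: "sinh R > 0" using R by simp
    have "cmod (contour_integral (linepath P Q) f) \<le> exp (pi * \<bar>s\<bar>) / sinh R * cmod (Q - P)"
    proof (rule has_contour_integral_bound_linepath[OF has_contour_integral_integral[OF PQ(1)]])
      show "0 \<le> exp (pi * \<bar>s\<bar>) / sinh R" using sR by simp
      fix z assume "z \<in> closed_segment P Q"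
      then have z: "\<bar>Re z\<bar> = R" "\<bar>Im z\<bar> \<le> pi" using seg by auto
      have "cmod (exp (\<i> * s * z)) = exp (- s * Im z)" by (simp add: norm_exp_eq_Re)
      also have "\<dots> \<le> exp (pi * \<bar>s\<bar>)"
      proof -
        have "- s * Im z \<le> \<bar>s\<bar> * \<bar>Im z\<bar>" by (metis abs_ge_self abs_minus_cancel abs_mult)
        also have "\<dots> \<le> \<bar>s\<bar> * pi" by (intro mult_left_mono z) simp
        finally show ?thesis by (simp add: mult.commute)
      qed
      finally have 1: "cmod (exp (\<i> * s * z)) \<le> exp (pi * \<bar>s\<bar>)" .
      have "\<bar>sinh (Re z)\<bar> = sinh R" using z(1) R by (cases "Re z \<ge> 0") auto
      then have 2: "sinh R \<le> cmod (cosh z)" using cmod_cosh_ge[of z] by simp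
      show "cmod (f z) \<le> exp (pi * \<bar>s\<bar>) / sinh R"
        unfolding f_def norm_divide using 1 2 sR by (intro frac_le) auto
    qed
    then show ?thesis using PQ(2) by (simp add: mult.commute)
  qed
  have s1: "cmod (contour_integral (linepath B C) f) \<le> pi * exp (pi * \<bar>s\<bar>) / sinh R"
  proof (rule side[OF ci(2)])
    show "cmod (C - B) = pi" by (simp add: A_B_C_D_def cmod_def)
    fix z assume "z \<in> closed_segment B C"
    then show "\<bar>Re z\<bar> = R \<and> \<bar>Im z\<bar> \<le> pi"
      using R closed_segment_same_Re[of B C] pi_ge_zero by (auto simp: A_B_C_D_def closed_segment_eq_real_ivl)
  qed
  have s2: "cmod (contour_integral (linepath D A) f) \<le> pi * exp (pi * \<bar>s\<bar>) / sinh R"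
  proof (rule side[OF ci(4)])
    show "cmod (A - D) = pi" by (simp add: A_B_C_D_def cmod_def)
    fix z assume "z \<in> closed_segment D A"
    then show "\<bar>Re z\<bar> = R \<and> \<bar>Im z\<bar> \<le> pi"
      using R closed_segment_same_Re[of D A] pi_ge_zero by (auto simp: A_B_C_D_def closed_segment_eq_real_ivl)
  qed
  have I: "?I = integral {-R..R} (\<lambda>t. cis (s * t) / complex_of_real (cosh t))"
  proof -
    have "?I = integral {Re A..Re B} (\<lambda>t. f (of_real t))"
      using R by (intro contour_integral_linepath_Reals_eq) (auto simp: A_B_C_D_def)
    moreover have "f (of_real t) = cis (s * t) / complex_of_real (cosh t)" for t
      by (simp add: f_def cis_conv_exp cosh_field_def mult.assoc flip: exp_of_real)
    ultimately show ?thesis by (simp add: A_B_C_D_def)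
  qed
  have "(1 + exp (- pi * s)) * ?I - 2 * pi * exp (- pi * s / 2) =
      - (contour_integral (linepath B C) f + contour_integral (linepath D A) f)"
    using val sum top by (simp add: algebra_simps)
  then have "cmod ((1 + exp (- pi * s)) * ?I - 2 * pi * exp (- pi * s / 2)) \<le>
      cmod (contour_integral (linepath B C) f) + cmod (contour_integral (linepath D A) f)"
    by (simp only: norm_minus_cancel norm_triangle_ineq)
  with s1 s2 show ?thesis unfolding I by simp
qed

text \<open>As R grows the contour estimate becomes (1 + exp (- \<pi> s)) I = 2 \<pi> exp (- \<pi> s
  / 2), and dividing out gives \<pi> / cosh (\<pi> s / 2).\<close>

lemma sech_transform_std:
  "(LINT t|lborel. cis (s * t) / complex_of_real (cosh t)) = complex_of_real (pi / cosh (pi * s / 2))"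
proof -
  let ?f = "\<lambda>t. cis (s * t) / complex_of_real (cosh t)"
  have [measurable]: "(\<lambda>t::real. cosh t) \<in> borel_measurable borel"
    by (intro borel_measurable_continuous_onI continuous_intros)
  have si: "integrable lborel (\<lambda>t::real. 1 / cosh t)" using integrable_sech[of 1] by simp
  have fi: "integrable lborel ?f"
    by (rule Bochner_Integration.integrable_bound[OF si]) (auto simp: norm_divide)
  \<comment> \<open>The radius n + 1 is positive also for n = 0, as \<open>sech_contour\<close>
    requires.\<close>
  define I where "I n = integral {- (real n + 1)..real n + 1} ?f" for n
  have "(\<lambda>n. LINT t|lborel. indicator {- (real n + 1)..real n + 1} t *\<^sub>R ?f t) \<longlonglongrightarrow> (LINT t|lborel. ?f t)"
  proof (rule integral_dominated_convergence[OF _ _ si])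
    show "AE t in lborel. (\<lambda>n. indicator {- (real n + 1)..real n + 1} t *\<^sub>R ?f t) \<longlonglongrightarrow> ?f t"
    proof (intro AE_I2 tendsto_eventually)
      fix t :: real
      obtain n0 :: nat where "real n0 \<ge> \<bar>t\<bar>" using real_arch_simple by blast
      then show "\<forall>\<^sub>F n in sequentially. indicator {- (real n + 1)..real n + 1} t *\<^sub>R ?f t = ?f t"
        by (intro eventually_sequentiallyI[of n0]) (auto simp: indicator_def)
    qed
    show "AE t in lborel. norm (indicator {- (real n + 1)..real n + 1} t *\<^sub>R ?f t) \<le> 1 / cosh t" for n
      by (intro AE_I2) (auto simp: norm_divide indicator_def)
  qed auto
  moreover have "(LINT t|lborel. indicator {- (real n + 1)..real n + 1} t *\<^sub>R ?f t) = I n" for n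
  proof -
    have "set_integrable lborel {- (real n + 1)..real n + 1} ?f"
      unfolding set_integrable_def by (rule integrable_mult_indicator[OF _ fi]) simp
    from set_borel_integral_eq_integral(2)[OF this] show ?thesis
      by (simp add: I_def set_lebesgue_integral_def)
  qed
  ultimately have lim: "I \<longlonglongrightarrow> (LINT t|lborel. ?f t)" by simp
  have "(\<lambda>n. (1 + exp (- pi * s)) * I n - 2 * pi * exp (- pi * s / 2)) \<longlonglongrightarrow> 0"
  proof (rule Lim_null_comparison[OF always_eventually], rule allI)
    fix n
    show "norm ((1 + exp (- pi * s)) * I n - 2 * pi * exp (- pi * s / 2)) \<le>
        2 * pi * exp (pi * \<bar>s\<bar>) / sinh (real n + 1)"
      unfolding I_def by (rule sech_contour) simp
    have "filterlim (\<lambda>n. sinh (real n + 1)) at_top sequentially"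
      by (rule filterlim_compose[OF sinh_real_at_top])
         (rule filterlim_at_top_mono[OF filterlim_real_sequentially], simp)
    then show "(\<lambda>n. 2 * pi * exp (pi * \<bar>s\<bar>) / sinh (real n + 1)) \<longlonglongrightarrow> 0"
      by (intro tendsto_divide_0[OF tendsto_const] filterlim_at_top_imp_at_infinity)
  qed
  moreover have "(\<lambda>n. (1 + exp (- pi * s)) * I n - 2 * pi * exp (- pi * s / 2)) \<longlonglongrightarrow>
      (1 + exp (- pi * s)) * (LINT t|lborel. ?f t) - 2 * pi * exp (- pi * s / 2)"
    by (intro tendsto_intros lim)
  ultimately have eq: "(1 + exp (- pi * s)) * (LINT t|lborel. ?f t) - 2 * pi * exp (- pi * s / 2) = 0"
    using LIMSEQ_unique by blast
  have pos: "1 + exp (- pi * s) > 0" by (simp add: add_pos_pos)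
  have "pi / cosh (pi * s / 2) * (1 + exp (- pi * s)) = 2 * pi * exp (- pi * s / 2)"
  proof -
    have "exp (- pi * s / 2) * (exp (pi * s / 2) + exp (- (pi * s / 2))) = 1 + exp (- pi * s)"
      unfolding distrib_left exp_add[symmetric] by simp
    moreover have "exp (pi * s / 2) + exp (- (pi * s / 2)) > 0" by (simp add: add_pos_pos)
    ultimately show ?thesis by (simp add: cosh_field_def field_simps)
  qed
  then have "complex_of_real (1 + exp (- pi * s)) * complex_of_real (pi / cosh (pi * s / 2)) =
      complex_of_real (2 * pi * exp (- pi * s / 2))"
    by (simp only: mult.commute flip: of_real_mult)
  also have "\<dots> = complex_of_real (1 + exp (- pi * s)) * (LINT t|lborel. ?f t)"
    using eq by simp
  finally have "complex_of_real (1 + exp (- pi * s)) * complex_of_real (pi / cosh (pi * s / 2)) =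
      complex_of_real (1 + exp (- pi * s)) * (LINT t|lborel. ?f t)" .
  moreover have "complex_of_real (1 + exp (- pi * s)) \<noteq> 0"
    unfolding of_real_eq_0_iff using pos by simp
  ultimately show ?thesis unfolding mult_cancel_left by simp
qed

text \<open>The substitution t to b t in the standard case. With s = c (x - y) this is the kernel of
  \<open>Qop (c / b)\<close> up to the factor 1 / c.\<close>

lemma sech_transform:
  assumes b: "b > 0"
  shows "(LINT t|lborel. cis (s * t) / complex_of_real (cosh (b * t))) =
           complex_of_real (pi / b / cosh (pi * s / (2 * b)))"
proof -
  have "(LINT t|lborel. cis (s / b * t) / complex_of_real (cosh t)) =
      \<bar>b\<bar> *\<^sub>R (LINT t|lborel. cis (s / b * (0 + b * t)) / complex_of_real (cosh (0 + b * t)))"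
    using b by (intro lborel_integral_real_affine) simp
  then have "complex_of_real (pi / cosh (pi * (s / b) / 2)) =
      b * (LINT t|lborel. cis (s * t) / complex_of_real (cosh (b * t)))"
    unfolding sech_transform_std using b by (simp add: scaleR_conv_of_real)
  then show ?thesis using b by (simp add: field_simps)
qed

section \<open>The truncated Fourier transform and its adjoint\<close>

lemma space_unit_interval [simp]: "space unit_interval_measure = {-1<..<1}"
  by (simp add: unit_interval_measure_def space_restrict_space)

lemma finite_measure_unit_interval: "finite_measure unit_interval_measure"
  by (rule finite_measureI) (simp add: unit_interval_measure_def emeasure_restrict_space space_restrict_space)

interpretation unit_interval: finite_measure unit_interval_measure
  by (rule finite_measure_unit_interval)

lemma measure_unit_interval: "measure unit_interval_measure {-1<..<1} = 2"
  by (simp add: unit_interval_measure_def measure_restrict_space)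

lemma measurable_unit_interval:
  "f \<in> borel_measurable borel \<Longrightarrow> f \<in> borel_measurable unit_interval_measure"
  unfolding unit_interval_measure_def by (rule measurable_restrict_space1) simp

text \<open>The sigma algebra on the interval is the trace of the Borel sets, so joint measurability
  of a kernel is pulled back along the inclusion.\<close>

lemma unit_interval_fst_kernel:
  fixes k :: "real \<times> real \<Rightarrow> complex"
  assumes "k \<in> borel_measurable (borel \<Otimes>\<^sub>M borel)"
  shows "(\<lambda>(x, t). k (x, t)) \<in> borel_measurable (unit_interval_measure \<Otimes>\<^sub>M borel)"
proof -
  have "(\<lambda>z. (fst z, snd z)) \<in> unit_interval_measure \<Otimes>\<^sub>M borel \<rightarrow>\<^sub>M (borel \<Otimes>\<^sub>M borel :: (real \<times> real) measure)"
    by (intro measurable_Pair measurable_compose[OF measurable_fst measurable_unit_interval] measurable_snd) simp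
  from measurable_compose[OF this assms] show ?thesis by (simp add: case_prod_beta)
qed

lemma unit_interval_snd_kernel:
  fixes k :: "real \<times> real \<Rightarrow> complex"
  assumes "k \<in> borel_measurable (borel \<Otimes>\<^sub>M borel)"
  shows "(\<lambda>(t, x). k (t, x)) \<in> borel_measurable (borel \<Otimes>\<^sub>M unit_interval_measure)"
proof -
  have "(\<lambda>z. (fst z, snd z)) \<in> borel \<Otimes>\<^sub>M unit_interval_measure \<rightarrow>\<^sub>M (borel \<Otimes>\<^sub>M borel :: (real \<times> real) measure)"
    by (intro measurable_Pair measurable_compose[OF measurable_snd measurable_unit_interval] measurable_fst) simp
  from measurable_compose[OF this assms] show ?thesis by (simp add: case_prod_beta)
qed

lemma borel_measurable_pair_lborel:
  "borel_measurable (M \<Otimes>\<^sub>M lborel) = borel_measurable (M \<Otimes>\<^sub>M borel)"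
  "borel_measurable (lborel \<Otimes>\<^sub>M M) = borel_measurable (borel \<Otimes>\<^sub>M M)"
  by (intro measurable_cong_sets sets_pair_measure_cong; simp)+

lemma L2_unit_interval_bounded:
  assumes "f \<in> borel_measurable unit_interval_measure" "\<And>x. -1 < x \<Longrightarrow> x < 1 \<Longrightarrow> cmod (f x) \<le> B"
  shows "f \<in> L2 unit_interval_measure"
proof (rule L2_bound[OF assms(1)])
  show "integrable unit_interval_measure (\<lambda>x. B\<^sup>2)" by simp
qed (use assms(2) in \<open>auto intro!: power_mono\<close>)

lemma L2_unit_interval_integrable:
  assumes "h \<in> L2 unit_interval_measure"
  shows "integrable unit_interval_measure h"
proof -
  have "(\<lambda>x. 1) \<in> L2 unit_interval_measure" by (rule L2_unit_interval_bounded[of _ 1]) auto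
  from L2_integrable_mult[OF this assms] show ?thesis by simp
qed

lemma L2n_unit_interval_one: "L2n unit_interval_measure (\<lambda>x. 1) = sqrt 2"
  by (simp add: L2n_def measure_unit_interval)

lemma L1_le_L2_unit_interval:
  assumes h: "h \<in> L2 unit_interval_measure"
  shows "(LINT x|unit_interval_measure. cmod (h x)) \<le> sqrt 2 * L2n unit_interval_measure h"
proof -
  have "(\<lambda>x. 1) \<in> L2 unit_interval_measure" by (rule L2_unit_interval_bounded[of _ 1]) auto
  from L2_Cauchy_Schwarz[OF this h] show ?thesis by (simp add: L2n_unit_interval_one)
qed

lemma AE_unit_interval_iff:
  "(AE x in unit_interval_measure. P x) \<longleftrightarrow> (AE x in lborel. -1 < x \<and> x < 1 \<longrightarrow> P x)"
  unfolding unit_interval_measure_def by (subst AE_restrict_space_iff) auto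

section \<open>The weighted space\<close>

lemma cosh_measurable [measurable]: "(\<lambda>t. cosh (b * t :: real)) \<in> borel_measurable borel"
  by (intro borel_measurable_continuous_onI continuous_intros)

lemma sets_cosh_measure [measurable_cong]: "sets (cosh_measure b) = sets borel"
  by (simp add: cosh_measure_def)

lemma space_cosh_measure [simp]: "space (cosh_measure b) = UNIV"
  by (simp add: cosh_measure_def)

lemma integral_cosh_measure:
  fixes f :: "real \<Rightarrow> 'a::{banach, second_countable_topology}"
  assumes "f \<in> borel_measurable borel"
  shows "integral\<^sup>L (cosh_measure b) f = (LINT t|lborel. cosh (b * t) *\<^sub>R f t)"
  unfolding cosh_measure_def by (rule integral_density) (use assms in auto)

lemma integrable_cosh_measure:
  fixes f :: "real \<Rightarrow> 'a::{banach, second_countable_topology}"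
  assumes "f \<in> borel_measurable borel"
  shows "integrable (cosh_measure b) f \<longleftrightarrow> integrable lborel (\<lambda>t. cosh (b * t) *\<^sub>R f t)"
  unfolding cosh_measure_def by (rule integrable_density) (use assms in auto)

lemma borel_measurable_cosh_measure: "borel_measurable (cosh_measure b) = borel_measurable borel"
  by (rule measurable_cong_sets) (simp_all add: sets_cosh_measure)

lemma L2_cosh_measurable: "f \<in> L2 (cosh_measure b) \<Longrightarrow> f \<in> borel_measurable borel"
  using L2_measurable[of f "cosh_measure b"] by (simp add: borel_measurable_cosh_measure)

lemma L2_cosh_iff:
  "f \<in> L2 (cosh_measure b) \<longleftrightarrow>
     f \<in> borel_measurable borel \<and> integrable lborel (\<lambda>t. cosh (b * t) * (cmod (f t))\<^sup>2)"
proof (cases "f \<in> borel_measurable borel")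
  case True
  then have "(\<lambda>t. (cmod (f t))\<^sup>2) \<in> borel_measurable borel" by measurable
  from integrable_cosh_measure[OF this] True show ?thesis
    by (simp add: L2_def borel_measurable_cosh_measure)
qed (simp add: L2_def borel_measurable_cosh_measure)

lemma L2n_cosh:
  assumes "f \<in> borel_measurable borel"
  shows "L2n (cosh_measure b) f = sqrt (LINT t|lborel. cosh (b * t) * (cmod (f t))\<^sup>2)"
  unfolding L2n_def by (subst integral_cosh_measure) (use assms in auto)

lemma AE_cosh_measure: "(AE t in cosh_measure b. P t) \<longleftrightarrow> (AE t in lborel. P t)"
  unfolding cosh_measure_def by (subst AE_density) auto

lemma L2_cosh_L2:
  assumes f: "f \<in> L2 (cosh_measure b)"
  shows "f \<in> L2 lborel" "L2n lborel f \<le> L2n (cosh_measure b) f"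
proof -
  have [measurable]: "f \<in> borel_measurable borel" and i: "integrable lborel (\<lambda>t. cosh (b * t) * (cmod (f t))\<^sup>2)"
    using f by (auto simp: L2_cosh_iff)
  have le: "(cmod (f t))\<^sup>2 \<le> cosh (b * t) * (cmod (f t))\<^sup>2" for t
    using mult_right_mono[OF cosh_real_ge_1[of "b * t"], of "(cmod (f t))\<^sup>2"] by simp
  show f': "f \<in> L2 lborel" by (rule L2_bound[OF _ i le]) measurable
  show "L2n lborel f \<le> L2n (cosh_measure b) f"
    unfolding L2n_cosh[OF \<open>f \<in> borel_measurable borel\<close>] unfolding L2n_def
    by (intro real_sqrt_le_mono integral_mono L2_integrable f' i le)
qed

text \<open>The weight in L2 amounts to an exponential moment in L1 of any rate below b / 2. This
  makes the functions integrable and their transforms analytic near the real line.\<close>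

lemma L2_cosh_exp_integrable:
  assumes f: "f \<in> L2 (cosh_measure b)" and a: "0 \<le> a" "2 * a < b"
  shows "integrable lborel (\<lambda>t. exp (a * \<bar>t\<bar>) * cmod (f t))"
proof -
  have [measurable]: "f \<in> borel_measurable borel" and i: "integrable lborel (\<lambda>t. cosh (b * t) * (cmod (f t))\<^sup>2)"
    using f by (auto simp: L2_cosh_iff)
  have b: "b > 0" using a by simp
  have j: "integrable lborel (\<lambda>t. 2 * exp (- (b - 2 * a) * \<bar>t\<bar>))"
    using a by (intro integrable_mult_right integrable_exp_abs) simp
  show ?thesis
  proof (rule Bochner_Integration.integrable_bound[OF Bochner_Integration.integrable_add[OF i j]])
    show "AE t in lborel. norm (exp (a * \<bar>t\<bar>) * cmod (f t)) \<le>
        norm (cosh (b * t) * (cmod (f t))\<^sup>2 + 2 * exp (- (b - 2 * a) * \<bar>t\<bar>))"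
    proof (rule AE_I2)
      fix t :: real
      define F where "F = cmod (f t)"
      \<comment> \<open>The exponential is split so that p^2 is controlled by the weighted square of
        f, while q^2 is integrable because 2 a < b.\<close>
      define p where "p = exp (b * \<bar>t\<bar> / 2) * F"
      define q where "q = exp (- (b - 2 * a) * \<bar>t\<bar> / 2)"
      have pq: "exp (a * \<bar>t\<bar>) * F = p * q"
        by (simp add: p_def q_def field_simps flip: exp_add)
      have "p\<^sup>2 / 2 \<le> cosh (b * t) * F\<^sup>2"
      proof -
        have "p\<^sup>2 / 2 = exp \<bar>b * t\<bar> / 2 * F\<^sup>2"
          using b by (simp add: p_def power_mult_distrib abs_mult flip: exp_double)
        also have "\<dots> \<le> cosh (b * t) * F\<^sup>2" by (intro mult_right_mono cosh_ge_exp_abs) simp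
        finally show ?thesis .
      qed
      moreover have "q\<^sup>2 = exp (- (b - 2 * a) * \<bar>t\<bar>)"
        by (simp add: q_def flip: exp_double)
      moreover have "p * q \<le> p\<^sup>2 / 2 + 2 * q\<^sup>2"
      proof -
        have "0 \<le> (p / 2 - q)\<^sup>2 + p\<^sup>2 / 4 + q\<^sup>2" by simp
        then show ?thesis by (simp add: power2_eq_square algebra_simps)
      qed
      ultimately have "exp (a * \<bar>t\<bar>) * F \<le> cosh (b * t) * F\<^sup>2 + 2 * exp (- (b - 2 * a) * \<bar>t\<bar>)"
        using pq by linarith
      moreover have "0 \<le> exp (a * \<bar>t\<bar>) * F" by (simp add: F_def)
      ultimately show "norm (exp (a * \<bar>t\<bar>) * cmod (f t)) \<le>
          norm (cosh (b * t) * (cmod (f t))\<^sup>2 + 2 * exp (- (b - 2 * a) * \<bar>t\<bar>))"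
        unfolding F_def real_norm_def by linarith
    qed
  qed measurable
qed

lemma L2_cosh_integrable:
  assumes "b > 0" "f \<in> L2 (cosh_measure b)"
  shows "integrable lborel f"
  using L2_cosh_exp_integrable[OF assms(2), of 0] assms L2_cosh_measurable[OF assms(2)]
  by (simp add: integrable_norm_iff)

section \<open>The adjoint and its composition with the truncated transform\<close>

lemma Fop_eq:
  assumes "b > 0" "u \<in> L2 (cosh_measure b)"
  shows "Fop c u = (\<lambda>x. fourier_integral u (c * x))"
  using L2_cosh_integrable[OF assms] by (simp add: Fop_def[abs_def] fourier_def)

text \<open>An explicit version of the adjoint. The division by cosh compensates the weight of the
  inner product on its target.\<close>

definition Astar :: "real \<Rightarrow> real \<Rightarrow> (real \<Rightarrow> complex) \<Rightarrow> real \<Rightarrow> complex" where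
  "Astar b c h t = (LINT x|unit_interval_measure. cis (- (c * x * t)) * h x) / complex_of_real (cosh (b * t))"

locale cosh_weight =
  fixes b c :: real
  assumes b_pos: "b > 0" and c_pos: "c > 0"
begin

abbreviation "U \<equiv> unit_interval_measure"
abbreviation "W \<equiv> cosh_measure b"

lemma Astar_measurable:
  assumes "h \<in> L2 U"
  shows "Astar b c h \<in> borel_measurable borel"
proof -
  have [measurable]: "h \<in> borel_measurable U" using assms by (rule L2_measurable)
  have "(\<lambda>(t, x). cis (- (c * x * t))) \<in> borel_measurable (borel \<Otimes>\<^sub>M U)"
    using unit_interval_snd_kernel[of "\<lambda>(t, x). cis (- (c * x * t))"] by simp
  moreover have "(\<lambda>z. h (snd z)) \<in> borel_measurable (borel \<Otimes>\<^sub>M U)"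
    by (rule measurable_compose[OF measurable_snd]) fact
  ultimately have "(\<lambda>(t, x). cis (- (c * x * t)) * h x) \<in> borel_measurable (borel \<Otimes>\<^sub>M U)"
    by (simp add: case_prod_beta)
  then have [measurable]: "(\<lambda>t. LINT x|U. cis (- (c * x * t)) * h x) \<in> borel_measurable borel"
    by (rule unit_interval.borel_measurable_lebesgue_integral)
  then show ?thesis unfolding Astar_def[abs_def] by measurable
qed

lemma Astar_L2:
  assumes h: "h \<in> L2 U"
  shows "Astar b c h \<in> L2 W"
proof -
  note [measurable] = Astar_measurable[OF h]
  define B where "B = (LINT x|U. cmod (h x))"
  have le: "cosh (b * t) * (cmod (Astar b c h t))\<^sup>2 \<le> B\<^sup>2 * (1 / cosh (b * t))" for t
  proof -
    have "cmod (LINT x|U. cis (- (c * x * t)) * h x) \<le> (LINT x|U. cmod (cis (- (c * x * t)) * h x))"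
      by (rule integral_norm_bound)
    then have "cmod (LINT x|U. cis (- (c * x * t)) * h x) \<le> B" by (simp add: norm_mult B_def)
    then have "cmod (Astar b c h t) \<le> B / cosh (b * t)"
      by (simp add: Astar_def norm_divide divide_right_mono)
    then have "(cmod (Astar b c h t))\<^sup>2 \<le> (B / cosh (b * t))\<^sup>2" by (intro power_mono) auto
    then have "cosh (b * t) * (cmod (Astar b c h t))\<^sup>2 \<le> cosh (b * t) * (B / cosh (b * t))\<^sup>2"
      by (intro mult_left_mono) auto
    also have "\<dots> = B\<^sup>2 * (1 / cosh (b * t))" by (simp add: power2_eq_square)
    finally show ?thesis .
  qed
  have "integrable lborel (\<lambda>t. cosh (b * t) * (cmod (Astar b c h t))\<^sup>2)"
  proof (rule Bochner_Integration.integrable_bound[OF integrable_mult_right[OF integrable_sech[OF b_pos]]])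
    show "AE t in lborel. norm (cosh (b * t) * (cmod (Astar b c h t))\<^sup>2) \<le> norm (B\<^sup>2 * (1 / cosh (b * t)))"
      using le by (intro AE_I2) simp
  qed measurable
  then show ?thesis by (simp add: L2_cosh_iff Astar_measurable[OF h])
qed

lemma Fop_L2:
  assumes u: "u \<in> L2 W"
  shows "Fop c u \<in> L2 U"
proof (rule L2_unit_interval_bounded)
  have [measurable]: "u \<in> borel_measurable borel" by (rule L2_cosh_measurable[OF u])
  have "(\<lambda>x. fourier_integral u (c * x)) \<in> borel_measurable borel" by measurable
  then show "Fop c u \<in> borel_measurable U"
    unfolding Fop_eq[OF b_pos u] by (rule measurable_unit_interval)
  show "cmod (Fop c u x) \<le> (LINT x|lborel. cmod (u x))" for x
    unfolding Fop_eq[OF b_pos u] by (rule fourier_integral_bound[OF L2_cosh_integrable[OF b_pos u]])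
qed

lemma Astar_adjoint:
  assumes u: "u \<in> L2 W" and h: "h \<in> L2 U"
  shows "L2_inner U (Fop c u) h = L2_inner W u (Astar b c h)"
proof -
  have [measurable]: "u \<in> borel_measurable borel" by (rule L2_cosh_measurable[OF u])
  note [measurable] = Astar_measurable[OF h]
  have "L2_inner U (Fop c u) h = (LINT x|U. cnj (h x) * (LINT t|lborel. cis (c * x * t) * u t))"
    by (simp add: L2_inner_def Fop_eq[OF b_pos u] fourier_integral_def mult.commute)
  also have "\<dots> = (LINT t|lborel. u t * (LINT x|U. cis (c * x * t) * cnj (h x)))"
  proof (rule Fubini_kernel[where B=1, OF unit_interval.sigma_finite_measure_axioms sigma_finite_lborel])
    show "integrable U (\<lambda>x. cnj (h x))" using L2_unit_interval_integrable[OF h] by simp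
    show "integrable lborel u" by (rule L2_cosh_integrable[OF b_pos u])
    show "(\<lambda>(x, t). cis (c * x * t)) \<in> borel_measurable (U \<Otimes>\<^sub>M lborel)"
      using unit_interval_fst_kernel[of "\<lambda>(x, t). cis (c * x * t)"] by (simp add: borel_measurable_pair_lborel)
  qed auto
  also have "\<dots> = (LINT t|lborel. cosh (b * t) *\<^sub>R (u t * cnj (Astar b c h t)))"
  proof (intro Bochner_Integration.integral_cong refl)
    fix t
    have "cnj (Astar b c h t) = (LINT x|U. cis (c * x * t) * cnj (h x)) / complex_of_real (cosh (b * t))"
      unfolding Astar_def complex_cnj_divide Bochner_Integration.integral_cnj[symmetric] by (simp add: cis_cnj)
    then show "u t * (LINT x|U. cis (c * x * t) * cnj (h x)) = cosh (b * t) *\<^sub>R (u t * cnj (Astar b c h t))"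
      by (simp add: scaleR_conv_of_real)
  qed
  also have "\<dots> = L2_inner W u (Astar b c h)"
    unfolding L2_inner_def by (rule integral_cosh_measure[symmetric]) measurable
  finally show ?thesis .
qed

text \<open>\<open>Astar\<close> shows that an adjoint exists, so the choice in
  \<open>Fop_adj\<close> is a genuine one. The two versions have the same inner products with every
  element of the weighted space, in particular with their own difference.\<close>

lemma
  assumes h: "h \<in> L2 U"
  shows Fop_adj_L2: "Fop_adj b c h \<in> L2 W"
    and Fop_adj_adjoint: "u \<in> L2 W \<Longrightarrow> L2_inner U (Fop c u) h = L2_inner W u (Fop_adj b c h)"
    and Fop_adj_AE: "AE t in W. Fop_adj b c h t = Astar b c h t"
proof -
  have "\<exists>u. u \<in> L2 W \<and> (\<forall>f \<in> L2 W. L2_inner U (Fop c f) h = L2_inner W f u)"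
    using Astar_L2[OF h] Astar_adjoint[OF _ h] by blast
  from someI_ex[OF this] have *: "Fop_adj b c h \<in> L2 W"
    "\<And>f. f \<in> L2 W \<Longrightarrow> L2_inner U (Fop c f) h = L2_inner W f (Fop_adj b c h)"
    unfolding Fop_adj_def[symmetric] by auto
  then show "Fop_adj b c h \<in> L2 W"
    and "u \<in> L2 W \<Longrightarrow> L2_inner U (Fop c u) h = L2_inner W u (Fop_adj b c h)" by auto
  let ?d = "\<lambda>t. Fop_adj b c h t - Astar b c h t"
  have d: "?d \<in> L2 W" by (intro L2_diff * Astar_L2 h)
  have "L2_inner W ?d ?d = 0"
    using *(2)[OF d] Astar_adjoint[OF d h] by (simp add: L2_inner_diff_right * Astar_L2 h d)
  then have "(L2n W ?d)\<^sup>2 = 0" unfolding L2_inner_self by (simp only: of_real_eq_0_iff)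
  then have "AE t in W. ?d t = 0" using L2n_eq_0_iff[OF d] by simp
  then show "AE t in W. Fop_adj b c h t = Astar b c h t" by eventually_elim simp
qed

text \<open>Exchanging the integrals leaves the transform of 1 / cosh (b t) at c (x - y), which is
  the sech kernel.\<close>

lemma Fop_Astar:
  assumes h: "h \<in> L2 U"
  shows "Fop c (Astar b c h) x = complex_of_real (1 / c) * Qop (c / b) h x"
proof -
  have [measurable]: "h \<in> borel_measurable U" using h by (rule L2_measurable)
  have "Fop c (Astar b c h) x = (LINT t|lborel. cis (c * x * t) * Astar b c h t)"
    by (simp add: Fop_eq[OF b_pos Astar_L2[OF h]] fourier_integral_def)
  also have "\<dots> = (LINT t|lborel. (cis (c * x * t) / complex_of_real (cosh (b * t))) *
      (LINT y|U. cis (- (c * y * t)) * h y))"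
    by (simp add: Astar_def)
  also have "\<dots> = (LINT y|U. h y * (LINT t|lborel. cis (- (c * y * t)) * (cis (c * x * t) / complex_of_real (cosh (b * t)))))"
  proof (rule Fubini_kernel[where B=1, OF sigma_finite_lborel unit_interval.sigma_finite_measure_axioms])
    show "integrable lborel (\<lambda>t. cis (c * x * t) / complex_of_real (cosh (b * t)))"
      by (rule Bochner_Integration.integrable_bound[OF integrable_sech[OF b_pos]]) (auto simp: norm_divide)
    show "integrable U h" by (rule L2_unit_interval_integrable[OF h])
    show "(\<lambda>(t, y). cis (- (c * y * t))) \<in> borel_measurable (lborel \<Otimes>\<^sub>M U)"
      using unit_interval_snd_kernel[of "\<lambda>(t, y). cis (- (c * y * t))"] by (simp add: borel_measurable_pair_lborel)
  qed auto
  also have "\<dots> = (LINT y|U. complex_of_real (1 / c) * (complex_of_real (pi * (c / b) / cosh (pi * (c / b) / 2 * (x - y))) * h y))"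
  proof (intro Bochner_Integration.integral_cong refl)
    fix y
    have "cis (- (c * y * t)) * (cis (c * x * t) / complex_of_real (cosh (b * t))) =
        cis (c * (x - y) * t) / complex_of_real (cosh (b * t))" for t
      by (simp add: cis_mult algebra_simps)
    then have "(LINT t|lborel. cis (- (c * y * t)) * (cis (c * x * t) / complex_of_real (cosh (b * t)))) =
        complex_of_real (pi / b / cosh (pi * (c * (x - y)) / (2 * b)))"
      by (simp only: sech_transform[OF b_pos])
    moreover have "pi / b / cosh (pi * (c * (x - y)) / (2 * b)) = 1 / c * (pi * (c / b) / cosh (pi * (c / b) / 2 * (x - y)))"
      using b_pos c_pos by (simp add: mult_ac)
    ultimately show "h y * (LINT t|lborel. cis (- (c * y * t)) * (cis (c * x * t) / complex_of_real (cosh (b * t)))) =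
        complex_of_real (1 / c) * (complex_of_real (pi * (c / b) / cosh (pi * (c / b) / 2 * (x - y))) * h y)"
      by (simp only: of_real_mult mult_ac)
  qed
  also have "\<dots> = complex_of_real (1 / c) * Qop (c / b) h x"
    unfolding Qop_def by (rule integral_mult_right_zero)
  finally show ?thesis .
qed

lemma Qop_eq: "h \<in> L2 U \<Longrightarrow> Qop (c / b) h = (\<lambda>x. complex_of_real c * Fop c (Astar b c h) x)"
  using c_pos by (simp add: Fop_Astar fun_eq_iff)

lemma Qop_L2: "h \<in> L2 U \<Longrightarrow> Qop (c / b) h \<in> L2 U"
  by (simp add: Qop_eq L2_cmult Fop_L2 Astar_L2)

lemma Qop_inner:
  assumes "h \<in> L2 U" "k \<in> L2 U"
  shows "L2_inner U (Qop (c / b) h) k = complex_of_real c * L2_inner W (Astar b c h) (Astar b c k)"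
  by (simp add: Qop_eq assms L2_inner_cmult Astar_adjoint Astar_L2)

lemma Qop_form:
  assumes "h \<in> L2 U"
  shows "L2_inner U (Qop (c / b) h) h = complex_of_real (c * (L2n W (Astar b c h))\<^sup>2)"
  by (simp add: Qop_inner[OF assms assms] L2_inner_self)

lemma Qop_symmetric:
  assumes "h \<in> L2 U" "k \<in> L2 U"
  shows "L2_inner U (Qop (c / b) h) k = L2_inner U h (Qop (c / b) k)"
proof -
  have "L2_inner U h (Qop (c / b) k) = cnj (L2_inner U (Qop (c / b) k) h)" by (rule L2_inner_commute)
  also have "\<dots> = complex_of_real c * cnj (L2_inner W (Astar b c k) (Astar b c h))"
    by (simp add: Qop_inner assms)
  also have "cnj (L2_inner W (Astar b c k) (Astar b c h)) = L2_inner W (Astar b c h) (Astar b c k)"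
    by (rule L2_inner_commute[symmetric])
  finally show ?thesis by (simp add: Qop_inner assms)
qed

end

section \<open>The spectrum of the sech kernel operator\<close>

lemma L2n_unit_interval_bounded:
  assumes h: "h \<in> L2 unit_interval_measure" and B: "\<And>x. -1 < x \<Longrightarrow> x < 1 \<Longrightarrow> cmod (h x) \<le> B" "B \<ge> 0"
  shows "L2n unit_interval_measure h \<le> sqrt 2 * B"
proof -
  have "(L2n unit_interval_measure h)\<^sup>2 \<le> (LINT x|unit_interval_measure. B\<^sup>2)"
    unfolding L2n_sq by (intro integral_mono L2_integrable h) (auto intro: power_mono B)
  also have "\<dots> = (sqrt 2 * B)\<^sup>2" by (simp add: measure_unit_interval power_mult_distrib)
  finally show ?thesis by (rule power2_le_imp_le) (use B(2) in simp)
qed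

lemma sech_lipschitz: "\<bar>1 / cosh p - 1 / cosh (q::real)\<bar> \<le> \<bar>p - q\<bar>"
proof -
  have "norm (1 / cosh p - 1 / cosh q) \<le> 1 * norm (p - q)"
  proof (rule field_differentiable_bound[of UNIV _ "\<lambda>x. - sinh x / (cosh x)\<^sup>2"])
    show "((\<lambda>x. 1 / cosh x) has_field_derivative - sinh z / (cosh z)\<^sup>2) (at z within UNIV)" for z :: real
      by (auto intro!: derivative_eq_intros simp: power2_eq_square)
    have "\<bar>sinh z\<bar> \<le> (cosh z)\<^sup>2" for z :: real
    proof -
      have "\<bar>sinh z\<bar> \<le> cosh z" using cosh_real_abs[of z] sinh_less_cosh_real[of "\<bar>z\<bar>"] by (simp add: sinh_real_abs)
      also have "cosh z \<le> cosh z * cosh z" using cosh_real_ge_1[of z] by (simp add: mult_le_cancel_left1)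
      finally show ?thesis by (simp add: power2_eq_square)
    qed
    then show "norm (- sinh z / (cosh z)\<^sup>2) \<le> 1" for z :: real by (simp add: abs_mult)
  qed auto
  then show ?thesis by simp
qed

lemma Qop_integrable:
  assumes h: "h \<in> L2 unit_interval_measure"
  shows "integrable unit_interval_measure (\<lambda>y. complex_of_real (pi * a / cosh (pi * a / 2 * (x - y))) * h y)"
proof (rule Bochner_Integration.integrable_bound[OF integrable_mult_right[OF integrable_norm[OF L2_unit_interval_integrable[OF h]], of "pi * \<bar>a\<bar>"]])
  have "continuous_on UNIV (\<lambda>y. complex_of_real (pi * a / cosh (pi * a / 2 * (x - y))))"
    by (intro continuous_intros) auto
  then have [measurable]: "(\<lambda>y. complex_of_real (pi * a / cosh (pi * a / 2 * (x - y)))) \<in> borel_measurable unit_interval_measure"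
    by (intro measurable_unit_interval borel_measurable_continuous_onI)
  note [measurable] = L2_measurable[OF h]
  show "(\<lambda>y. complex_of_real (pi * a / cosh (pi * a / 2 * (x - y))) * h y) \<in> borel_measurable unit_interval_measure"
    by measurable
  show "AE y in unit_interval_measure. norm (complex_of_real (pi * a / cosh (pi * a / 2 * (x - y))) * h y)
      \<le> norm (pi * \<bar>a\<bar> * cmod (h y))"
  proof (rule AE_I2)
    fix y
    have "pi * \<bar>a\<bar> / cosh (pi * a / 2 * (x - y)) \<le> pi * \<bar>a\<bar> / 1"
      by (intro divide_left_mono) (auto simp: cosh_real_ge_1)
    from mult_right_mono[OF this norm_ge_zero[of "h y"]]
    show "norm (complex_of_real (pi * a / cosh (pi * a / 2 * (x - y))) * h y) \<le> norm (pi * \<bar>a\<bar> * cmod (h y))"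
      by (simp add: norm_mult norm_divide abs_mult)
  qed
qed

lemma Qop_diff:
  assumes "h \<in> L2 unit_interval_measure" "k \<in> L2 unit_interval_measure"
  shows "Qop a (\<lambda>x. h x - k x) x = Qop a h x - Qop a k x"
  unfolding Qop_def right_diff_distrib[where 'a=complex]
  by (rule Bochner_Integration.integral_diff) (rule Qop_integrable, fact)+

lemma Qop_cmult: "Qop a (\<lambda>x. r * h x) x = r * Qop a h x"
  unfolding Qop_def by (subst integral_mult_right_zero[symmetric]) (simp add: mult_ac)

text \<open>The kernel is Lipschitz in x uniformly in y. The bound depends on h only through its
  norm, which is equicontinuity of the images of the unit ball.\<close>

lemma Qop_lipschitz:
  assumes h: "h \<in> L2 unit_interval_measure" and a: "a > 0"
  shows "cmod (Qop a h x - Qop a h x') \<le> (pi * a) * (pi * a / 2) * \<bar>x - x'\<bar> * (sqrt 2 * L2n unit_interval_measure h)"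
proof -
  let ?k = "\<lambda>x y. pi * a / cosh (pi * a / 2 * (x - y))"
  have kl: "\<bar>?k x y - ?k x' y\<bar> \<le> (pi * a) * (pi * a / 2) * \<bar>x - x'\<bar>" for y
  proof -
    have "\<bar>?k x y - ?k x' y\<bar> = pi * a * \<bar>1 / cosh (pi * a / 2 * (x - y)) - 1 / cosh (pi * a / 2 * (x' - y))\<bar>"
    proof -
      have "\<bar>pi * a / C - pi * a / D\<bar> = pi * a * \<bar>1 / C - 1 / D\<bar>" for C D :: real
        using a abs_mult[of "pi * a" "1 / C - 1 / D"] by (simp add: right_diff_distrib)
      then show ?thesis .
    qed
    also have "\<dots> \<le> pi * a * \<bar>pi * a / 2 * (x - y) - pi * a / 2 * (x' - y)\<bar>"
      using a by (intro mult_left_mono sech_lipschitz) simp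
    also have "pi * a / 2 * (x - y) - pi * a / 2 * (x' - y) = pi * a / 2 * (x - x')"
      unfolding right_diff_distrib by simp
    also have "\<bar>pi * a / 2 * (x - x')\<bar> = pi * a / 2 * \<bar>x - x'\<bar>" using a by (simp add: abs_mult)
    finally show ?thesis by (simp only: mult.assoc)
  qed
  have "Qop a h x - Qop a h x' = (LINT y|unit_interval_measure. complex_of_real (?k x y) * h y - complex_of_real (?k x' y) * h y)"
    unfolding Qop_def by (rule Bochner_Integration.integral_diff[symmetric]) (rule Qop_integrable[OF h])+
  then have "cmod (Qop a h x - Qop a h x') \<le>
      (LINT y|unit_interval_measure. cmod (complex_of_real (?k x y) * h y - complex_of_real (?k x' y) * h y))"
    by (simp only: integral_norm_bound)
  also have "\<dots> \<le> (LINT y|unit_interval_measure. (pi * a) * (pi * a / 2) * \<bar>x - x'\<bar> * cmod (h y))"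
  proof (rule integral_mono)
    show "cmod (complex_of_real (?k x y) * h y - complex_of_real (?k x' y) * h y) \<le> (pi * a) * (pi * a / 2) * \<bar>x - x'\<bar> * cmod (h y)" for y
    proof -
      have "cmod (complex_of_real (?k x y) * h y - complex_of_real (?k x' y) * h y) = \<bar>?k x y - ?k x' y\<bar> * cmod (h y)"
        by (simp only: left_diff_distrib[symmetric] of_real_diff[symmetric] norm_mult norm_of_real)
      then show ?thesis by (simp only:) (rule mult_right_mono[OF kl norm_ge_zero])
    qed
  qed (intro integrable_norm Bochner_Integration.integrable_diff Qop_integrable h integrable_mult_right
      L2_unit_interval_integrable)+
  also have "\<dots> = (pi * a) * (pi * a / 2) * \<bar>x - x'\<bar> * (LINT y|unit_interval_measure. cmod (h y))"
    by (rule integral_mult_right_zero)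
  also have "\<dots> \<le> (pi * a) * (pi * a / 2) * \<bar>x - x'\<bar> * (sqrt 2 * L2n unit_interval_measure h)"
    using a by (intro mult_left_mono L1_le_L2_unit_interval h) simp
  finally show ?thesis .
qed

lemma Qop_bound:
  assumes h: "h \<in> L2 unit_interval_measure" and a: "a > 0"
  shows "cmod (Qop a h x) \<le> pi * a * (sqrt 2 * L2n unit_interval_measure h)"
proof -
  have "cmod (Qop a h x) \<le> (LINT y|unit_interval_measure. cmod (complex_of_real (pi * a / cosh (pi * a / 2 * (x - y))) * h y))"
    unfolding Qop_def by (rule integral_norm_bound)
  also have "\<dots> \<le> (LINT y|unit_interval_measure. pi * a * cmod (h y))"
  proof (rule integral_mono)
    fix y
    have "pi * a / cosh (pi * a / 2 * (x - y)) \<le> pi * a / 1"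
      by (intro divide_left_mono cosh_real_ge_1) (use a in auto)
    from mult_right_mono[OF this norm_ge_zero[of "h y"]]
    show "cmod (complex_of_real (pi * a / cosh (pi * a / 2 * (x - y))) * h y) \<le> pi * a * cmod (h y)"
      using a by (simp add: norm_mult norm_divide abs_mult)
  qed (intro integrable_norm Qop_integrable h integrable_mult_right L2_unit_interval_integrable)+
  also have "\<dots> = pi * a * (LINT y|unit_interval_measure. cmod (h y))" by (rule integral_mult_right_zero)
  also have "\<dots> \<le> pi * a * (sqrt 2 * L2n unit_interval_measure h)"
    using a by (intro mult_left_mono L1_le_L2_unit_interval h) simp
  finally show ?thesis .
qed

text \<open>The images of the unit ball are uniformly bounded and equicontinuous, so Arzela-Ascoli
  yields a uniformly convergent subsequence; on an interval of finite length this is convergence in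
  L2.\<close>

lemma Qop_compact:
  assumes v: "\<And>n. v n \<in> L2 unit_interval_measure" "\<And>n. L2n unit_interval_measure (v n) \<le> 1"
    and a: "a > 0" and Q: "\<And>n. Qop a (v n) \<in> L2 unit_interval_measure"
  obtains w and k :: "nat \<Rightarrow> nat" where "strict_mono k" "w \<in> L2 unit_interval_measure"
    "(\<lambda>n. L2n unit_interval_measure (\<lambda>x. Qop a (v (k n)) x - w x)) \<longlonglongrightarrow> 0"
proof -
  define L where "L = (pi * a) * (pi * a / 2) * sqrt 2"
  have L: "L > 0" using a by (simp add: L_def)
  have lip: "cmod (Qop a (v n) x - Qop a (v n) x') \<le> L * \<bar>x - x'\<bar>" for n x x'
  proof -
    have "cmod (Qop a (v n) x - Qop a (v n) x') \<le>
        (pi * a) * (pi * a / 2) * \<bar>x - x'\<bar> * (sqrt 2 * L2n unit_interval_measure (v n))"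
      by (rule Qop_lipschitz[OF v(1) a])
    also have "\<dots> \<le> (pi * a) * (pi * a / 2) * \<bar>x - x'\<bar> * (sqrt 2 * 1)"
      using a v(2) by (intro mult_left_mono) auto
    finally show ?thesis by (simp add: L_def mult_ac)
  qed
  obtain g and k :: "nat \<Rightarrow> nat" where k: "strict_mono k"
    and conv: "\<And>e. 0 < e \<Longrightarrow> \<exists>N. \<forall>n x. n \<ge> N \<and> x \<in> {-1..1} \<longrightarrow> norm (Qop a (v (k n)) x - g x) < e"
  proof (rule Arzela_Ascoli[of "{-1..1::real}" "\<lambda>n. Qop a (v n)" "pi * a * (sqrt 2 * 1)"])
    show "norm (Qop a (v n) x) \<le> pi * a * (sqrt 2 * 1)" for n x
      by (rule order_trans[OF Qop_bound[OF v(1) a]]) (use a v(2) in \<open>intro mult_left_mono; auto\<close>)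
    show "\<exists>d. 0 < d \<and> (\<forall>n y. y \<in> {-1..1} \<and> norm (x - y) < d \<longrightarrow> norm (Qop a (v n) x - Qop a (v n) y) < e)"
      if "0 < e" for x e :: real
    proof (intro exI[of _ "e / L"] conjI allI impI)
      fix n y assume "y \<in> {-1..1} \<and> norm (x - y) < e / L"
      then have "L * \<bar>x - y\<bar> < e" using L by (simp add: field_simps)
      then show "norm (Qop a (v n) x - Qop a (v n) y) < e" using lip[of n x y] by linarith
    qed (use that L in simp)
  qed auto
  let ?F = "\<lambda>n. Qop a (v (k n))"
  have "\<exists>N. \<forall>m\<ge>N. \<forall>n\<ge>N. L2n unit_interval_measure (\<lambda>x. ?F m x - ?F n x) < e" if e: "e > 0" for e
  proof -
    \<comment> \<open>Two functions within e' of the same limit differ by at most 2 e', hence by e /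
      2 in norm on an interval of length 2.\<close>
    define e' where "e' = e / (4 * sqrt 2)"
    have e': "e' > 0" using e by (simp add: e'_def)
    obtain N where N: "\<And>n x. n \<ge> N \<Longrightarrow> x \<in> {-1..1} \<Longrightarrow> norm (?F n x - g x) < e'"
      using conv[OF e'] by blast
    show ?thesis
    proof (intro exI[of _ N] allI impI)
      fix m n assume mn: "m \<ge> N" "n \<ge> N"
      have "L2n unit_interval_measure (\<lambda>x. ?F m x - ?F n x) \<le> sqrt 2 * (2 * e')"
      proof (rule L2n_unit_interval_bounded)
        show "(\<lambda>x. ?F m x - ?F n x) \<in> L2 unit_interval_measure" by (intro L2_diff Q)
        fix x :: real assume "-1 < x" "x < 1"
        then have "norm (?F m x - g x) < e'" "norm (?F n x - g x) < e'" using N mn by auto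
        then show "cmod (?F m x - ?F n x) \<le> 2 * e'"
          using norm_triangle_ineq4[of "?F m x - g x" "?F n x - g x"] by simp
      qed (use e' in simp)
      also have "\<dots> < e" using e by (simp add: e'_def)
      finally show "L2n unit_interval_measure (\<lambda>x. ?F m x - ?F n x) < e" .
    qed
  qed
  from L2_complete[of ?F unit_interval_measure, OF Q this]
  obtain w where "w \<in> L2 unit_interval_measure" "(\<lambda>n. L2n unit_interval_measure (\<lambda>x. ?F n x - w x)) \<longlonglongrightarrow> 0"
    by (rule bexE)
  then show ?thesis by (rule that[OF k])
qed

section \<open>Rayleigh quotients of the operator\<close>

locale qop_eigensystem = cosh_weight +
  fixes \<rho> :: "nat \<Rightarrow> real" and g :: "nat \<Rightarrow> real \<Rightarrow> real"
  assumes eigen: "eigensystem (c / b) \<rho> g"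
begin

abbreviation "G \<equiv> \<lambda>m x. complex_of_real (g m x)"
abbreviation "Q \<equiv> Qop (c / b)"

lemma ratio_pos: "c / b > 0" using b_pos c_pos by simp

lemma rho_pos: "\<rho> m > 0"
  and rho_dec: "decseq \<rho>"
  and G_L2: "G m \<in> L2 U"
  and G_eigen: "AE x in U. Q (G m) x = complex_of_real (\<rho> m * g m x)"
  using eigen unfolding eigensystem_def by auto

lemma G_orthonormal: "L2_orthonormal U G"
  using eigen unfolding eigensystem_def L2_orthonormal_def by auto

lemma eigenfunction_expansion:
  assumes "r > 0" "h \<in> L2 U" "AE x in U. Q h x = complex_of_real r * h x"
  obtains A k where "finite A" "A \<subseteq> {m. \<rho> m = r}" "AE x in U. h x = (\<Sum>m\<in>A. k m * G m x)"
  using eigen assms unfolding eigensystem_def by blast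

lemma Q_inner_G:
  assumes v: "v \<in> L2 U"
  shows "L2_inner U (Q v) (G m) = \<rho> m * L2_inner U v (G m)"
proof -
  have "L2_inner U (Q v) (G m) = L2_inner U v (Q (G m))" by (rule Qop_symmetric[OF v G_L2])
  also have "\<dots> = L2_inner U v (\<lambda>x. complex_of_real (\<rho> m) * G m x)"
  proof (rule L2_inner_cong_AE)
    show "AE x in U. Q (G m) x = complex_of_real (\<rho> m) * G m x" using G_eigen[of m] by simp
  qed (intro L2_measurable v Qop_L2 G_L2 L2_cmult AE_I2 refl)+
  also have "\<dots> = \<rho> m * L2_inner U v (G m)" by (simp add: L2_inner_cmult_right)
  finally show ?thesis .
qed

text \<open>The value of <Q v, v>, written as a squared norm so that it is visibly real and
  nonnegative, and so that Cauchy-Schwarz can be applied to \<open>Astar\<close>.\<close>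

definition form :: "(real \<Rightarrow> complex) \<Rightarrow> real" where
  "form v = c * (L2n W (Astar b c v))\<^sup>2"

lemma form_nonneg: "form v \<ge> 0"
  using c_pos by (simp add: form_def)

lemma Q_form: "v \<in> L2 U \<Longrightarrow> L2_inner U (Q v) v = complex_of_real (form v)"
  by (simp add: Qop_form form_def)

lemma form_cmult:
  assumes "v \<in> L2 U"
  shows "form (\<lambda>x. k * v x) = (cmod k)\<^sup>2 * form v"
proof -
  have "Astar b c (\<lambda>x. k * v x) = (\<lambda>t. k * Astar b c v t)"
  proof
    fix t
    have "(LINT x|U. cis (- (c * x * t)) * (k * v x)) = k * (LINT x|U. cis (- (c * x * t)) * v x)"
      by (subst integral_mult_right_zero[symmetric]) (simp add: mult_ac)
    then show "Astar b c (\<lambda>x. k * v x) t = k * Astar b c v t" by (simp add: Astar_def)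
  qed
  then show ?thesis by (simp add: form_def L2n_cmult power_mult_distrib)
qed

lemma Q_norm_bound:
  assumes v: "v \<in> L2 U"
  shows "L2n U (Q v) \<le> 2 * pi * (c / b) * L2n U v"
proof -
  have "L2n U (Q v) \<le> sqrt 2 * (pi * (c / b) * (sqrt 2 * L2n U v))"
    using ratio_pos
    by (intro L2n_unit_interval_bounded Qop_L2 v Qop_bound mult_nonneg_nonneg) auto
  also have "\<dots> = 2 * pi * (c / b) * L2n U v"
  proof -
    have "sqrt 2 * (p * (sqrt 2 * x)) = 2 * p * x" for p x :: real by simp
    from this[of "pi * (c / b)"] show ?thesis by (simp only: mult.assoc)
  qed
  finally show ?thesis .
qed

lemma form_bound:
  assumes v: "v \<in> L2 U"
  shows "form v \<le> 2 * pi * (c / b) * (L2n U v)\<^sup>2"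
proof -
  have "form v = cmod (L2_inner U (Q v) v)" using form_nonneg[of v] by (simp add: Q_form[OF v])
  also have "\<dots> \<le> L2n U (Q v) * L2n U v" by (rule L2_inner_bound[OF Qop_L2[OF v] v])
  also have "\<dots> \<le> 2 * pi * (c / b) * L2n U v * L2n U v"
    by (intro mult_right_mono Q_norm_bound v) simp
  finally show ?thesis by (simp add: power2_eq_square mult_ac)
qed

text \<open>If the supremum \<open>l\<close> of the form on the orthogonal complement of the \<open>G m\<close>, \<open>m \<in> S\<close>,
  exceeded \<open>\<mu>\<close>, then by compactness it would be attained at an eigenfunction, which the
  completeness of the eigensystem puts into the span of the \<open>G m\<close>.\<close>

lemma rayleigh_bound:
  assumes mu: "\<mu> \<ge> 0" "\<And>m. m \<notin> S \<Longrightarrow> \<rho> m \<le> \<mu>"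
    and v: "v \<in> L2 U" "\<And>m. m \<in> S \<Longrightarrow> L2_inner U v (G m) = 0"
  shows "form v \<le> \<mu> * (L2n U v)\<^sup>2"
proof (rule ccontr)
  assume contra: "\<not> form v \<le> \<mu> * (L2n U v)\<^sup>2"
  define V where "V = {v \<in> L2 U. \<forall>m\<in>S. L2_inner U v (G m) = 0}"
  have VI: "v \<in> L2 U" if "v \<in> V" for v using that by (simp add: V_def)
  have Vcm: "(\<lambda>x. k * u x) \<in> V" if "u \<in> V" for k u
    using that by (simp add: V_def L2_cmult L2_inner_cmult)
  define X where "X = {form u | u. u \<in> V \<and> L2n U u \<le> 1}"
  define l where "l = Sup X"
  have Xb: "bdd_above X"
  proof (rule bdd_aboveI)
    fix y assume "y \<in> X"
    then obtain u where u: "u \<in> V" "L2n U u \<le> 1" "y = form u" by (auto simp: X_def)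
    have "y \<le> 2 * pi * (c / b) * (L2n U u)\<^sup>2" using form_bound[OF VI[OF u(1)]] u by simp
    also have "\<dots> \<le> 2 * pi * (c / b) * 1\<^sup>2"
      using u b_pos c_pos by (intro mult_left_mono power_mono) auto
    finally show "y \<le> 2 * pi * (c / b) * 1\<^sup>2" .
  qed
  have le1: "form u \<le> l" if "u \<in> V" "L2n U u \<le> 1" for u
    unfolding l_def using that by (intro cSup_upper Xb) (auto simp: X_def)
  have le: "form u \<le> l * (L2n U u)\<^sup>2" if u: "u \<in> V" for u
  proof (cases "L2n U u = 0")
    case True
    then show ?thesis using form_bound[OF VI[OF u]] by simp
  next
    case False
    let ?k = "complex_of_real (1 / L2n U u)"
    have "L2n U (\<lambda>x. ?k * u x) = 1" using False unfolding L2n_cmult by (simp add: norm_divide)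
    then have "form (\<lambda>x. ?k * u x) \<le> l" by (intro le1 Vcm u) simp
    then have "form u / (L2n U u)\<^sup>2 \<le> l"
      unfolding form_cmult[OF VI[OF u]] by (simp add: power_divide norm_divide)
    then show ?thesis using False by (simp add: pos_divide_le_eq)
  qed
  have vV: "v \<in> V" using v by (simp add: V_def)
  have "\<mu> * (L2n U v)\<^sup>2 < l * (L2n U v)\<^sup>2" using contra le[OF vV] by linarith
  then have lmu: "l > \<mu>" by (metis mult_le_cancel_right_pos not_less zero_le_power2 mult_right_mono)
  then have l: "l > 0" using mu by simp
  have "\<exists>u. u \<in> V \<and> L2n U u \<le> 1 \<and> form u > l - 1 / real (Suc n)" for n
  proof -
    have "X \<noteq> {}" using L2_zero[of U] by (auto simp: X_def V_def L2_inner_def L2n_def intro!: exI[of _ "\<lambda>x. 0"])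
    then have "\<exists>y\<in>X. l - 1 / real (Suc n) < y" unfolding l_def by (intro less_cSupD) auto
    then show ?thesis by (auto simp: X_def)
  qed
  then obtain u where u: "\<And>n. u n \<in> V" "\<And>n. L2n U (u n) \<le> 1" "\<And>n. form (u n) > l - 1 / real (Suc n)"
    by metis
  have uL: "u n \<in> L2 U" for n by (rule VI[OF u(1)])
  have QL: "Q (u n) \<in> L2 U" for n by (rule Qop_L2[OF uL])
  \<comment> \<open>The squared norm of Q u is c times the inner product of \<open>Astar\<close> at
    u and at Q u. Cauchy-Schwarz for these, and the bound l for the form at Q u, which lies in V
    again, give the claim after cancelling the squared norm of Q u.\<close>
  have Qsq: "(L2n U (Q (u n)))\<^sup>2 \<le> l * form (u n)" for n
  proof -
    let ?w = "Q (u n)"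
    have wV: "?w \<in> V" using u(1)[of n] QL by (simp add: V_def Q_inner_G)
    have "(L2n U ?w)\<^sup>2 = cmod (L2_inner U ?w ?w)" by (simp add: L2_inner_self norm_power)
    also have "\<dots> = c * cmod (L2_inner W (Astar b c (u n)) (Astar b c ?w))"
      using c_pos by (simp add: Qop_inner uL QL norm_mult)
    also have "\<dots> \<le> c * (L2n W (Astar b c (u n)) * L2n W (Astar b c ?w))"
      using c_pos by (intro mult_left_mono L2_inner_bound Astar_L2 uL QL) simp
    finally have "((L2n U ?w)\<^sup>2)\<^sup>2 \<le> (c * (L2n W (Astar b c (u n)) * L2n W (Astar b c ?w)))\<^sup>2"
      by (intro power_mono) auto
    also have "\<dots> = form (u n) * form ?w" by (simp add: form_def power_mult_distrib power2_eq_square mult_ac)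
    also have "\<dots> \<le> form (u n) * (l * (L2n U ?w)\<^sup>2)"
      by (intro mult_left_mono le wV form_nonneg)
    finally have "(L2n U ?w)\<^sup>2 * (L2n U ?w)\<^sup>2 \<le> (l * form (u n)) * (L2n U ?w)\<^sup>2"
      by (simp add: power2_eq_square mult_ac)
    then show ?thesis
    proof (cases "L2n U ?w = 0")
      case True
      then show ?thesis using l form_nonneg[of "u n"] by simp
    next
      case False
      then have "(L2n U ?w)\<^sup>2 > 0" by simp
      then show ?thesis using \<open>(L2n U ?w)\<^sup>2 * (L2n U ?w)\<^sup>2 \<le> (l * form (u n)) * (L2n U ?w)\<^sup>2\<close>
        by (rule mult_right_le_imp_le[rotated])
    qed
  qed
  \<comment> \<open>Near maximisers of the form are near eigenvectors: expanding the square with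
    \<open>Qsq\<close> and norm at most 1 leaves l (l - form u).\<close>
  have near: "(L2n U (\<lambda>x. Q (u n) x - complex_of_real l * u n x))\<^sup>2 \<le> l * (1 / real (Suc n))" for n
  proof -
    have "(L2n U (\<lambda>x. Q (u n) x - complex_of_real l * u n x))\<^sup>2 =
        (L2n U (Q (u n)))\<^sup>2 + (l * L2n U (u n))\<^sup>2 - 2 * (l * form (u n))"
      using l by (simp add: L2n_diff_sq[OF QL L2_cmult[OF uL]] L2n_cmult L2_inner_cmult_right Q_form[OF uL])
    also have "(l * L2n U (u n))\<^sup>2 \<le> (l * 1)\<^sup>2" using l u(2)[of n] by (intro power_mono mult_left_mono) auto
    finally have "(L2n U (\<lambda>x. Q (u n) x - complex_of_real l * u n x))\<^sup>2 \<le> l * (l - form (u n))"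
      using Qsq[of n] by (simp add: power2_eq_square algebra_simps)
    also have "\<dots> \<le> l * (1 / real (Suc n))" using u(3)[of n] l by (intro mult_left_mono) auto
    finally show ?thesis .
  qed
  obtain w and k :: "nat \<Rightarrow> nat" where k: "strict_mono k" and w: "w \<in> L2 U"
    and wl: "(\<lambda>n. L2n U (\<lambda>x. Q (u (k n)) x - w x)) \<longlonglongrightarrow> 0"
    by (rule Qop_compact[OF uL u(2) ratio_pos QL])
  define z where "z n = u (k n)" for n
  have zL: "z n \<in> L2 U" for n by (simp add: z_def uL)
  have lzL: "(\<lambda>x. complex_of_real l * z n x) \<in> L2 U" for n by (rule L2_cmult[OF zL])
  have QzL: "Q (z n) \<in> L2 U" for n by (rule Qop_L2[OF zL])
  have wl': "(\<lambda>n. L2n U (\<lambda>x. Q (z n) x - w x)) \<longlonglongrightarrow> 0" using wl by (simp add: z_def)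
  have nl: "(\<lambda>n. L2n U (\<lambda>x. Q (z n) x - complex_of_real l * z n x)) \<longlonglongrightarrow> 0"
  proof -
    have "(\<lambda>n. sqrt (l * (1 / real (Suc n)))) \<longlonglongrightarrow> sqrt (l * 0)"
      by (intro tendsto_real_sqrt tendsto_mult tendsto_const LIMSEQ_Suc[OF lim_1_over_n])
    then have s0: "(\<lambda>n. sqrt (l * (1 / real (Suc n)))) \<longlonglongrightarrow> 0" by (simp only: mult_zero_right real_sqrt_zero)
    have "(\<lambda>n. L2n U (\<lambda>x. Q (u n) x - complex_of_real l * u n x)) \<longlonglongrightarrow> 0"
    proof (rule Lim_null_comparison[OF always_eventually s0], rule allI)
      fix n
      show "norm (L2n U (\<lambda>x. Q (u n) x - complex_of_real l * u n x)) \<le> sqrt (l * (1 / real (Suc n)))"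
        unfolding real_norm_def abs_of_nonneg[OF L2n_nonneg] by (rule real_le_rsqrt[OF near])
    qed
    from LIMSEQ_subseq_LIMSEQ[OF this k] show ?thesis by (simp add: z_def o_def)
  qed
  \<comment> \<open>Compactness gives a limit of Q z only. Since Q z - l z is a null sequence, l z
    has the same limit w, and continuity of Q then makes w an eigenvector for l.\<close>
  have lzw: "(\<lambda>n. L2n U (\<lambda>x. complex_of_real l * z n x - w x)) \<longlonglongrightarrow> 0"
  proof (rule Lim_null_comparison[OF always_eventually], rule allI)
    show "norm (L2n U (\<lambda>x. complex_of_real l * z n x - w x)) \<le>
        L2n U (\<lambda>x. Q (z n) x - complex_of_real l * z n x) + L2n U (\<lambda>x. Q (z n) x - w x)" for n
      using L2n_triangle_via[OF lzL w QzL, of n n]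
        L2n_minus_commute[of U "Q (z n)" "\<lambda>x. complex_of_real l * z n x"] by simp
    show "(\<lambda>n. L2n U (\<lambda>x. Q (z n) x - complex_of_real l * z n x) + L2n U (\<lambda>x. Q (z n) x - w x)) \<longlonglongrightarrow> 0"
      using tendsto_add[OF nl wl'] by simp
  qed
  have Qlz: "Q (\<lambda>x. complex_of_real l * z n x) = (\<lambda>x. complex_of_real l * Q (z n) x)" for n
    by (rule ext) (rule Qop_cmult)
  have eig: "AE x in U. Q w x = complex_of_real l * w x"
  proof (rule L2_limit_unique)
    show "(\<lambda>x. complex_of_real l * Q (z n) x) \<in> L2 U" for n by (rule L2_cmult[OF QzL])
    show "Q w \<in> L2 U" by (rule Qop_L2[OF w])
    show "(\<lambda>x. complex_of_real l * w x) \<in> L2 U" by (rule L2_cmult[OF w])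
    show "(\<lambda>n. L2n U (\<lambda>x. complex_of_real l * Q (z n) x - Q w x)) \<longlonglongrightarrow> 0"
    proof (rule Lim_null_comparison[OF always_eventually], rule allI)
      fix n
      have "(\<lambda>x. complex_of_real l * Q (z n) x - Q w x) = Q (\<lambda>x. complex_of_real l * z n x - w x)"
        by (rule ext) (simp add: Qop_diff[OF lzL w] Qlz)
      then show "norm (L2n U (\<lambda>x. complex_of_real l * Q (z n) x - Q w x)) \<le>
          2 * pi * (c / b) * L2n U (\<lambda>x. complex_of_real l * z n x - w x)"
        using Q_norm_bound[OF L2_diff[OF lzL w]] by simp
    next
      show "(\<lambda>n. 2 * pi * (c / b) * L2n U (\<lambda>x. complex_of_real l * z n x - w x)) \<longlonglongrightarrow> 0"
        using tendsto_mult[OF tendsto_const[of "2 * pi * (c / b)"] lzw] by simp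
    qed
    have "L2n U (\<lambda>x. complex_of_real l * Q (z n) x - complex_of_real l * w x) = l * L2n U (\<lambda>x. Q (z n) x - w x)" for n
      using L2n_cmult[of U "complex_of_real l" "\<lambda>x. Q (z n) x - w x"] l by (simp add: right_diff_distrib)
    then show "(\<lambda>n. L2n U (\<lambda>x. complex_of_real l * Q (z n) x - complex_of_real l * w x)) \<longlonglongrightarrow> 0"
      using tendsto_mult[OF tendsto_const[of l] wl'] by simp
  qed
  have wG: "L2_inner U w (G m) = 0" if "m \<in> S" for m
  proof (rule LIMSEQ_unique)
    show "(\<lambda>n. L2_inner U (\<lambda>x. complex_of_real l * z n x) (G m)) \<longlonglongrightarrow> L2_inner U w (G m)"
      by (rule L2_inner_tendsto[OF lzL w G_L2 G_L2 lzw]) (simp add: L2n_def)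
    have "L2_inner U (\<lambda>x. complex_of_real l * z n x) (G m) = 0" for n
      using u(1)[of "k n"] that by (simp add: L2_inner_cmult z_def V_def)
    then show "(\<lambda>n. L2_inner U (\<lambda>x. complex_of_real l * z n x) (G m)) \<longlonglongrightarrow> 0" by simp
  qed
  obtain A kk where A: "finite A" "A \<subseteq> {m. \<rho> m = l}" and wA: "AE x in U. w x = (\<Sum>m\<in>A. kk m * G m x)"
    using eigenfunction_expansion[OF l w eig] .
  \<comment> \<open>All indices outside S have \<rho> at most \<mu>, which is smaller than
    l.\<close>
  have AS: "A \<subseteq> S" using A(2) mu(2) lmu by force
  have sL: "(\<lambda>x. \<Sum>m\<in>A. kk m * G m x) \<in> L2 U" by (rule L2_orthonormal_sum_L2[OF G_orthonormal])
  have "L2_inner U w w = L2_inner U w (\<lambda>x. \<Sum>m\<in>A. kk m * G m x)"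
    by (rule L2_inner_cong_AE[OF _ wA]) (intro L2_measurable w sL AE_I2 refl)+
  also have "\<dots> = (\<Sum>m\<in>A. cnj (kk m) * L2_inner U w (G m))"
    by (subst L2_inner_sum_right) (auto intro: L2_cmult G_L2 w simp: L2_inner_cmult_right)
  also have "\<dots> = 0" using AS wG by (intro sum.neutral) auto
  finally have ww: "L2_inner U w w = 0" .
  have "(\<lambda>n. L2_inner U (Q (z n)) (\<lambda>x. complex_of_real l * z n x)) \<longlonglongrightarrow> L2_inner U w w"
    by (rule L2_inner_tendsto[OF QzL w lzL w wl' lzw])
  moreover have "L2_inner U (Q (z n)) (\<lambda>x. complex_of_real l * z n x) = complex_of_real (l * form (z n))" for n
    by (simp add: L2_inner_cmult_right Q_form[OF zL])
  ultimately have "(\<lambda>n. complex_of_real (l * form (z n))) \<longlonglongrightarrow> complex_of_real 0" using ww by simp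
  then have lim0: "(\<lambda>n. l * form (z n)) \<longlonglongrightarrow> 0" by (simp only: tendsto_of_real_iff)
  have "(\<lambda>n. l * (l - 1 / real (Suc n))) \<longlonglongrightarrow> l * (l - 0)"
    by (intro tendsto_intros LIMSEQ_Suc[OF lim_1_over_n])
  moreover have "l * (l - 1 / real (Suc n)) \<le> l * form (z n)" for n
  proof -
    have "n \<le> k n" using k by (simp add: strict_mono_imp_increasing)
    then have "1 / real (Suc (k n)) \<le> 1 / real (Suc n)" by (intro divide_left_mono) auto
    then show ?thesis using u(3)[of "k n"] l by (intro mult_left_mono) (auto simp: z_def)
  qed
  \<comment> \<open>The same sequence l * form z tends to the squared norm of w, which is 0, and
    stays above a sequence tending to l^2.\<close>
  ultimately have "l * (l - 0) \<le> 0"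
    by (intro LIMSEQ_le[OF _ lim0]) auto
  then show False using l by (simp add: mult_le_0_iff)
qed

end

section \<open>Injectivity of the truncated Fourier transform\<close>

lemma fourier_integral_continuous:
  assumes f: "integrable lborel f"
  shows "continuous_on UNIV (fourier_integral f)"
  unfolding continuous_on_sequentially
proof (intro allI ballI impI, elim conjE)
  fix X :: "nat \<Rightarrow> real" and a assume X: "X \<longlonglongrightarrow> a"
  note [measurable] = borel_measurable_integrable[OF f]
  have "(\<lambda>n. LINT t|lborel. cis (X n * t) * f t) \<longlonglongrightarrow> (LINT t|lborel. cis (a * t) * f t)"
  proof (rule integral_dominated_convergence)
    show "integrable lborel (\<lambda>t. cmod (f t))" using f by simp
    show "AE t in lborel. (\<lambda>n. cis (X n * t) * f t) \<longlonglongrightarrow> cis (a * t) * f t"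
    proof (intro AE_I2 tendsto_mult tendsto_const)
      fix t
      have l: "(\<lambda>n. X n * t) \<longlonglongrightarrow> a * t" by (rule tendsto_mult[OF X tendsto_const])
      show "(\<lambda>n. cis (X n * t)) \<longlonglongrightarrow> cis (a * t)"
        using continuous_on_tendsto_compose[OF continuous_on_cis[OF continuous_on_id[of UNIV]] l] by simp
    qed
  qed (auto simp: norm_mult)
  then show "(fourier_integral f \<circ> X) \<longlonglongrightarrow> fourier_integral f a"
    by (simp add: fourier_integral_def o_def)
qed

text \<open>A single term of the exponential series is at most its sum.\<close>

lemma power_le_fact_exp:
  assumes "r > 0"
  shows "\<bar>t::real\<bar> ^ n \<le> fact n / r ^ n * exp (r * \<bar>t\<bar>)"
proof -
  let ?x = "r * \<bar>t\<bar>"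
  have "(\<lambda>k. ?x ^ k /\<^sub>R fact k) sums exp ?x" by (rule exp_converges)
  moreover have "(\<Sum>k\<in>{n}. ?x ^ k /\<^sub>R fact k) \<le> (\<Sum>k. ?x ^ k /\<^sub>R fact k)"
    using assms by (intro sum_le_suminf sums_summable[OF exp_converges]) auto
  ultimately have "?x ^ n / fact n \<le> exp ?x"
    by (simp add: sums_iff divide_inverse mult.commute)
  then have "r ^ n * \<bar>t\<bar> ^ n \<le> fact n * exp ?x"
    by (simp add: power_mult_distrib pos_divide_le_eq mult.commute)
  then show ?thesis using assms by (simp add: pos_le_divide_eq mult.commute)
qed

lemma cmod_cis_diff: "cmod (cis p - cis q) = 2 * \<bar>sin ((p - q) / 2)\<bar>"
proof -
  have "cis p - cis q = cis q * (cis (p - q) - 1)" by (simp add: cis_mult right_diff_distrib)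
  then have "cmod (cis p - cis q) = cmod (cis (p - q) - 1)" by (simp add: norm_mult)
  also have "\<dots> = 2 * \<bar>sin ((p - q) / 2)\<bar>"
  proof (rule power2_eq_imp_eq)
    have "(cmod (cis (p - q) - 1))\<^sup>2 = (cos (p - q) - 1)\<^sup>2 + (sin (p - q))\<^sup>2" by (simp add: cmod_power2)
    also have "\<dots> = 2 - 2 * cos (p - q)" by (simp add: power2_diff sin_squared_eq algebra_simps)
    also have "\<dots> = (2 * \<bar>sin ((p - q) / 2)\<bar>)\<^sup>2"
    proof -
      have e: "2 * ((p - q) / 2) = p - q" by simp
      show ?thesis using cos_double_sin[of "(p - q) / 2", unfolded e] by (simp add: power_mult_distrib)
    qed
    finally show "(cmod (cis (p - q) - 1))\<^sup>2 = (2 * \<bar>sin ((p - q) / 2)\<bar>)\<^sup>2" .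
  qed auto
  finally show ?thesis .
qed

lemma cmod_cis_minus_one: "cmod (cis s - 1) \<le> \<bar>s\<bar>"
  using cmod_cis_diff[of s 0] abs_sin_x_le_abs_x[of "s / 2"] by simp

text \<open>The moment condition under which the Taylor series of the transform represents it within
  distance r of every real point.\<close>

locale exp_integrable =
  fixes u :: "real \<Rightarrow> complex" and r :: real
  assumes r_pos: "r > 0" and u_meas [measurable]: "u \<in> borel_measurable borel"
    and exp_int: "integrable lborel (\<lambda>t. exp (r * \<bar>t\<bar>) * cmod (u t))"
begin

text \<open>The n-th derivative of the transform at x, up to a power of i.\<close>

definition moment :: "nat \<Rightarrow> real \<Rightarrow> complex" where
  "moment n x = (LINT t|lborel. complex_of_real t ^ n * (cis (x * t) * u t))"

lemma moment_abs_integrable: "integrable lborel (\<lambda>t. \<bar>t\<bar> ^ n * cmod (u t))"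
proof (rule Bochner_Integration.integrable_bound[OF integrable_mult_right[OF exp_int, of "fact n / r ^ n"]])
  show "AE t in lborel. norm (\<bar>t\<bar> ^ n * cmod (u t)) \<le> norm (fact n / r ^ n * (exp (r * \<bar>t\<bar>) * cmod (u t)))"
  proof (rule AE_I2)
    fix t
    have "\<bar>t\<bar> ^ n * cmod (u t) \<le> fact n / r ^ n * exp (r * \<bar>t\<bar>) * cmod (u t)"
      by (intro mult_right_mono power_le_fact_exp r_pos) simp
    then show "norm (\<bar>t\<bar> ^ n * cmod (u t)) \<le> norm (fact n / r ^ n * (exp (r * \<bar>t\<bar>) * cmod (u t)))"
      using r_pos by (simp add: abs_mult mult.assoc)
  qed
qed measurable

lemma moment_integrable: "integrable lborel (\<lambda>t. complex_of_real t ^ n * (cis (x * t) * u t))"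
  by (rule Bochner_Integration.integrable_bound[OF moment_abs_integrable[of n]])
     (auto simp: norm_mult norm_power)

text \<open>The difference quotients of one moment converge to i times the next, dominated by the
  absolute moment of order n + 1. On an open interval of zeros they are eventually 0.\<close>

lemma moment_zero_Suc:
  assumes z: "\<And>x. \<alpha> < x \<Longrightarrow> x < \<beta> \<Longrightarrow> moment n x = 0" and x: "\<alpha> < x" "x < \<beta>"
  shows "moment (Suc n) x = 0"
proof -
  define h where "h k = inverse (real (Suc k))" for k
  have h0: "h k > 0" for k by (simp add: h_def)
  have hl: "h \<longlonglongrightarrow> 0" unfolding h_def by (rule LIMSEQ_inverse_real_of_nat)
  let ?F = "\<lambda>k t. (cis (h k * t) - 1) / complex_of_real (h k) * (complex_of_real t ^ n * (cis (x * t) * u t))"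
  have "(\<lambda>k. LINT t|lborel. ?F k t) \<longlonglongrightarrow> (LINT t|lborel. \<i> * (complex_of_real t ^ Suc n * (cis (x * t) * u t)))"
  proof (rule integral_dominated_convergence)
    show "integrable lborel (\<lambda>t. \<bar>t\<bar> ^ Suc n * cmod (u t))" by (rule moment_abs_integrable)
    show "AE t in lborel. (\<lambda>k. ?F k t) \<longlonglongrightarrow> \<i> * (complex_of_real t ^ Suc n * (cis (x * t) * u t))"
    proof (rule AE_I2)
      fix t
      have "((\<lambda>z. exp (\<i> * complex_of_real t * z)) has_field_derivative \<i> * t) (at 0)"
        by (auto intro!: derivative_eq_intros)
      then have "((\<lambda>z. (exp (\<i> * complex_of_real t * z) - 1) / z) \<longlongrightarrow> \<i> * t) (at 0)"
        by (simp add: has_field_derivative_iff)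
      moreover have "filterlim (\<lambda>k. complex_of_real (h k)) (at 0) sequentially"
        unfolding filterlim_at
      proof (intro conjI always_eventually allI)
        show "(\<lambda>k. complex_of_real (h k)) \<longlonglongrightarrow> 0" using tendsto_of_real[OF hl, where 'a=complex] by simp
        show "complex_of_real (h k) \<in> UNIV" "complex_of_real (h k) \<noteq> 0" for k using h0[of k] by auto
      qed
      ultimately have "(\<lambda>k. (exp (\<i> * complex_of_real t * h k) - 1) / h k) \<longlonglongrightarrow> \<i> * t"
        by (rule filterlim_compose)
      then have "(\<lambda>k. (cis (h k * t) - 1) / complex_of_real (h k)) \<longlonglongrightarrow> \<i> * t"
        by (simp add: cis_conv_exp mult_ac)
      then have "(\<lambda>k. ?F k t) \<longlonglongrightarrow> \<i> * t * (complex_of_real t ^ n * (cis (x * t) * u t))"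
        by (intro tendsto_mult tendsto_const)
      then show "(\<lambda>k. ?F k t) \<longlonglongrightarrow> \<i> * (complex_of_real t ^ Suc n * (cis (x * t) * u t))"
        by (simp add: mult_ac)
    qed
    show "AE t in lborel. norm (?F k t) \<le> \<bar>t\<bar> ^ Suc n * cmod (u t)" for k
    proof (rule AE_I2)
      fix t
      have "cmod ((cis (h k * t) - 1) / complex_of_real (h k)) \<le> \<bar>t\<bar>"
        using cmod_cis_minus_one[of "h k * t"] h0[of k] by (simp add: norm_divide abs_mult field_simps)
      then have "cmod ((cis (h k * t) - 1) / complex_of_real (h k)) * (\<bar>t\<bar> ^ n * cmod (u t)) \<le> \<bar>t\<bar> * (\<bar>t\<bar> ^ n * cmod (u t))"
        by (rule mult_right_mono) simp
      moreover have "norm (?F k t) = cmod ((cis (h k * t) - 1) / complex_of_real (h k)) * (\<bar>t\<bar> ^ n * cmod (u t))"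
        by (simp only: norm_mult norm_power norm_of_real norm_cis mult_1_left)
      ultimately show "norm (?F k t) \<le> \<bar>t\<bar> ^ Suc n * cmod (u t)"
        by (simp add: mult.assoc)
    qed
  qed measurable
  moreover have "\<forall>\<^sub>F k in sequentially. (LINT t|lborel. ?F k t) = 0"
  proof -
    have "\<forall>\<^sub>F k in sequentially. h k < \<beta> - x" using order_tendstoD(2)[OF hl, of "\<beta> - x"] x by simp
    then show ?thesis
    proof eventually_elim
      fix k assume "h k < \<beta> - x"
      then have z': "moment n (x + h k) = 0" using x h0[of k] by (intro z) auto
      have "?F k t = (complex_of_real t ^ n * (cis ((x + h k) * t) * u t) - complex_of_real t ^ n * (cis (x * t) * u t)) / complex_of_real (h k)" for t
      proof -
        have "cis ((x + h k) * t) = cis (h k * t) * cis (x * t)" by (simp add: cis_mult algebra_simps)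
        moreover have "(A - 1) / H * (T * (B * V)) = (T * ((A * B) * V) - T * (B * V)) / H" for A B H T V :: complex
          by (simp add: divide_inverse algebra_simps)
        ultimately show ?thesis by (simp only:)
      qed
      then have "(LINT t|lborel. ?F k t) = (moment n (x + h k) - moment n x) / complex_of_real (h k)"
        by (simp only: moment_def integral_divide_zero Bochner_Integration.integral_diff[OF moment_integrable moment_integrable])
      then show "(LINT t|lborel. ?F k t) = 0" using z' z x by simp
    qed
  qed
  ultimately have "(LINT t|lborel. \<i> * (complex_of_real t ^ Suc n * (cis (x * t) * u t))) = 0"
    using LIMSEQ_unique tendsto_eventually[of "\<lambda>k. LINT t|lborel. ?F k t" 0 sequentially] by blast
  then have "\<i> * moment (Suc n) x = 0" unfolding moment_def by (simp only: integral_mult_right_zero)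
  then show ?thesis by simp
qed

text \<open>Taylor expansion about x: the partial sums of exp (i y t) are dominated by exp (r |t|),
  so integrating term by term expresses the transform at x + y through the moments at x.\<close>

lemma moment_zero_shift:
  assumes z: "\<And>n. moment n x = 0" and y: "\<bar>y\<bar> \<le> r"
  shows "moment 0 (x + y) = 0"
proof -
  let ?P = "\<lambda>N t. (\<Sum>n<N. (\<i> * y) ^ n / fact n * (complex_of_real t ^ n * (cis (x * t) * u t)))"
  have tm: "(\<i> * y) ^ n / fact n * (complex_of_real t ^ n * (cis (x * t) * u t)) =
      ((\<i> * complex_of_real y * complex_of_real t) ^ n /\<^sub>R fact n) * (cis (x * t) * u t)" for n and t :: real
    by (simp add: power_mult_distrib scaleR_conv_of_real divide_inverse mult_ac)
  have "(\<lambda>N. LINT t|lborel. ?P N t) \<longlonglongrightarrow> (LINT t|lborel. cis ((x + y) * t) * u t)"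
  proof (rule integral_dominated_convergence[OF _ _ exp_int])
    show "AE t in lborel. (\<lambda>N. ?P N t) \<longlonglongrightarrow> cis ((x + y) * t) * u t"
    proof (rule AE_I2)
      fix t :: real
      have "(\<lambda>N. \<Sum>n<N. (\<i> * complex_of_real y * complex_of_real t) ^ n /\<^sub>R fact n) \<longlonglongrightarrow> exp (\<i> * complex_of_real y * complex_of_real t)"
        using exp_converges[of "\<i> * complex_of_real y * complex_of_real t"] by (simp add: sums_def)
      then have "(\<lambda>N. (\<Sum>n<N. (\<i> * complex_of_real y * complex_of_real t) ^ n /\<^sub>R fact n) * (cis (x * t) * u t)) \<longlonglongrightarrow> exp (\<i> * complex_of_real y * complex_of_real t) * (cis (x * t) * u t)"
        by (intro tendsto_mult tendsto_const)
      moreover have "exp (\<i> * complex_of_real y * complex_of_real t) * (cis (x * t) * u t) = cis ((x + y) * t) * u t"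
      proof -
        have "exp (\<i> * complex_of_real y * complex_of_real t) = cis (y * t)" by (simp add: cis_conv_exp mult.assoc)
        moreover have "cis ((x + y) * t) = cis (y * t) * cis (x * t)" by (simp add: cis_mult algebra_simps)
        ultimately show ?thesis by simp
      qed
      ultimately show "(\<lambda>N. ?P N t) \<longlonglongrightarrow> cis ((x + y) * t) * u t"
        by (simp only: tm sum_distrib_right)
    qed
    show "AE t in lborel. norm (?P N t) \<le> exp (r * \<bar>t\<bar>) * cmod (u t)" for N
    proof (rule AE_I2)
      fix t :: real
      have "norm (\<Sum>n<N. (\<i> * complex_of_real y * complex_of_real t) ^ n /\<^sub>R fact n) \<le> (\<Sum>n<N. (\<bar>y\<bar> * \<bar>t\<bar>) ^ n /\<^sub>R fact n)"
        by (rule sum_norm_le) (simp add: norm_mult norm_power)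
      also have "\<dots> \<le> (\<Sum>n. (\<bar>y\<bar> * \<bar>t\<bar>) ^ n /\<^sub>R fact n)"
        by (intro sum_le_suminf sums_summable[OF exp_converges]) auto
      also have "\<dots> = exp (\<bar>y\<bar> * \<bar>t\<bar>)" using exp_converges[of "\<bar>y\<bar> * \<bar>t\<bar>"] by (simp add: sums_iff)
      also have "\<dots> \<le> exp (r * \<bar>t\<bar>)" using y by (simp add: mult_right_mono)
      finally have "norm (\<Sum>n<N. (\<i> * complex_of_real y * complex_of_real t) ^ n /\<^sub>R fact n) * cmod (u t) \<le> exp (r * \<bar>t\<bar>) * cmod (u t)"
        by (rule mult_right_mono) simp
      then show "norm (?P N t) \<le> exp (r * \<bar>t\<bar>) * cmod (u t)"
        unfolding tm sum_distrib_right[symmetric] norm_mult by simp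
    qed
  qed measurable
  moreover have "(LINT t|lborel. ?P N t) = 0" for N
  proof -
    have "(LINT t|lborel. ?P N t) = (\<Sum>n<N. (\<i> * y) ^ n / fact n * moment n x)"
      unfolding moment_def integral_mult_right_zero[symmetric]
      by (rule Bochner_Integration.integral_sum) (intro integrable_mult_right moment_integrable)
    then show ?thesis by (simp add: z)
  qed
  ultimately have "(LINT t|lborel. cis ((x + y) * t) * u t) = 0" by (simp add: LIMSEQ_const_iff)
  then show ?thesis by (simp add: moment_def)
qed

text \<open>Analytic continuation in real terms: on an interval of zeros all moments vanish, and
  each Taylor expansion enlarges the interval by r on both sides.\<close>

lemma moment_zero_everywhere:
  assumes z: "\<And>x. \<alpha> < x \<Longrightarrow> x < \<beta> \<Longrightarrow> moment 0 x = 0" and ab: "\<alpha> < \<beta>"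
  shows "moment 0 x = 0"
proof -
  have step: "\<forall>x. \<alpha> - real k * r < x \<and> x < \<beta> + real k * r \<longrightarrow> moment 0 x = 0" for k
  proof (induction k)
    case 0
    then show ?case using z by simp
  next
    case (Suc k)
    let ?a = "\<alpha> - real k * r" and ?b = "\<beta> + real k * r"
    have all: "moment n x = 0" if "?a < x" "x < ?b" for n x
      using that
    proof (induction n arbitrary: x)
      case 0
      then show ?case using Suc.IH by blast
    next
      case (Suc n)
      show ?case by (rule moment_zero_Suc[of ?a ?b]) (use Suc in auto)
    qed
    show ?case
    proof (intro allI impI)
      fix x assume x: "\<alpha> - real (Suc k) * r < x \<and> x < \<beta> + real (Suc k) * r"
      have kr: "0 \<le> real k * r" using r_pos by simp
      define p where "p = max ?a (x - r)"
      define q where "q = min ?b (x + r)"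
      have x1: "?a < x + r" "x - r < ?b" using x by (simp_all add: algebra_simps)
      have x2: "?a < ?b" using ab kr by linarith
      \<comment> \<open>Some point x0 lies both in the old interval and within r of x.\<close>
      have "p < q" using x1 x2 r_pos unfolding p_def q_def max_less_iff_conj min_less_iff_conj by simp
      then obtain x0 where x0: "p < x0" "x0 < q" using dense by blast
      have "moment 0 (x0 + (x - x0)) = 0"
        by (rule moment_zero_shift) (use x0 all in \<open>auto simp: p_def q_def\<close>)
      then show "moment 0 x = 0" by simp
    qed
  qed
  obtain k :: nat where k: "real k * r > \<bar>x - \<alpha>\<bar> + \<bar>x - \<beta>\<bar>" using reals_Archimedean3[OF r_pos] by blast
  have "\<alpha> - real k * r < x \<and> x < \<beta> + real k * r" using k by linarith
  then show ?thesis using step[of k] by blast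
qed

end

context cosh_weight
begin

text \<open>The transform is continuous, vanishes on (-c, c) and is analytic, so it vanishes on the
  whole line, and Plancherel gives the claim for u.\<close>

lemma Fop_injective:
  assumes u: "u \<in> L2 W" and z: "AE x in U. Fop c u x = 0"
  shows "AE t in lborel. u t = 0"
proof -
  have ui: "integrable lborel u" by (rule L2_cosh_integrable[OF b_pos u])
  \<comment> \<open>Every positive rate below b / 2 is admissible here.\<close>
  interpret exp_integrable u "b / 4"
  proof
    show "b / 4 > 0" using b_pos by simp
    show "u \<in> borel_measurable borel" by (rule L2_cosh_measurable[OF u])
    show "integrable lborel (\<lambda>t. exp (b / 4 * \<bar>t\<bar>) * cmod (u t))"
      using b_pos by (intro L2_cosh_exp_integrable[OF u]) auto
  qed
  have m0: "moment 0 x = fourier_integral u x" for x by (simp add: moment_def fourier_integral_def)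
  define O' where "O' = {x. -1 < x \<and> x < 1 \<and> fourier_integral u (c * x) \<noteq> 0}"
  have cont: "continuous_on UNIV (\<lambda>x. fourier_integral u (c * x))"
    by (rule continuous_on_compose2[OF fourier_integral_continuous[OF ui]]) (auto intro: continuous_intros)
  have "O' = {-1<..<1} \<inter> (\<lambda>x. fourier_integral u (c * x)) -` (- {0})" by (auto simp: O'_def)
  then have op: "open O'"
    by (auto intro!: open_Int open_vimage cont)
  have "AE x in lborel. x \<notin> O'"
    using z unfolding AE_unit_interval_iff Fop_eq[OF b_pos u] by eventually_elim (auto simp: O'_def)
  then have "O' \<in> null_sets lborel" using op by (subst AE_iff_null_sets) (auto simp: AE_not_in)
  then have "negligible O'" using null_sets_completionI by (auto simp: negligible_iff_null_sets)
  \<comment> \<open>An open null set is empty: zero almost everywhere becomes zero everywhere on the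
    interval.\<close>
  then have "O' = {}" using open_not_negligible[OF op] by blast
  then have "moment 0 x = 0" if "- c < x" "x < c" for x
  proof -
    have "x / c \<notin> O'" using \<open>O' = {}\<close> by simp
    moreover have "-1 < x / c" "x / c < 1" using that c_pos by (simp_all add: field_simps)
    ultimately show ?thesis using c_pos by (simp add: O'_def m0)
  qed
  then have "moment 0 x = 0" for x by (rule moment_zero_everywhere) (use c_pos in auto)
  then have zero: "fourier_integral u = (\<lambda>x. 0)" by (simp add: m0 fun_eq_iff)
  have uL: "u \<in> L2 lborel" by (rule L2_cosh_L2[OF u])
  have "sqrt (2 * pi) * L2n lborel u = 0"
    using Plancherel_L1_L2[OF ui uL] by (simp add: Plancherel_def zero L2n_def)
  then show ?thesis using L2n_eq_0_iff[OF uL] by simp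
qed

end

section \<open>The singular value decomposition\<close>

context qop_eigensystem
begin

abbreviation "s \<equiv> sing_val c \<rho>"
abbreviation "\<phi> \<equiv> sing_fun b c \<rho> g"

lemma s_pos: "s m > 0"
  using rho_pos[of m] c_pos by (simp add: sing_val_def)

lemma s_sq: "(s m)\<^sup>2 = \<rho> m / c"
  using rho_pos[of m] c_pos by (simp add: sing_val_def)

lemma s_antimono: "m \<le> n \<Longrightarrow> s n \<le> s m"
  using rho_dec c_pos by (simp add: sing_val_def decseq_def divide_right_mono)

lemma phi_eq: "\<phi> m = (\<lambda>t. complex_of_real (1 / s m) * Fop_adj b c (G m) t)"
  by (simp add: sing_fun_def[abs_def])

lemma phi_L2: "\<phi> m \<in> L2 W"
  unfolding phi_eq by (intro L2_cmult Fop_adj_L2 G_L2)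

lemma inner_phi:
  assumes "u \<in> L2 W"
  shows "L2_inner W u (\<phi> m) = complex_of_real (1 / s m) * L2_inner U (Fop c u) (G m)"
  unfolding phi_eq L2_inner_cmult_right by (simp add: Fop_adj_adjoint[OF G_L2 assms])

text \<open>Since c times \<open>Fop\<close> after its adjoint is Q, the inner product is \<rho> n
  <G m, G n> / (c s m s n), and the square of s n is \<rho> n / c.\<close>

lemma phi_orthonormal: "L2_orthonormal W \<phi>"
  unfolding L2_orthonormal_def
proof (intro conjI allI phi_L2)
  fix m n
  have "L2_inner W (\<phi> m) (\<phi> n) = complex_of_real (1 / s m) * (complex_of_real (1 / s n) * L2_inner W (Fop_adj b c (G m)) (Fop_adj b c (G n)))"
    unfolding phi_eq[of m] L2_inner_cmult phi_eq[of n] L2_inner_cmult_right by simp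
  also have "L2_inner W (Fop_adj b c (G m)) (Fop_adj b c (G n)) = L2_inner W (Astar b c (G m)) (Astar b c (G n))"
    by (rule L2_inner_cong_AE) (intro Fop_adj_AE L2_measurable Fop_adj_L2 Astar_L2 G_L2)+
  also have "\<dots> = complex_of_real (1 / c) * L2_inner U (Q (G m)) (G n)"
    using c_pos by (simp add: Qop_inner G_L2)
  also have "L2_inner U (Q (G m)) (G n) = \<rho> n * L2_inner U (G m) (G n)" by (rule Q_inner_G[OF G_L2])
  also have "L2_inner U (G m) (G n) = (if m = n then 1 else 0)"
    using G_orthonormal by (simp add: L2_orthonormal_def)
  finally have e: "L2_inner W (\<phi> m) (\<phi> n) = complex_of_real (1 / s m) * (complex_of_real (1 / s n) *
      (complex_of_real (1 / c) * (complex_of_real (\<rho> n) * (if m = n then 1 else 0))))" .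
  show "L2_inner W (\<phi> m) (\<phi> n) = (if m = n then 1 else 0)"
  proof (cases "m = n")
    case True
    have "1 / s n * (1 / s n * (1 / c * \<rho> n)) = (\<rho> n / c) / (s n)\<^sup>2" by (simp add: power2_eq_square)
    also have "\<dots> = 1" unfolding s_sq
      by (rule divide_self) (use divide_pos_pos[OF rho_pos[of n] c_pos] in linarith)
    finally have "complex_of_real (1 / s n * (1 / s n * (1 / c * \<rho> n))) = 1" by (simp only: of_real_1)
    then have "complex_of_real (1 / s n) * (complex_of_real (1 / s n) * (complex_of_real (1 / c) * complex_of_real (\<rho> n))) = 1"
      by (simp only: of_real_mult)
    then show ?thesis unfolding e unfolding True by (simp only: mult_1_right if_True refl)
  qed (simp add: e)
qed

text \<open>\<open>Fop c v\<close> is orthogonal to all eigenfunctions, so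
  \<open>rayleigh_bound\<close> with \<mu> = 0 makes its form vanish. Then \<open>Astar\<close>
  annihilates it, hence \<open>Fop c v\<close> has norm 0, and injectivity concludes.\<close>

lemma phi_total:
  assumes v: "v \<in> L2 W" and z: "\<And>m. L2_inner W v (\<phi> m) = 0"
  shows "AE t in W. v t = 0"
proof -
  let ?h = "Fop c v"
  have h: "?h \<in> L2 U" by (rule Fop_L2[OF v])
  have "L2_inner U ?h (G m) = 0" for m
    using z[of m] s_pos[of m] by (simp add: inner_phi[OF v])
  then have "form ?h \<le> 0 * (L2n U ?h)\<^sup>2"
    by (intro rayleigh_bound[of 0 UNIV] h) auto
  then have "L2n W (Astar b c ?h) = 0" using c_pos by (simp add: form_def mult_le_0_iff)
  moreover have "L2_inner U ?h ?h = L2_inner W v (Astar b c ?h)" by (rule Astar_adjoint[OF v h])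
  ultimately have "cmod (L2_inner U ?h ?h) \<le> 0"
    using L2_inner_bound[OF v Astar_L2[OF h]] by simp
  then have "L2n U ?h = 0" by (simp add: L2_inner_self norm_power)
  then have "AE x in U. ?h x = 0" using L2n_eq_0_iff[OF h] by simp
  from Fop_injective[OF v this] show ?thesis by (simp add: AE_cosh_measure)
qed

text \<open>The error is the norm of the coefficients beyond N; there every weight is at least
  \<eta>, so the source condition bounds their sum of squares by (M / \<eta>)^2.\<close>

lemma truncation_error:
  assumes u: "u \<in> L2 W" and M: "M \<ge> 0"
    and src: "(\<Sum>m. ennreal ((\<omega> m)\<^sup>2 * (cmod (L2_inner W u (\<phi> m)))\<^sup>2)) \<le> ennreal (M\<^sup>2)"
    and om: "\<eta> > 0" "\<And>m. m > N \<Longrightarrow> \<eta> \<le> \<omega> m"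
  shows "L2n W (\<lambda>t. u t - (\<Sum>m\<le>N. L2_inner W u (\<phi> m) * \<phi> m t)) \<le> M / \<eta>"
proof -
  let ?c = "\<lambda>m. L2_inner W u (\<phi> m)"
  define p where "p n t = (\<Sum>m<n. ?c m * \<phi> m t)" for n t
  have p: "p n \<in> L2 W" for n unfolding p_def by (rule L2_orthonormal_sum_L2[OF phi_orthonormal])
  have lim: "(\<lambda>n. L2n W (\<lambda>t. u t - p n t)) \<longlonglongrightarrow> 0"
    unfolding p_def by (rule L2_total_expansion[OF phi_orthonormal u phi_total])
  have fin: "(\<Sum>m\<in>A. (\<omega> m)\<^sup>2 * (cmod (?c m))\<^sup>2) \<le> M\<^sup>2" if "finite A" for A
  proof -
    have "ennreal (\<Sum>m\<in>A. (\<omega> m)\<^sup>2 * (cmod (?c m))\<^sup>2) = (\<Sum>m\<in>A. ennreal ((\<omega> m)\<^sup>2 * (cmod (?c m))\<^sup>2))"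
      by (rule sum_ennreal[symmetric]) simp
    also have "\<dots> \<le> (\<Sum>m. ennreal ((\<omega> m)\<^sup>2 * (cmod (?c m))\<^sup>2))"
      by (rule sum_le_suminf) (use that in auto)
    also note src
    finally show ?thesis by (subst (asm) ennreal_le_iff) auto
  qed
  have d: "L2n W (\<lambda>t. p n t - p (Suc N) t) \<le> M / \<eta>" if n: "n \<ge> Suc N" for n
  proof -
    have "p n t - p (Suc N) t = (\<Sum>m\<in>{Suc N..<n}. ?c m * \<phi> m t)" for t
      using n sum_diff_nat_ivl[of 0 "Suc N" n "\<lambda>m. ?c m * \<phi> m t"] by (simp add: p_def atLeast0LessThan)
    then have "(L2n W (\<lambda>t. p n t - p (Suc N) t))\<^sup>2 = (\<Sum>m\<in>{Suc N..<n}. (cmod (?c m))\<^sup>2)"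
      using L2_orthonormal_norm_sum[OF phi_orthonormal, of "{Suc N..<n}" ?c] by simp
    also have "\<dots> \<le> (\<Sum>m\<in>{Suc N..<n}. (\<omega> m)\<^sup>2 * (cmod (?c m))\<^sup>2 / \<eta>\<^sup>2)"
    proof (rule sum_mono)
      fix m assume "m \<in> {Suc N..<n}"
      then have "\<eta>\<^sup>2 \<le> (\<omega> m)\<^sup>2" using om by (intro power_mono) auto
      then have "\<eta>\<^sup>2 * (cmod (?c m))\<^sup>2 \<le> (\<omega> m)\<^sup>2 * (cmod (?c m))\<^sup>2" by (rule mult_right_mono) simp
      then show "(cmod (?c m))\<^sup>2 \<le> (\<omega> m)\<^sup>2 * (cmod (?c m))\<^sup>2 / \<eta>\<^sup>2"
        using om(1) by (simp add: pos_le_divide_eq mult.commute)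
    qed
    also have "\<dots> \<le> (M / \<eta>)\<^sup>2"
      unfolding sum_divide_distrib[symmetric] power_divide
      using fin[of "{Suc N..<n}"] om(1) by (intro divide_right_mono) auto
    finally show ?thesis by (rule power2_le_imp_le) (use M om(1) in simp)
  qed
  \<comment> \<open>The bound above is for finite blocks; the infinite tail follows by letting n
    grow in the triangle inequality.\<close>
  have "L2n W (\<lambda>t. u t - p (Suc N) t) \<le> 0 + M / \<eta>"
  proof (rule tendsto_lowerbound)
    show "(\<lambda>n. L2n W (\<lambda>t. u t - p n t) + M / \<eta>) \<longlonglongrightarrow> 0 + M / \<eta>"
      by (intro tendsto_add lim tendsto_const)
    show "\<forall>\<^sub>F n in sequentially. L2n W (\<lambda>t. u t - p (Suc N) t) \<le> L2n W (\<lambda>t. u t - p n t) + M / \<eta>"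
    proof (rule eventually_sequentiallyI[of "Suc N"])
      fix n assume "Suc N \<le> n"
      from d[OF this] L2n_triangle_via[OF u p[of "Suc N"] p[of n]]
      show "L2n W (\<lambda>t. u t - p (Suc N) t) \<le> L2n W (\<lambda>t. u t - p n t) + M / \<eta>" by linarith
    qed
  qed simp
  then show ?thesis by (simp add: p_def lessThan_Suc_atMost)
qed

end

section \<open>Trigonometric polynomials on arcs\<close>

text \<open>Gaussian elimination. It will supply a nonzero step function orthogonal to the first N
  eigenfunctions.\<close>

lemma underdetermined_solution:
  fixes A :: "nat \<Rightarrow> nat \<Rightarrow> 'a::field"
  shows "\<exists>a. (\<exists>k\<le>N. a k \<noteq> 0) \<and> (\<forall>i<N. (\<Sum>k\<le>N. A i k * a k) = 0)"
proof (induction N arbitrary: A)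
  case 0
  show ?case by (intro exI[of _ "\<lambda>_. 1"]) simp
next
  case (Suc N)
  show ?case
  proof (cases "\<exists>p\<le>Suc N. A N p \<noteq> 0")
    \<comment> \<open>The last equation is empty: the others are solved in all unknowns but the
      last, which is set to 0.\<close>
    case False
    obtain a where a: "\<exists>k\<le>N. a k \<noteq> 0" "\<forall>i<N. (\<Sum>k\<le>N. A i k * a k) = 0"
      using Suc.IH by blast
    define a' where "a' k = (if k \<le> N then a k else 0)" for k
    have "(\<Sum>k\<le>Suc N. A i k * a' k) = (\<Sum>k\<le>N. A i k * a k)" for i
      by (simp add: a'_def)
    moreover have "(\<Sum>k\<le>Suc N. A N k * a' k) = 0" using False by (intro sum.neutral) auto
    moreover have "\<exists>k\<le>Suc N. a' k \<noteq> 0" using a(1) by (auto simp: a'_def)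
    ultimately show ?thesis using a(2) by (metis less_Suc_eq)
  next
    case True
    then obtain p where p: "p \<le> Suc N" "A N p \<noteq> 0" by blast
    \<comment> \<open>The transposition that moves the pivot column into the last position; it is
      its own inverse.\<close>
    define \<pi> where "\<pi> k = (if k = p then Suc N else if k = Suc N then p else k)" for k
    have inv: "\<pi> (\<pi> k) = k" for k by (simp add: \<pi>_def)
    have le: "\<pi> k \<le> Suc N \<longleftrightarrow> k \<le> Suc N" for k using p(1) by (auto simp: \<pi>_def)
    have bij: "bij_betw \<pi> {..Suc N} {..Suc N}"
      by (rule bij_betw_byWitness[where f'=\<pi>]) (auto simp: inv le)
    define B where "B i k = A i (\<pi> k)" for i k
    have piv: "B N (Suc N) \<noteq> 0" using p by (simp add: B_def \<pi>_def)
    obtain a where a: "\<exists>k\<le>N. a k \<noteq> 0"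
      "\<forall>i<N. (\<Sum>k\<le>N. (B i k - B i (Suc N) * (B N k / B N (Suc N))) * a k) = 0"
      using Suc.IH[of "\<lambda>i k. B i k - B i (Suc N) * (B N k / B N (Suc N))"] by blast
    \<comment> \<open>The last unknown solved from the pivot equation. Substituting it into the
      other equations gives the reduced system to which the induction hypothesis was
      applied.\<close>
    define t where "t = - (\<Sum>k\<le>N. B N k / B N (Suc N) * a k)"
    define a' where "a' k = (if k \<le> N then a k else t)" for k
    have s: "(\<Sum>k\<le>Suc N. B i k * a' k) = (\<Sum>k\<le>N. B i k * a k) + B i (Suc N) * t" for i
      by (simp add: a'_def)
    have z: "(\<Sum>k\<le>Suc N. B i k * a' k) = 0" if "i < Suc N" for i
    proof (cases "i = N")
      case True
      have "B N (Suc N) * t = - (\<Sum>k\<le>N. B N k * a k)"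
        using piv by (simp add: t_def sum_distrib_left)
      then show ?thesis unfolding s True by simp
    next
      case False
      with that have "i < N" by simp
      with a(2) have "(\<Sum>k\<le>N. B i k * a k) - (\<Sum>k\<le>N. B i (Suc N) * (B N k / B N (Suc N) * a k)) = 0"
        by (simp add: left_diff_distrib sum_subtractf mult.assoc)
      then show ?thesis unfolding s by (simp add: t_def sum_distrib_left)
    qed
    show ?thesis
    proof (intro exI[of _ "\<lambda>k. a' (\<pi> k)"] conjI allI impI)
      obtain k where "k \<le> N" "a k \<noteq> 0" using a(1) by blast
      then show "\<exists>k\<le>Suc N. a' (\<pi> k) \<noteq> 0"
        using le[of k] by (intro exI[of _ "\<pi> k"]) (auto simp: inv a'_def)
      fix i assume "i < Suc N"
      have "(\<Sum>k\<le>Suc N. A i k * a' (\<pi> k)) = (\<Sum>k\<le>Suc N. A i (\<pi> k) * a' (\<pi> (\<pi> k)))"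
        by (rule sum.reindex_bij_betw[OF bij, symmetric])
      also have "\<dots> = 0" using z[OF \<open>i < Suc N\<close>] by (simp only: inv B_def)
      finally show "(\<Sum>k\<le>Suc N. A i k * a' (\<pi> k)) = 0" .
    qed
  qed
qed

text \<open>The negative frequencies are those of \<open>Astar\<close>; the function is a polynomial
  of degree at most N in \<open>cis (- \<theta>)\<close>.\<close>

definition trig_poly :: "nat \<Rightarrow> (nat \<Rightarrow> complex) \<Rightarrow> real \<Rightarrow> complex" where
  "trig_poly N a \<theta> = (\<Sum>k\<le>N. a k * cis (- (real k * \<theta>)))"

lemma trig_poly_continuous: "continuous_on A (trig_poly N a)"
  unfolding trig_poly_def by (intro continuous_intros)

lemma has_integral_cis:
  fixes m :: int
  shows "((\<lambda>\<theta>. cis (real_of_int m * \<theta>)) has_integral (if m = 0 then 2 * pi else 0)) {-pi..pi}"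
proof (cases "m = 0")
  case True
  then show ?thesis
    using has_integral_const_real[of "1 :: complex" "- pi" pi] by (simp add: scaleR_conv_of_real)
next
  case False
  let ?F = "\<lambda>\<theta>. cis (real_of_int m * \<theta>) / (\<i> * of_int m)"
  have "((\<lambda>\<theta>. cis (real_of_int m * \<theta>)) has_integral ?F pi - ?F (- pi)) {-pi..pi}"
  proof (rule fundamental_theorem_of_calculus)
    fix x :: real
    have "((\<lambda>\<theta>. cis (real_of_int m * \<theta>)) has_derivative
        (\<lambda>t. (real_of_int m * t) *\<^sub>R (\<i> * cis (real_of_int m * x)))) (at x within {-pi..pi})"
      by (intro has_derivative_cis derivative_eq_intros) auto
    then have "((\<lambda>\<theta>. cis (real_of_int m * \<theta>)) has_vector_derivative
        (\<i> * of_int m) * cis (real_of_int m * x)) (at x within {-pi..pi})"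
      by (simp add: has_vector_derivative_def scaleR_conv_of_real mult_ac)
    from has_vector_derivative_divide[OF this, of "\<i> * of_int m"]
    show "(?F has_vector_derivative cis (real_of_int m * x)) (at x within {-pi..pi})" using False by simp
  qed simp
  moreover have "cis (real_of_int m * pi) = cis (real_of_int m * (- pi))"
  proof -
    have "sin (real_of_int m * pi) = 0" by (simp add: sin_zero_iff_int2)
    then show ?thesis by (simp add: cis.ctr)
  qed
  ultimately show ?thesis using False by simp
qed


lemma trig_poly_sq:
  fixes \<theta> :: real
  shows "complex_of_real ((cmod (trig_poly N a \<theta>))\<^sup>2) =
     (\<Sum>k\<le>N. \<Sum>l\<le>N. a k * cnj (a l) * cis ((int l - int k) * \<theta>))"
proof -
  have "complex_of_real ((cmod (trig_poly N a \<theta>))\<^sup>2) =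
      (\<Sum>k\<le>N. \<Sum>l\<le>N. (a k * cis (- (real k * \<theta>))) * cnj (a l * cis (- (real l * \<theta>))))"
    unfolding complex_norm_square trig_poly_def cnj_sum sum_product ..
  also have "\<dots> = (\<Sum>k\<le>N. \<Sum>l\<le>N. a k * cnj (a l) * cis ((int l - int k) * \<theta>))"
  proof (intro sum.cong refl)
    fix k l
    have "cis (- (real k * \<theta>)) * cis (real l * \<theta>) = cis ((int l - int k) * \<theta>)"
      by (simp add: cis_mult algebra_simps)
    moreover have "(a k * cis (- (real k * \<theta>))) * cnj (a l * cis (- (real l * \<theta>))) =
        a k * cnj (a l) * (cis (- (real k * \<theta>)) * cis (real l * \<theta>))"
      by (simp add: cis_cnj)
    ultimately show "(a k * cis (- (real k * \<theta>))) * cnj (a l * cis (- (real l * \<theta>))) =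
        a k * cnj (a l) * cis ((int l - int k) * \<theta>)" by (simp only:)
  qed
  finally show ?thesis .
qed

lemma trig_poly_Parseval:
  "integral {-pi..pi} (\<lambda>\<theta>. (cmod (trig_poly N a \<theta>))\<^sup>2) = 2 * pi * (\<Sum>k\<le>N. (cmod (a k))\<^sup>2)"
proof -
  have h1: "((\<lambda>\<theta>. \<Sum>k\<le>N. \<Sum>l\<le>N. a k * cnj (a l) * cis ((int l - int k) * \<theta>)) has_integral
      (\<Sum>k\<le>N. \<Sum>l\<le>N. a k * cnj (a l) * (if int l - int k = 0 then 2 * pi else 0))) {-pi..pi}"
    by (intro has_integral_sum has_integral_mult_right finite_atMost) (use has_integral_cis in blast)
  have h2: "(\<Sum>k\<le>N. \<Sum>l\<le>N. a k * cnj (a l) * (if int l - int k = 0 then 2 * pi else 0)) =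
      complex_of_real (2 * pi * (\<Sum>k\<le>N. (cmod (a k))\<^sup>2))"
  proof -
    have "(\<Sum>l\<le>N. a k * cnj (a l) * (if int l - int k = 0 then 2 * pi else 0)) = complex_of_real (2 * pi * (cmod (a k))\<^sup>2)"
      if "k \<le> N" for k
    proof -
      have "(\<Sum>l\<le>N. a k * cnj (a l) * (if int l - int k = 0 then 2 * pi else 0)) =
          (\<Sum>l\<le>N. if k = l then a k * cnj (a k) * (2 * pi) else 0)"
        by (intro sum.cong) auto
      also have "\<dots> = a k * cnj (a k) * (2 * pi)" using that by simp
      finally show ?thesis by (simp add: complex_norm_square[symmetric] mult.commute del: of_real_power)
    qed
    then show ?thesis by (simp add: sum_distrib_left)
  qed
  have "((\<lambda>\<theta>. complex_of_real ((cmod (trig_poly N a \<theta>))\<^sup>2)) has_integral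
      complex_of_real (2 * pi * (\<Sum>k\<le>N. (cmod (a k))\<^sup>2))) {-pi..pi}"
    by (rule has_integral_eq[OF trig_poly_sq[symmetric] h1[unfolded h2]])
  from has_integral_linear[OF this bounded_linear_Re]
  have "((\<lambda>\<theta>. (cmod (trig_poly N a \<theta>))\<^sup>2) has_integral 2 * pi * (\<Sum>k\<le>N. (cmod (a k))\<^sup>2)) {-pi..pi}"
    by (simp only: o_def Re_complex_of_real)
  then show ?thesis by (rule integral_unique)
qed

section \<open>Interpolation and a Remez inequality on arcs\<close>

lemma lagrange_interpolation:
  fixes z :: "nat \<Rightarrow> 'a::field"
  assumes inj: "inj_on z {..N}"
  shows "(\<Sum>k\<le>N. b k * x ^ k) =
    (\<Sum>j\<le>N. (\<Sum>k\<le>N. b k * z j ^ k) * (\<Prod>i\<in>{..N} - {j}. (x - z i) / (z j - z i)))"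
proof -
  define p where "p = (\<Sum>k\<le>N. monom (b k) k)"
  define L where "L j = (\<Prod>i\<in>{..N} - {j}. smult (1 / (z j - z i)) [:- z i, 1:])" for j
  define q where "q = (\<Sum>j\<le>N. smult (poly p (z j)) (L j))"
  have pp: "poly p y = (\<Sum>k\<le>N. b k * y ^ k)" for y
    by (simp add: p_def poly_sum poly_monom)
  have pL: "poly (L j) y = (\<Prod>i\<in>{..N} - {j}. (y - z i) / (z j - z i))" for j y
    by (simp add: L_def poly_prod diff_divide_distrib)
  \<comment> \<open>Both polynomials have degree at most N and agree at N + 1 distinct
    nodes.\<close>
  have "p = q"
  proof (rule poly_eqI_degree[of "z ` {..N}"])
    have card: "card (z ` {..N}) = Suc N" using inj by (simp add: card_image)
    have "degree p \<le> N" unfolding p_def by (intro degree_sum_le) (auto intro: order_trans[OF degree_monom_le])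
    then show "degree p < card (z ` {..N})" using card by simp
    have "degree (L j) \<le> N" if "j \<le> N" for j
    proof -
      have "degree (L j) \<le> (\<Sum>i\<in>{..N} - {j}. degree (smult (1 / (z j - z i)) [:- z i, 1:]))"
        unfolding L_def by (rule order_trans[OF degree_prod_sum_le]) (simp_all add: o_def)
      also have "\<dots> \<le> (\<Sum>i\<in>{..N} - {j}. 1)" by (intro sum_mono) (auto intro: order_trans[OF degree_smult_le])
      also have "\<dots> = N" using that by simp
      finally show ?thesis .
    qed
    then have "degree q \<le> N" unfolding q_def by (intro degree_sum_le) (auto intro: order_trans[OF degree_smult_le])
    then show "degree q < card (z ` {..N})" using card by simp
    fix y assume "y \<in> z ` {..N}"
    then obtain m where m: "m \<le> N" "y = z m" by auto
    have "poly (L j) (z m) = (if j = m then 1 else 0)" if "j \<le> N" for j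
    proof (cases "j = m")
      case True
      have "z m - z i \<noteq> 0" if "i \<in> {..N} - {m}" for i
        using inj that m by (auto simp: inj_on_def)
      then show ?thesis using True unfolding pL by (simp add: prod.neutral)
    next
      case False
      then have "(\<Prod>i\<in>{..N} - {j}. (z m - z i) / (z j - z i)) = 0"
        using m by (intro prod_zero) auto
      then show ?thesis using False by (simp add: pL)
    qed
    then have "poly q (z m) = (\<Sum>j\<le>N. if m = j then poly p (z m) else 0)"
      unfolding q_def poly_sum by (intro sum.cong) auto
    then show "poly p y = poly q y" using m by simp
  qed
  then have "poly p x = poly q x" by simp
  then show ?thesis unfolding pp by (simp add: q_def poly_sum pL pp)
qed

lemma sin_ge_half: "0 \<le> x \<Longrightarrow> x \<le> 1 \<Longrightarrow> x / 2 \<le> sin (x::real)"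
proof (cases "x = 0")
  case False
  assume "0 \<le> x" "x \<le> 1"
  with False have "0 < x" by simp
  have "\<exists>z. 0 < z \<and> z < x \<and> sin x - sin 0 = (x - 0) * cos z"
    by (rule MVT2[OF \<open>0 < x\<close>]) (auto intro!: derivative_eq_intros)
  then obtain z where z: "0 < z" "z < x" "sin x = x * cos z" by auto
  have "cos (pi / 3) \<le> cos z"
    using z \<open>x \<le> 1\<close> pi_gt3 by (intro cos_monotone_0_pi_le) auto
  then have "1 / 2 \<le> cos z" by (simp add: cos_60)
  then have "x * (1 / 2) \<le> x * cos z" using \<open>0 < x\<close> by (intro mult_left_mono) auto
  then show ?thesis using z by simp
qed simp

text \<open>The denominators of the Lagrange basis at equally spaced nodes, up to the
  spacing.\<close>

lemma prod_dist_fact: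
  assumes "j \<le> N"
  shows "(\<Prod>i\<in>{..N} - {j}. \<bar>real j - real i\<bar>) = fact j * fact (N - j)"
proof -
  have split: "{..N} - {j} = {..<j} \<union> {Suc j..N}" using assms by auto
  have "(\<Prod>i\<in>{..N} - {j}. \<bar>real j - real i\<bar>) =
      (\<Prod>i\<in>{..<j}. \<bar>real j - real i\<bar>) * (\<Prod>i\<in>{Suc j..N}. \<bar>real j - real i\<bar>)"
    unfolding split by (rule prod.union_disjoint) auto
  also have "(\<Prod>i\<in>{..<j}. \<bar>real j - real i\<bar>) = (\<Prod>k\<in>{1..j}. real k)"
    by (rule prod.reindex_bij_witness[of _ "\<lambda>k. j - k" "\<lambda>i. j - i"]) auto
  also have "(\<Prod>i\<in>{Suc j..N}. \<bar>real j - real i\<bar>) = (\<Prod>k\<in>{1..N - j}. real k)"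
    by (rule prod.reindex_bij_witness[of _ "\<lambda>k. j + k" "\<lambda>i. i - j"]) (use assms in auto)
  finally show ?thesis by (simp add: fact_prod)
qed

lemma power_le_exp_fact: "0 \<le> x \<Longrightarrow> x ^ n \<le> fact n * exp (x::real)"
  using power_le_fact_exp[of 1 x n] by simp

text \<open>A Remez type inequality, by interpolation at \<open>N + 1\<close> equally spaced nodes of the arc.\<close>

lemma trig_poly_interpolation_bound:
  fixes N :: nat
  assumes T: "0 < T" "T \<le> 1"
  defines "d \<equiv> 2 * T / (N + 1)"
  shows "cmod (trig_poly N a \<theta>) \<le> exp 1 * (4 * exp 1 / T) ^ N * (\<Sum>j\<le>N. cmod (trig_poly N a (s + real j * d)))"
proof -
  define z where "z j = cis (- (s + real j * d))" for j
  define x where "x = cis (- \<theta>)"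
  have d: "d > 0" using T by (simp add: d_def)
  have tp: "trig_poly N a t = (\<Sum>k\<le>N. a k * cis (- t) ^ k)" for t
    unfolding trig_poly_def Complex.DeMoivre by (simp only: mult_minus_right)
  \<comment> \<open>A chord is twice the sine of half the angle. Half the angle is at most T, hence
    at most 1, where sin x >= x / 2, so the chord is at least half the arc.\<close>
  have zd: "cmod (z j - z i) \<ge> d / 2 * \<bar>real j - real i\<bar>" if "i \<le> N" "j \<le> N" for i j
  proof -
    have "\<bar>real j - real i\<bar> \<le> real N" using that by auto
    then have "\<bar>real j - real i\<bar> * d / 2 \<le> real N * d / 2" using d by (intro divide_right_mono mult_right_mono) auto
    also have "\<dots> \<le> 1"
    proof -
      have "real N * d / 2 = real N / (N + 1) * T" by (simp add: d_def divide_simps)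
      also have "\<dots> \<le> 1 * 1" using T by (intro mult_mono) auto
      finally show ?thesis by simp
    qed
    finally have le1: "\<bar>real j - real i\<bar> * d / 2 \<le> 1" .
    have "cmod (z j - z i) = 2 * \<bar>sin (((real i - real j) * d) / 2)\<bar>"
      unfolding z_def cmod_cis_diff by (simp add: algebra_simps)
    also have "\<dots> = 2 * sin (\<bar>real j - real i\<bar> * d / 2)"
    proof (cases "real i \<le> real j")
      case True
      have "sin ((real i - real j) * d / 2) = - sin (\<bar>real j - real i\<bar> * d / 2)"
      proof -
        have "(real i - real j) * d / 2 = - (\<bar>real j - real i\<bar> * d / 2)" using True by (simp add: algebra_simps diff_divide_distrib)
        then show ?thesis by (simp only: sin_minus)
      qed
      moreover have "0 \<le> sin (\<bar>real j - real i\<bar> * d / 2)"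
        using sin_ge_half[OF _ le1] d by (smt (verit) abs_ge_zero divide_nonneg_nonneg mult_nonneg_nonneg)
      ultimately show ?thesis by simp
    next
      case False
      have "0 \<le> sin (\<bar>real j - real i\<bar> * d / 2)"
        using sin_ge_half[OF _ le1] d by (smt (verit) abs_ge_zero divide_nonneg_nonneg mult_nonneg_nonneg)
      with False show ?thesis by simp
    qed
    also have "\<dots> \<ge> 2 * (\<bar>real j - real i\<bar> * d / 2 / 2)"
      using sin_ge_half[OF _ le1] d by (intro mult_left_mono) auto
    finally show ?thesis by (simp add: mult_ac)
  qed
  have inj: "inj_on z {..N}"
  proof (rule inj_onI)
    fix i j assume "i \<in> {..N}" "j \<in> {..N}" "z i = z j"
    then have "d / 2 * \<bar>real j - real i\<bar> \<le> 0" using zd[of i j] by simp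
    then show "i = j" using d by (simp add: mult_le_0_iff)
  qed
  have L: "cmod (\<Prod>i\<in>{..N} - {j}. (x - z i) / (z j - z i)) \<le> exp 1 * (4 * exp 1 / T) ^ N" if j: "j \<le> N" for j
  proof -
    have "cmod (\<Prod>i\<in>{..N} - {j}. (x - z i) / (z j - z i)) = (\<Prod>i\<in>{..N} - {j}. cmod (x - z i) / cmod (z j - z i))"
      by (simp add: prod_norm[symmetric] norm_divide)
    \<comment> \<open>The numerators are distances of two points of the unit circle, hence at most
      2.\<close>
    also have "\<dots> \<le> (\<Prod>i\<in>{..N} - {j}. 2 / (d / 2 * \<bar>real j - real i\<bar>))"
    proof (rule prod_mono)
      fix i assume i: "i \<in> {..N} - {j}"
      have "cmod (x - z i) \<le> cmod x + cmod (z i)" by (rule norm_triangle_ineq4)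
      then have "cmod (x - z i) \<le> 2" by (simp add: x_def z_def)
      moreover have "0 < d / 2 * \<bar>real j - real i\<bar>" using d i by simp
      ultimately show "0 \<le> cmod (x - z i) / cmod (z j - z i) \<and>
          cmod (x - z i) / cmod (z j - z i) \<le> 2 / (d / 2 * \<bar>real j - real i\<bar>)"
        using zd[of i j] i j by (intro conjI frac_le divide_nonneg_nonneg norm_ge_zero) auto
    qed
    also have "\<dots> = (\<Prod>i\<in>{..N} - {j}. (4 / d) / \<bar>real j - real i\<bar>)" by simp
    also have "\<dots> = (4 / d) ^ N / (fact j * fact (N - j))"
      using j by (simp only: prod_dividef prod_dist_fact prod_constant card_Diff_singleton_if) (simp add: power_divide)
    also have "\<dots> = (4 / d) ^ N * (real (N choose j) / fact N)"
      using j by (simp add: binomial_fact)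
    also have "\<dots> \<le> (4 / d) ^ N * (2 ^ N / fact N)"
    proof (intro mult_left_mono divide_right_mono)
      have "real (N choose j) \<le> real (2 ^ N)"
        unfolding of_nat_le_iff choose_row_sum[symmetric] by (rule member_le_sum) (use j in auto)
      then show "real (N choose j) \<le> 2 ^ N" by simp
    qed (use d in auto)
    \<comment> \<open>The spacing d = 2 T / (N + 1) puts a power of N + 1 into the
      numerator.\<close>
    also have "\<dots> = (4 / T) ^ N * (real (N + 1) ^ N / fact N)"
    proof -
      have "4 / d * 2 = 4 / T * real (N + 1)" using T by (simp add: d_def field_simps)
      then have "(4 / d) ^ N * 2 ^ N = (4 / T * real (N + 1)) ^ N"
        by (simp only: power_mult_distrib[symmetric])
      then show ?thesis by (simp only: power_mult_distrib times_divide_eq_right)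
    qed
    \<comment> \<open>In place of Stirling: (N + 1)^N / N! is one term of the series of exp (N +
      1).\<close>
    also have "\<dots> \<le> (4 / T) ^ N * exp (real (N + 1))"
      using T power_le_exp_fact[of "real (N + 1)" N]
      by (intro mult_left_mono) (simp_all add: pos_divide_le_eq mult.commute)
    also have "\<dots> = exp 1 * (4 * exp 1 / T) ^ N"
    proof -
      have "exp (real (N + 1)) = exp 1 * exp 1 ^ N"
        using exp_of_nat_mult[of "N + 1" "1 :: real"] by simp
      then show ?thesis by (simp only: power_mult_distrib power_divide mult_ac times_divide_eq_left times_divide_eq_right)
    qed
    finally show ?thesis .
  qed
  have "trig_poly N a \<theta> = (\<Sum>k\<le>N. a k * x ^ k)" by (simp add: tp x_def)
  also have "\<dots> = (\<Sum>j\<le>N. (\<Sum>k\<le>N. a k * z j ^ k) * (\<Prod>i\<in>{..N} - {j}. (x - z i) / (z j - z i)))"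
    by (rule lagrange_interpolation[OF inj])
  also have "\<dots> = (\<Sum>j\<le>N. trig_poly N a (s + real j * d) * (\<Prod>i\<in>{..N} - {j}. (x - z i) / (z j - z i)))"
    by (simp add: tp z_def)
  finally have "cmod (trig_poly N a \<theta>) \<le>
      (\<Sum>j\<le>N. cmod (trig_poly N a (s + real j * d) * (\<Prod>i\<in>{..N} - {j}. (x - z i) / (z j - z i))))"
    by (simp only: norm_sum)
  also have "\<dots> \<le> (\<Sum>j\<le>N. cmod (trig_poly N a (s + real j * d)) * (exp 1 * (4 * exp 1 / T) ^ N))"
    unfolding norm_mult by (intro sum_mono mult_left_mono L) auto
  finally show ?thesis by (simp add: sum_distrib_left mult.commute)
qed

lemma integral_split_cells:
  fixes f :: "real \<Rightarrow> real"
  assumes f: "continuous_on UNIV f" and d: "d \<ge> 0"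
  shows "integral {p..p + real n * d} f = (\<Sum>j<n. integral {0..d} (\<lambda>t. f (p + real j * d + t)))"
proof (induction n)
  case (Suc n)
  have i: "f integrable_on {a..b}" for a b
    by (intro integrable_continuous_real continuous_on_subset[OF f]) simp
  have "integral {p..p + real (Suc n) * d} f = integral {p..p + real n * d} f + integral {p + real n * d..p + real (Suc n) * d} f"
    by (rule Henstock_Kurzweil_Integration.integral_combine[symmetric, OF _ _ i]) (use d in \<open>auto simp: mult_right_mono\<close>)
  also have "integral {p + real n * d..p + real (Suc n) * d} f = integral {0..d} (\<lambda>t. f (p + real n * d + t))"
    using integral_shift_Icc_real[of 0 d f "p + real n * d"] by (simp add: o_def algebra_simps)
  finally show ?case using Suc by simp
qed simp

text \<open>The interpolation bound may use nodes shifted by any t. Parseval converts it into a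
  bound on the coefficients, and averaging over t in one cell converts the sampled values into the
  integral over the arc.\<close>

lemma trig_poly_arc_bound:
  fixes N :: nat
  assumes T: "0 < T" "T \<le> 1"
  shows "2 * T / (real (N + 1) * (exp 1 * (4 * exp 1 / T) ^ N))\<^sup>2 * (\<Sum>k\<le>N. (cmod (a k))\<^sup>2)
    \<le> integral {-T..T} (\<lambda>\<theta>. (cmod (trig_poly N a \<theta>))\<^sup>2)"
proof -
  define \<Lambda> where "\<Lambda> = exp 1 * (4 * exp 1 / T) ^ N"
  define S where "S = (\<Sum>k\<le>N. (cmod (a k))\<^sup>2)"
  define d where "d = 2 * T / (N + 1)"
  define f where "f \<theta> = (cmod (trig_poly N a \<theta>))\<^sup>2" for \<theta>
  have \<Lambda>: "\<Lambda> > 0" using T by (simp add: \<Lambda>_def)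
  have d: "d > 0" using T by (simp add: d_def)
  have fc: "continuous_on A f" for A unfolding f_def by (intro continuous_intros trig_poly_continuous)
  have fi: "f integrable_on {p..q}" for p q by (intro integrable_continuous_real fc)
  have pt: "S \<le> \<Lambda>\<^sup>2 * (N + 1) * (\<Sum>j\<le>N. f (- T + real j * d + t))" for t
  proof -
    define R where "R = (\<Sum>j\<le>N. f (- T + real j * d + t))"
    have b: "f \<theta> \<le> \<Lambda>\<^sup>2 * (N + 1) * R" for \<theta>
    proof -
      have "cmod (trig_poly N a \<theta>) \<le> \<Lambda> * (\<Sum>j\<le>N. cmod (trig_poly N a ((- T + t) + real j * d)))"
        unfolding \<Lambda>_def d_def by (rule trig_poly_interpolation_bound[OF T])
      then have "f \<theta> \<le> (\<Lambda> * (\<Sum>j\<le>N. cmod (trig_poly N a ((- T + t) + real j * d))))\<^sup>2"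
        unfolding f_def by (intro power_mono) auto
      \<comment> \<open>Cauchy-Schwarz for N + 1 summands passes from moduli to squares at the cost
        of a factor N + 1.\<close>
      also have "\<dots> \<le> \<Lambda>\<^sup>2 * ((N + 1) * (\<Sum>j\<le>N. (cmod (trig_poly N a ((- T + t) + real j * d)))\<^sup>2))"
        unfolding power_mult_distrib
        using Cauchy_Schwarz_ineq_sum[of "\<lambda>_. 1" "\<lambda>j. cmod (trig_poly N a ((- T + t) + real j * d))" "{..N}"]
        by (intro mult_left_mono) auto
      also have "\<dots> = \<Lambda>\<^sup>2 * (N + 1) * R" unfolding R_def f_def by (simp add: algebra_simps)
      finally show ?thesis .
    qed
    \<comment> \<open>The pointwise bound holds at every angle, also off the arc, so it can be
      integrated over the full period.\<close>
    have "2 * pi * S = integral {-pi..pi} f" unfolding S_def f_def by (rule trig_poly_Parseval[symmetric])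
    also have "\<dots> \<le> integral {-pi..pi} (\<lambda>_. \<Lambda>\<^sup>2 * (N + 1) * R)"
      by (intro integral_le fi b integrable_const_ivl)
    also have "\<dots> = 2 * pi * (\<Lambda>\<^sup>2 * (N + 1) * R)" by simp
    finally show ?thesis by (simp add: R_def)
  qed
  \<comment> \<open>As t runs through [0, d], the N + 1 shifted nodes sweep the arc from -T to T
    exactly once.\<close>
  have "d * S = integral {0..d} (\<lambda>_. S)" using d by simp
  also have "\<dots> \<le> integral {0..d} (\<lambda>t. \<Lambda>\<^sup>2 * (N + 1) * (\<Sum>j\<le>N. f (- T + real j * d + t)))"
    by (intro integral_le pt integrable_continuous_real continuous_intros continuous_on_compose2[OF fc]) auto
  also have "\<dots> = \<Lambda>\<^sup>2 * (N + 1) * integral {0..d} (\<lambda>t. \<Sum>j\<le>N. f (- T + real j * d + t))"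
    by (rule integral_mult_right)
  also have "integral {0..d} (\<lambda>t. \<Sum>j\<le>N. f (- T + real j * d + t)) =
      (\<Sum>j\<le>N. integral {0..d} (\<lambda>t. f (- T + real j * d + t)))"
    by (intro integral_sum integrable_continuous_real continuous_intros continuous_on_compose2[OF fc[of UNIV]]) auto
  also have "\<dots> = integral {- T..- T + real (N + 1) * d} f"
    using integral_split_cells[OF fc, of d "- T" "N + 1"] d by (simp add: lessThan_Suc_atMost)
  also have "- T + real (N + 1) * d = T" by (simp add: d_def)
  finally have "d * S \<le> \<Lambda>\<^sup>2 * (N + 1) * integral {- T..T} f" .
  then have "d * S / (\<Lambda>\<^sup>2 * (N + 1)) \<le> integral {- T..T} f"
    using \<Lambda> by (simp add: pos_divide_le_eq mult.commute)
  moreover have "d * S / (\<Lambda>\<^sup>2 * (N + 1)) = 2 * T / (real (N + 1) * \<Lambda>)\<^sup>2 * S"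
    by (simp add: d_def power_mult_distrib power2_eq_square)
  ultimately show ?thesis by (simp add: \<Lambda>_def S_def f_def[abs_def])
qed

section \<open>A lower bound on the eigenvalues\<close>

text \<open>Half open, so that neighbouring cells are disjoint and all cells are exact translates of
  the first.\<close>

definition cell :: "real \<Rightarrow> nat \<Rightarrow> real set" where
  "cell w k = {-1 + real k * w ..< -1 + (real k + 1) * w}"

lemma cell_measurable [measurable]: "cell w k \<in> sets borel"
  by (simp add: cell_def)

lemma cell_disjoint:
  assumes "w > 0" "x \<in> cell w k" "x \<in> cell w l"
  shows "k = l"
proof -
  have "real k * w < (real l + 1) * w" "real l * w < (real k + 1) * w"
    using assms(2,3) by (auto simp: cell_def)
  then have "real k < real l + 1" "real l < real k + 1" using assms(1) by simp_all
  then show ?thesis by linarith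
qed

lemma cell_integral:
  fixes f :: "real \<Rightarrow> complex"
  assumes k: "k \<le> N" and w: "w = 2 / (real N + 1)" and f [measurable]: "f \<in> borel_measurable borel"
  shows "(LINT x|unit_interval_measure. indicator (cell w k) x * f x) =
    (LINT y|lborel. indicator {0..<w} y * f (-1 + real k * w + y))"
proof -
  have w0: "w > 0" by (simp add: w)
  have kw: "(real k + 1) * w \<le> 2"
  proof -
    have "(real k + 1) * w \<le> (real N + 1) * w" using k w0 by (intro mult_right_mono) auto
    moreover have "real N + 1 \<noteq> 0" by linarith
    then have "(real N + 1) * w = 2" unfolding w
      by (subst times_divide_eq_right) (rule nonzero_mult_div_cancel_left)
    ultimately show ?thesis by linarith
  qed
  have "(LINT x|unit_interval_measure. indicator (cell w k) x * f x) =
      (LINT x|lborel. indicator {-1<..<1} x *\<^sub>R (indicator (cell w k) x * f x))"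
    unfolding unit_interval_measure_def by (rule integral_restrict_space) simp
  also have "\<dots> = (LINT x|lborel. indicator (cell w k) x * f x)"
  proof (rule integral_cong_AE)
    \<comment> \<open>Cell 0 contains the endpoint -1, which is missing from the open
      interval.\<close>
    have "AE x in lborel. x \<noteq> (-1::real)" by (rule AE_lborel_singleton)
    then show "AE x in lborel. indicator {-1<..<1} x *\<^sub>R (indicator (cell w k) x * f x) = indicator (cell w k) x * f x"
    proof eventually_elim
      fix x :: real assume "x \<noteq> -1"
      moreover have "0 \<le> real k * w" using w0 by simp
      ultimately have "x \<in> cell w k \<Longrightarrow> x \<in> {-1<..<1}" using kw by (auto simp: cell_def)
      then show "indicator {-1<..<1} x *\<^sub>R (indicator (cell w k) x * f x) = indicator (cell w k) x * f x"
        by (auto simp: indicator_def)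
    qed
  qed measurable
  also have "\<dots> = \<bar>1\<bar> *\<^sub>R (LINT y|lborel. indicator (cell w k) (-1 + real k * w + 1 * y) * f (-1 + real k * w + 1 * y))"
    by (rule lborel_integral_real_affine) simp
  also have "\<dots> = (LINT y|lborel. indicator {0..<w} y * f (-1 + real k * w + y))"
  proof -
    have "indicator (cell w k) (-1 + real k * w + 1 * y) = (indicator {0..<w} y :: complex)" for y
      by (auto simp: cell_def indicator_def algebra_simps)
    then show ?thesis by simp
  qed
  finally show ?thesis .
qed

text \<open>Moving the phase to the midpoint of the cell does not change the modulus. The real part
  is then nonnegative on the whole cell and at least 1/2 on its middle half, because the phase there
  is at most \<pi> / 4.\<close>

lemma cell_transform_bound:
  assumes w: "w > 0" and s: "\<bar>s\<bar> * w \<le> pi"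
  shows "w / 4 \<le> cmod (LINT y|lborel. indicator {0..<w} y * cis (- (s * y)))"
proof -
  have int: "integrable lborel (\<lambda>y. indicator {0..<w} y * cis (g y))" if [measurable]: "g \<in> borel_measurable borel" for g
    by (rule Bochner_Integration.integrable_bound[OF integrable_indicator_interval[of w 1]])
       (auto simp: indicator_def)
  let ?J = "LINT y|lborel. indicator {0..<w} y * cis (- (s * y))"
  have "w / 4 = (LINT y|lborel. indicator {w/4..3*w/4} y * (1/2::real))"
    using w by simp
  also have "\<dots> \<le> (LINT y|lborel. Re (indicator {0..<w} y * cis (s * (w / 2 - y))))"
  proof (rule integral_mono)
    show "integrable lborel (\<lambda>y. indicator {w/4..3*w/4} y * (1/2::real))"
      by (intro integrable_mult_left) (simp add: integrable_indicator_iff emeasure_lborel_Icc_eq)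
    show "integrable lborel (\<lambda>y. Re (indicator {0..<w} y * cis (s * (w / 2 - y))))"
      by (intro integrable_Re int) measurable
    fix y :: real
    have b: "\<bar>s * (w / 2 - y)\<bar> \<le> pi / 2" if "y \<in> {0..<w}"
    proof -
      have "\<bar>s * (w / 2 - y)\<bar> \<le> \<bar>s\<bar> * (w / 2)"
        unfolding abs_mult using that by (intro mult_left_mono abs_leI) auto
      then show ?thesis using s by simp
    qed
    have b2: "\<bar>s * (w / 2 - y)\<bar> \<le> pi / 4" if "y \<in> {w/4..3*w/4}"
    proof -
      have "\<bar>s * (w / 2 - y)\<bar> \<le> \<bar>s\<bar> * (w / 4)"
        unfolding abs_mult using that by (intro mult_left_mono abs_leI) auto
      then show ?thesis using s by simp
    qed
    show "indicator {w/4..3*w/4} y * (1/2) \<le> Re (indicator {0..<w} y * cis (s * (w / 2 - y)))"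
    proof (cases "y \<in> {w/4..3*w/4}")
      case True
      then have "y \<in> {0..<w}" using w by auto
      have "cos (pi / 3) \<le> cos \<bar>s * (w / 2 - y)\<bar>"
      proof (rule cos_monotone_0_pi_le)
        show "\<bar>s * (w / 2 - y)\<bar> \<le> pi / 3" using b2[OF True] pi_gt_zero by linarith
      qed (use pi_gt_zero in auto)
      then have "1 / 2 \<le> cos (s * (w / 2 - y))" by (simp add: cos_60)
      then show ?thesis using True \<open>y \<in> {0..<w}\<close> by simp
    next
      case False
      have "0 \<le> cos (s * (w / 2 - y))" if "y \<in> {0..<w}"
        using b[OF that] by (intro cos_ge_zero) auto
      then show ?thesis using False by (auto simp: indicator_def)
    qed
  qed
  also have "\<dots> = Re (LINT y|lborel. indicator {0..<w} y * cis (s * (w / 2 - y)))"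
    by (rule integral_Re) (intro int; measurable)
  also have "\<dots> \<le> cmod (LINT y|lborel. indicator {0..<w} y * cis (s * (w / 2 - y)))"
    by (rule complex_Re_le_cmod)
  also have "(LINT y|lborel. indicator {0..<w} y * cis (s * (w / 2 - y))) = cis (s * w / 2) * ?J"
  proof -
    have "indicator {0..<w} y * cis (s * (w / 2 - y)) = cis (s * w / 2) * (indicator {0..<w} y * cis (- (s * y)))" for y
    proof -
      have "cis (s * (w / 2 - y)) = cis (s * w / 2) * cis (- (s * y))"
        by (simp add: cis_mult algebra_simps)
      then show ?thesis by simp
    qed
    then show ?thesis by (simp only: integral_mult_right_zero)
  qed
  also have "cmod (cis (s * w / 2) * ?J) = cmod ?J" by (simp add: norm_mult)
  finally show ?thesis .
qed

context qop_eigensystem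
begin

text \<open>The trial functions are step functions on \<open>N + 1\<close> cells of width \<open>w\<close>: their transform is a
  trigonometric polynomial times the transform of one cell.\<close>

lemma rho_trial_bound:
  assumes T: "0 < T" "T \<le> pi" and \<epsilon>: "\<epsilon> \<ge> 0"
    and P: "\<And>a. \<epsilon> * (\<Sum>k\<le>N. (cmod (a k))\<^sup>2) \<le> integral {-T..T} (\<lambda>\<theta>. (cmod (trig_poly N a \<theta>))\<^sup>2)"
  shows "\<epsilon> / 16 / cosh (T * (real N + 1) / (2 * (c / b))) \<le> \<rho> N"
proof -
  define w where "w = 2 / (real N + 1)"
  have w: "w > 0" by (simp add: w_def)
  define I where "I k = (\<lambda>x. indicator (cell w k) x :: complex)" for k
  have I_meas [measurable]: "I k \<in> borel_measurable borel" for k unfolding I_def by measurable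
  have I_L2: "I k \<in> L2 U" for k
    by (rule L2_unit_interval_bounded[OF measurable_unit_interval[OF I_meas], of _ 1]) (simp add: I_def indicator_def)
  \<comment> \<open>N orthogonality conditions on N + 1 coefficients leave a nontrivial
    solution.\<close>
  obtain a where a: "\<exists>k\<le>N. a k \<noteq> 0" "\<And>i. i < N \<Longrightarrow> (\<Sum>k\<le>N. L2_inner U (I k) (G i) * a k) = 0"
    using underdetermined_solution[of N "\<lambda>i k. L2_inner U (I k) (G i)"] by blast
  define S where "S = (\<Sum>k\<le>N. (cmod (a k))\<^sup>2)"
  have S: "S > 0"
  proof -
    obtain k where "k \<le> N" "a k \<noteq> 0" using a(1) by blast
    then show ?thesis unfolding S_def by (intro sum_pos2[of _ k]) auto
  qed
  define h where "h x = (\<Sum>k\<le>N. a k * I k x)" for x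
  have h_L2: "h \<in> L2 U" unfolding h_def by (intro L2_sum L2_cmult I_L2)
  have h_orth: "L2_inner U h (G i) = 0" if "i < N" for i
  proof -
    have "L2_inner U h (G i) = (\<Sum>k\<le>N. L2_inner U (\<lambda>x. a k * I k x) (G i))"
      unfolding h_def by (intro L2_inner_sum L2_cmult I_L2 G_L2)
    then show ?thesis using a(2)[OF that] by (simp add: L2_inner_cmult mult.commute)
  qed
  have h_norm: "(L2n U h)\<^sup>2 = w * S"
  proof -
    have pt: "h x * cnj (h x) = (\<Sum>k\<le>N. complex_of_real ((cmod (a k))\<^sup>2) * (indicator (cell w k) x * 1))" for x
    proof (cases "\<exists>k\<le>N. x \<in> cell w k")
      case True
      then obtain k where k: "k \<le> N" "x \<in> cell w k" by blast
      have i: "indicator (cell w l) x = (if l = k then 1 else 0 :: complex)" for l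
      proof (cases "l = k")
        case False
        then have "x \<notin> cell w l" using cell_disjoint[OF w k(2)] by blast
        with False show ?thesis by simp
      qed (simp add: k(2))
      have "h x = a k" unfolding h_def I_def i using k(1) by (simp add: if_distrib cong: if_cong)
      moreover have "(\<Sum>l\<le>N. complex_of_real ((cmod (a l))\<^sup>2) * (indicator (cell w l) x * 1)) = complex_of_real ((cmod (a k))\<^sup>2)"
        unfolding i mult_1_right using k(1) by (simp add: if_distrib cong: if_cong)
      ultimately show ?thesis by (simp only: complex_norm_square)
    next
      case False
      then show ?thesis by (simp add: h_def I_def indicator_def)
    qed
    have one: "(LINT x|U. indicator (cell w k) x * 1) = complex_of_real w" if "k \<le> N" for k
    proof -
      have "(LINT x|U. indicator (cell w k) x * (1::complex)) = (LINT y|lborel. indicator {0..<w} y * 1)"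
        using cell_integral[OF that w_def, of "\<lambda>_. 1"] by simp
      also have "\<dots> = complex_of_real (measure lborel {0..<w})"
        using integral_complex_of_real[of lborel "indicator {0..<w}"] by (simp add: of_real_indicator)
      finally show ?thesis using w by simp
    qed
    have "complex_of_real ((L2n U h)\<^sup>2) = (LINT x|U. (\<Sum>k\<le>N. complex_of_real ((cmod (a k))\<^sup>2) * (indicator (cell w k) x * 1)))"
      unfolding L2_inner_self[symmetric] L2_inner_def pt ..
    also have "\<dots> = (\<Sum>k\<le>N. (LINT x|U. complex_of_real ((cmod (a k))\<^sup>2) * (indicator (cell w k) x * 1)))"
    proof (intro Bochner_Integration.integral_sum integrable_mult_right)
      show "integrable U (\<lambda>x. indicator (cell w k) x * 1 :: complex)" for k
        using L2_unit_interval_integrable[OF I_L2[of k]] by (simp add: I_def)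
    qed
    also have "\<dots> = (\<Sum>k\<le>N. complex_of_real ((cmod (a k))\<^sup>2) * complex_of_real w)"
      by (intro sum.cong refl) (simp only: integral_mult_right_zero one atMost_iff)
    also have "\<dots> = complex_of_real (w * S)" by (simp add: S_def sum_distrib_left mult.commute)
    finally show ?thesis by (simp only: of_real_eq_iff)
  qed
  define J where "J s = (LINT y|lborel. indicator {0..<w} y * cis (- (s * y)))" for s
  have star: "cmod (Astar b c h t) = cmod (J (c * t)) * cmod (trig_poly N a (c * w * t)) / cosh (b * t)" for t
  proof -
    have "(LINT x|U. cis (- (c * x * t)) * h x) = (LINT x|U. (\<Sum>k\<le>N. a k * (I k x * cis (- (c * x * t)))))"
      by (simp add: h_def sum_distrib_left mult_ac)
    also have "\<dots> = (\<Sum>k\<le>N. (LINT x|U. a k * (I k x * cis (- (c * x * t)))))"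
    proof (intro Bochner_Integration.integral_sum integrable_mult_right)
      show "integrable U (\<lambda>x. I k x * cis (- (c * x * t)))" for k
        using integrable_cis_mult[OF L2_unit_interval_integrable[OF I_L2[of k]], of "\<lambda>x. - (c * x * t)"]
        by (simp add: mult.commute measurable_unit_interval)
    qed
    also have "\<dots> = (\<Sum>k\<le>N. cis (c * t) * J (c * t) * (a k * cis (- (real k * (c * w * t)))))"
    proof (intro sum.cong refl)
      fix k assume "k \<in> {..N}"
      then have "(LINT x|U. I k x * cis (- (c * x * t))) =
          (LINT y|lborel. indicator {0..<w} y * cis (- (c * (-1 + real k * w + y) * t)))"
        unfolding I_def by (intro cell_integral[of k N w "\<lambda>x. cis (- (c * x * t))"] w_def) auto
      also have "\<dots> = (LINT y|lborel. (cis (c * t) * cis (- (real k * (c * w * t)))) * (indicator {0..<w} y * cis (- (c * t * y))))"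
      proof (intro Bochner_Integration.integral_cong refl)
        fix y
        have "cis (- (c * (-1 + real k * w + y) * t)) = cis (c * t) * cis (- (real k * (c * w * t))) * cis (- (c * t * y))"
          by (simp add: cis_mult algebra_simps)
        then show "indicator {0..<w} y * cis (- (c * (-1 + real k * w + y) * t)) =
            (cis (c * t) * cis (- (real k * (c * w * t)))) * (indicator {0..<w} y * cis (- (c * t * y)))"
          by (simp add: mult_ac)
      qed
      also have "\<dots> = (cis (c * t) * cis (- (real k * (c * w * t)))) * J (c * t)"
        unfolding J_def by (rule integral_mult_right_zero)
      finally show "(LINT x|U. a k * (I k x * cis (- (c * x * t)))) = cis (c * t) * J (c * t) * (a k * cis (- (real k * (c * w * t))))"
        by (simp add: mult_ac)
    qed
    also have "\<dots> = cis (c * t) * J (c * t) * trig_poly N a (c * w * t)"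
      by (simp only: trig_poly_def sum_distrib_left)
    finally show ?thesis by (simp add: Astar_def norm_divide norm_mult)
  qed
  \<comment> \<open>Under \<theta> = c w t the arc becomes |t| <= R, and cosh (b t) is at most cosh
    (b R) there. The condition T <= \<pi> is what \<open>cell_transform_bound\<close> asks
    for.\<close>
  define R where "R = T / (c * w)"
  define f where "f \<theta> = (cmod (trig_poly N a \<theta>))\<^sup>2" for \<theta>
  have cw: "c * w > 0" using c_pos w by simp
  have fi: "integrable lborel (\<lambda>\<theta>. indicator {-T..T} \<theta> *\<^sub>R f \<theta>)"
    unfolding f_def by (intro borel_integrable_compact continuous_intros trig_poly_continuous) auto
  have fL: "(LINT \<theta>|lborel. indicator {-T..T} \<theta> *\<^sub>R f \<theta>) = integral {-T..T} f"
    using set_borel_integral_eq_integral(2)[of "{-T..T}" f] fi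
    by (simp add: set_integrable_def set_lebesgue_integral_def)
  let ?K = "(w / 4)\<^sup>2 / cosh (b * R)"
  have "?K * (1 / (c * w) * integral {-T..T} f) = (LINT t|lborel. ?K * (indicator {-T..T} (c * w * t) *\<^sub>R f (c * w * t)))"
  proof -
    have "integral {-T..T} f = \<bar>c * w\<bar> *\<^sub>R (LINT t|lborel. indicator {-T..T} (0 + c * w * t) *\<^sub>R f (0 + c * w * t))"
      unfolding fL[symmetric] using cw by (intro lborel_integral_real_affine) auto
    then have "integral {-T..T} f = c * w * (LINT t|lborel. indicator {-T..T} (c * w * t) *\<^sub>R f (c * w * t))"
      using cw by simp
    moreover have "1 / (c * w) * (c * w * X) = X" for X using c_pos w by simp
    ultimately have "1 / (c * w) * integral {-T..T} f = (LINT t|lborel. indicator {-T..T} (c * w * t) *\<^sub>R f (c * w * t))"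
      by (simp only:)
    then show ?thesis by (simp only: integral_mult_right_zero)
  qed
  also have "\<dots> \<le> (LINT t|lborel. cosh (b * t) * (cmod (Astar b c h t))\<^sup>2)"
  proof (rule integral_mono)
    show "integrable lborel (\<lambda>t. ?K * (indicator {-T..T} (c * w * t) *\<^sub>R f (c * w * t)))"
      using lborel_integrable_real_affine[OF fi, of "c * w" 0] c_pos w by (intro integrable_mult_right) simp
    show "integrable lborel (\<lambda>t. cosh (b * t) * (cmod (Astar b c h t))\<^sup>2)"
      using Astar_L2[OF h_L2] by (simp add: L2_cosh_iff)
    fix t
    show "?K * (indicator {-T..T} (c * w * t) *\<^sub>R f (c * w * t)) \<le> cosh (b * t) * (cmod (Astar b c h t))\<^sup>2"
    proof (cases "c * w * t \<in> {-T..T}")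
      case True
      then have "\<bar>c * w * t\<bar> \<le> T" by auto
      then have t: "\<bar>c * t\<bar> * w \<le> T" using c_pos w by (simp add: abs_mult mult_ac)
      have "w / 4 \<le> cmod (J (c * t))"
        unfolding J_def using t T by (intro cell_transform_bound w) auto
      then have j: "(w / 4)\<^sup>2 \<le> (cmod (J (c * t)))\<^sup>2" using w by (intro power_mono) auto
      have "\<bar>t\<bar> \<le> R" using t c_pos w by (simp add: R_def pos_le_divide_eq abs_mult mult_ac)
      then have "\<bar>b * t\<bar> \<le> b * R" using b_pos by (simp add: abs_mult)
      then have ch: "cosh (b * t) \<le> cosh (b * R)"
        by (metis abs_ge_zero cosh_real_abs cosh_real_nonneg_le_iff order_trans)
      have "?K * f (c * w * t) \<le> (cmod (J (c * t)))\<^sup>2 / cosh (b * t) * f (c * w * t)"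
        by (intro mult_right_mono frac_le j ch) (auto simp: f_def)
      also have "\<dots> = cosh (b * t) * (cmod (Astar b c h t))\<^sup>2"
        unfolding star f_def by (simp add: power_mult_distrib power_divide power2_eq_square)
      finally show ?thesis using True by simp
    qed simp
  qed
  also have "\<dots> = (L2n W (Astar b c h))\<^sup>2"
    using L2n_cosh[OF Astar_measurable[OF h_L2]] by simp
  finally have "c * (?K * (1 / (c * w) * integral {-T..T} f)) \<le> form h"
    unfolding form_def by (rule mult_left_mono) (use c_pos in simp)
  moreover have "c * (?K * (1 / (c * w) * (\<epsilon> * S))) \<le> c * (?K * (1 / (c * w) * integral {-T..T} f))"
    using P[of a] c_pos w unfolding S_def f_def[abs_def] by (intro mult_left_mono) auto
  moreover have "c * (?K * (1 / (c * w) * (\<epsilon> * S))) = \<epsilon> / 16 / cosh (b * R) * (w * S)"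
    using c_pos w by (simp add: power2_eq_square)
  \<comment> \<open>On the complement of the first N eigenfunctions the largest eigenvalue left is
    \<rho> N.\<close>
  moreover have "form h \<le> \<rho> N * (L2n U h)\<^sup>2"
  proof (rule rayleigh_bound[of _ "{..<N}"])
    show "0 \<le> \<rho> N" using rho_pos[of N] by simp
    show "\<rho> m \<le> \<rho> N" if "m \<notin> {..<N}" for m using rho_dec that by (simp add: decseq_def)
  qed (use h_L2 h_orth in auto)
  ultimately have "\<epsilon> / 16 / cosh (b * R) * (w * S) \<le> \<rho> N * (w * S)" unfolding h_norm by linarith
  then have "\<epsilon> / 16 / cosh (b * R) \<le> \<rho> N"
    by (rule mult_right_le_imp_le) (use w S in simp)
  moreover have "b * R = T * (real N + 1) / (2 * (c / b))"
    using b_pos c_pos by (simp add: R_def w_def field_simps)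
  ultimately show ?thesis by simp
qed

lemma cosh_le_exp: "x \<ge> 0 \<Longrightarrow> cosh x \<le> exp (x::real)"
  by (simp add: cosh_field_def)

text \<open>Two instances of \<open>rho_trial_bound\<close>: the full period, where Parseval is
  exact, and the arc of half length 4 a with the Remez constant. The constant C may depend on a = c
  / b but not on N.\<close>

lemma rho_lower_bound: "\<exists>C>0. \<forall>N. C * exp (- 2 * beta_fun (c / b) * real N) \<le> \<rho> N"
proof -
  define a where "a = c / b"
  have a: "a > 0" using ratio_pos by (simp add: a_def)
  show ?thesis
  proof (cases "a \<le> 0.12059")
    case False
    \<comment> \<open>The argument of cosh contains N + 1 instead of N; the extra summand \<pi> / (2
      a) goes into the constant.\<close>
    define C where "C = pi / 8 * exp (- (pi / (2 * a)))"
    have "C * exp (- 2 * beta_fun a * real N) \<le> \<rho> N" for N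
    proof -
      let ?x = "pi * (real N + 1) / (2 * a)"
      have "C * exp (- 2 * beta_fun a * real N) = pi / 8 * exp (- ?x)"
        using False a by (simp add: C_def beta_fun_def field_simps flip: exp_add)
      also have "\<dots> \<le> pi / 8 / cosh ?x"
      proof -
        have "cosh ?x \<le> exp ?x" using a by (intro cosh_le_exp) simp
        then have "pi / 8 / exp ?x \<le> pi / 8 / cosh ?x" by (intro divide_left_mono) auto
        then show ?thesis by (simp add: exp_minus field_simps)
      qed
      also have "\<dots> = (2 * pi) / 16 / cosh ?x" by simp
      also have "\<dots> \<le> \<rho> N"
        using rho_trial_bound[of pi "2 * pi" N] by (simp add: trig_poly_Parseval a_def)
      finally show ?thesis .
    qed
    moreover have "C > 0" by (simp add: C_def)
    ultimately show ?thesis unfolding a_def[symmetric] by (intro exI[of _ C] conjI allI)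
  next
    case True
    define C where "C = a / (2 * exp 4)"
    have "C * exp (- 2 * beta_fun a * real N) \<le> \<rho> N" for N
    proof -
      \<comment> \<open>The minimiser of 2 ln (4 e / T) + T / (2 a), the loss per unit of N. It
        makes the Remez factor (e / a)^N and the argument of cosh 2 (N + 1), free of a.\<close>
      define T where "T = 4 * a"
      define \<Lambda> where "\<Lambda> = exp 1 * (4 * exp 1 / T) ^ N"
      define \<epsilon> where "\<epsilon> = 2 * T / (real (N + 1) * \<Lambda>)\<^sup>2"
      have T: "0 < T" "T \<le> 1" using True a by (simp_all add: T_def)
      define q where "q = a / (exp 1)\<^sup>2"
      have q: "q > 0" using a by (simp add: q_def)
      have eb: "exp (- beta_fun a) = q / (7 * pi / 2)"
        using True a by (simp add: beta_fun_def exp_minus q_def)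
      \<comment> \<open>Here the slack 7 \<pi> / 2 in \<beta> is spent: its N-th power outweighs the
        polynomial factor of the Remez inequality.\<close>
      have N1: "real (N + 1) \<le> (7 * pi / 2) ^ N"
      proof -
        have "N + 1 \<le> 2 ^ N" by (metis Suc_eq_plus1 Suc_leI less_exp)
        then have "real (N + 1) \<le> 2 ^ N" by (metis of_nat_le_iff of_nat_numeral of_nat_power)
        also have "\<dots> \<le> (7 * pi / 2) ^ N" using pi_gt3 by (intro power_mono) auto
        finally show ?thesis .
      qed
      have "exp (- 2 * beta_fun a * real N) = (exp (- beta_fun a) ^ N)\<^sup>2"
        by (simp add: mult_ac flip: exp_of_nat_mult exp_double)
      also have "\<dots> = (q ^ N / (7 * pi / 2) ^ N)\<^sup>2" by (simp add: eb power_divide)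
      also have "\<dots> \<le> (q ^ N / real (N + 1))\<^sup>2"
        using N1 q by (intro power_mono divide_left_mono) auto
      finally have "C * exp (- 2 * beta_fun a * real N) \<le> C * (q ^ N / real (N + 1))\<^sup>2"
        using a by (intro mult_left_mono) (auto simp: C_def)
      also have "\<dots> = \<epsilon> / 16 * exp (- (2 * (real N + 1)))"
      proof -
        have \<Lambda>: "\<Lambda> = exp 1 * (exp 1 / a) ^ N" by (simp add: \<Lambda>_def T_def)
        have qN: "q ^ N = a ^ N / (exp 1 ^ N * exp 1 ^ N)"
          by (simp add: q_def power_divide power2_eq_square power_mult_distrib)
        have e2: "exp (- (2 * (real N + 1))) = 1 / (exp 1 ^ N * exp 1 ^ N * (exp 1 * exp 1))"
        proof -
          have "2 * (real N + 1) = real N + real N + (1 + 1)" by simp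
          moreover have "exp (real N) = exp 1 ^ N" using exp_of_nat_mult[of N "1 :: real"] by simp
          ultimately have "exp (2 * (real N + 1)) = exp 1 ^ N * exp 1 ^ N * (exp 1 * exp 1)"
            by (simp only: exp_add)
          then show ?thesis by (simp only: exp_minus inverse_eq_divide)
        qed
        have e4: "exp (4::real) = exp 1 * exp 1 * (exp 1 * exp 1)" by (simp flip: exp_add)
        \<comment> \<open>With E, X, A, n for e, e^N, a^N, N + 1 the claim becomes an identity of
          rational functions.\<close>
        have alg: "a / (2 * (E * E * (E * E))) * (A / (X * X) / n)\<^sup>2 =
            2 * (4 * a) / (n * (E * (X / A)))\<^sup>2 / 16 * (1 / (X * X * (E * E)))"
          if "A > 0" "X > 0" "n > 0" "E > 0" for A X n E :: real
          using that by (simp add: field_simps power2_eq_square)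
        show ?thesis
          unfolding C_def \<epsilon>_def T_def \<Lambda> qN e2 e4 power_divide[of "exp 1" a]
          by (rule alg) (use a in auto)
      qed
      also have "\<dots> \<le> \<epsilon> / 16 / cosh (2 * (real N + 1))"
      proof -
        have "cosh (2 * (real N + 1)) \<le> exp (2 * (real N + 1))" by (intro cosh_le_exp) simp
        then have "\<epsilon> / 16 / exp (2 * (real N + 1)) \<le> \<epsilon> / 16 / cosh (2 * (real N + 1))"
          using T by (intro divide_left_mono) (auto simp: \<epsilon>_def)
        then show ?thesis by (simp only: exp_minus divide_inverse)
      qed
      also have "\<dots> = \<epsilon> / 16 / cosh (T * (real N + 1) / (2 * (c / b)))"
        using a by (simp add: T_def a_def[symmetric])
      also have "\<dots> \<le> \<rho> N"
      proof (rule rho_trial_bound)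
        show "\<epsilon> * (\<Sum>k\<le>N. (cmod (\<alpha> k))\<^sup>2) \<le> integral {-T..T} (\<lambda>\<theta>. (cmod (trig_poly N \<alpha> \<theta>))\<^sup>2)" for \<alpha>
          unfolding \<epsilon>_def \<Lambda>_def by (rule trig_poly_arc_bound[OF T])
      qed (use T pi_gt3 in \<open>auto simp: \<epsilon>_def\<close>)
      finally show ?thesis .
    qed
    moreover have "C > 0" using a by (simp add: C_def)
    ultimately show ?thesis unfolding a_def[symmetric] by (intro exI[of _ C] conjI allI)
  qed
qed

end

section \<open>The error of the approximation\<close>

text \<open>The weight is even and the factor \<open>cis\<close> has modulus 1.\<close>

lemma L2_cosh_reflect:
  assumes f: "f \<in> L2 (cosh_measure b)"
  shows "(\<lambda>t. cis (x * t) * f (0 - t)) \<in> L2 (cosh_measure b)"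
proof -
  have [measurable]: "f \<in> borel_measurable borel" and i: "integrable lborel (\<lambda>t. cosh (b * t) * (cmod (f t))\<^sup>2)"
    using f by (auto simp: L2_cosh_iff)
  show ?thesis
    unfolding L2_cosh_iff using lborel_integrable_real_affine[OF i, of "-1" 0] by (simp add: norm_mult)
qed

context qop_eigensystem
begin

text \<open>With H the transform of f (x0 - .), the noiseless data are \<open>Fop c H\<close>
  divided by 2 \<pi>. So 2 \<pi> times the approximation is the truncated expansion of H plus a
  noise term, and Plancherel transfers the error back to f.\<close>

lemma approximation_error:
  assumes f: "f \<in> L2 lborel" "fourier f \<in> L2 W"
    and src: "(\<Sum>m. ennreal ((\<omega> m)\<^sup>2 * (cmod (L2_inner W (fourier (\<lambda>x. f (x0 - x))) (\<phi> m)))\<^sup>2)) \<le> ennreal (M\<^sup>2)"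
    and \<xi>: "\<xi> \<in> L2 U" "L2n U \<xi> \<le> 1" and \<delta>: "\<delta> \<ge> 0" and M: "M \<ge> 0"
    and om: "\<eta> > 0" "\<And>m. m > N \<Longrightarrow> \<eta> \<le> \<omega> m"
  defines "fa \<equiv> f_approx b c x0 \<rho> g N (observed c x0 \<delta> f \<xi>)"
  shows "(\<lambda>x. fa x - f x) \<in> L2 lborel"
    and "L2n lborel (\<lambda>x. fa x - f x) \<le> (2 * pi * \<delta> / s N + M / \<eta>) / sqrt (2 * pi)"
proof -
  define h where "h = (\<lambda>x. f (x0 - x))"
  define H where "H = fourier h"
  have h: "h \<in> L2 lborel" unfolding h_def by (rule L2_reflect[OF f(1)])
  have HL: "H \<in> L2 lborel" unfolding H_def by (rule fourier_L2[OF h])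
  have H: "H \<in> L2 W"
  proof (rule L2_cong_AE)
    show "(\<lambda>t. cis (x0 * t) * fourier f (0 - t)) \<in> L2 W" by (rule L2_cosh_reflect[OF f(2)])
    have "AE t in lborel. H t = cis (x0 * t) * fourier f (0 - t)"
      unfolding H_def h_def by (rule fourier_reflect[OF f(1)])
    then show "AE t in W. cis (x0 * t) * fourier f (0 - t) = H t"
      unfolding AE_cosh_measure by eventually_elim simp
    show "H \<in> borel_measurable W" using L2_measurable[OF HL] by (simp add: borel_measurable_cosh_measure)
  qed
  define y where "y = (\<lambda>x. f (c * x + x0))"
  have [measurable]: "f \<in> borel_measurable borel" using L2_measurable[OF f(1)] by simp
  have [measurable]: "fourier H \<in> borel_measurable borel" using L2_measurable[OF fourier_L2[OF HL]] by simp
  \<comment> \<open>Fourier inversion at z = c x: the double transform of f (x0 - .) is 2 \<pi> f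
    (x0 + z).\<close>
  have yAE: "AE x in U. Fop c H x = complex_of_real (2 * pi) * y x"
  proof -
    have "AE z in lborel. fourier H z = complex_of_real (2 * pi) * f (x0 - (0 - z))"
      using fourier_fourier[OF h] by (simp add: H_def h_def)
    then have "AE x in lborel. fourier H (0 + c * x) = complex_of_real (2 * pi) * f (x0 - (0 - (0 + c * x)))"
      using c_pos by (intro AE_borel_affine[where P="\<lambda>z. fourier H z = complex_of_real (2 * pi) * f (x0 - (0 - z))"]) auto
    then have "AE x in lborel. Fop c H x = complex_of_real (2 * pi) * y x"
      by (simp add: Fop_def y_def add.commute)
    then show ?thesis unfolding AE_unit_interval_iff by eventually_elim simp
  qed
  have FH: "Fop c H \<in> L2 U" by (rule Fop_L2[OF H])
  have ym: "y \<in> borel_measurable U" unfolding y_def by (intro measurable_unit_interval) measurable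
  have yL: "y \<in> L2 U"
  proof (rule L2_cong_AE[OF _ L2_cmult[OF FH, of "complex_of_real (1 / (2 * pi))"] ym])
    show "AE x in U. complex_of_real (1 / (2 * pi)) * Fop c H x = y x"
      using yAE by eventually_elim simp
  qed
  have yG: "L2_inner U y (G m) = complex_of_real (s m / (2 * pi)) * L2_inner W H (\<phi> m)" for m
  proof -
    have "complex_of_real (2 * pi) * L2_inner U y (G m) = L2_inner U (\<lambda>x. complex_of_real (2 * pi) * y x) (G m)"
      by (simp only: L2_inner_cmult)
    also have "\<dots> = L2_inner U (Fop c H) (G m)"
      by (rule L2_inner_cong_AE) (use yAE in \<open>auto intro: L2_measurable L2_cmult yL FH G_L2 simp: eq_commute\<close>)
    also have "\<dots> = complex_of_real (s m) * L2_inner W H (\<phi> m)"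
      using s_pos[of m] by (simp add: inner_phi[OF H])
    finally show ?thesis by (simp add: field_simps)
  qed
  have obs: "observed c x0 \<delta> f \<xi> (c * x + x0) = y x + complex_of_real \<delta> * \<xi> x" for x
    using c_pos by (simp add: observed_def y_def)
  have data: "L2_inner U (\<lambda>x. observed c x0 \<delta> f \<xi> (c * x + x0)) (G m) =
      complex_of_real (s m / (2 * pi)) * L2_inner W H (\<phi> m) + complex_of_real \<delta> * L2_inner U \<xi> (G m)" for m
    unfolding obs by (simp add: L2_inner_add yL L2_cmult \<xi>(1) G_L2 L2_inner_cmult yG)
  define F where "F = F_approx b c x0 \<rho> g N (observed c x0 \<delta> f \<xi>)"
  define p where "p = (\<lambda>t. \<Sum>m\<le>N. L2_inner W H (\<phi> m) * \<phi> m t)"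
  define k where "k m = complex_of_real (2 * pi * \<delta> / s m) * L2_inner U \<xi> (G m)" for m
  define q where "q = (\<lambda>t. \<Sum>m\<le>N. k m * \<phi> m t)"
  \<comment> \<open>A data coefficient is s m / (2 \<pi>) times the coefficient of H, so dividing by
    s m recovers the latter exactly, while the noise is amplified by 1 / s m.\<close>
  have Feq: "complex_of_real (2 * pi) * F t = p t + q t" for t
  proof -
    have "complex_of_real (2 * pi) * (1 / complex_of_real (s m) * (complex_of_real (s m / (2 * pi)) * A + complex_of_real \<delta> * B) * C) =
        A * C + complex_of_real (2 * pi * \<delta> / s m) * B * C" for A B C m
      using s_pos[of m] by (simp add: field_simps)
    then show ?thesis
      unfolding F_def F_approx_def p_def q_def data sum_distrib_left k_def sum.distrib[symmetric] by simp
  qed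
  have FL: "F \<in> L2 W"
    unfolding F_def F_approx_def by (intro L2_sum L2_cmult phi_L2)
  have pL: "p \<in> L2 W" and qL: "q \<in> L2 W"
    unfolding p_def q_def by (intro L2_orthonormal_sum_L2 phi_orthonormal)+
  have e1: "L2n W (\<lambda>t. H t - p t) \<le> M / \<eta>"
    unfolding p_def by (rule truncation_error[OF H M _ om]) (use src in \<open>simp add: H_def h_def\<close>)
  \<comment> \<open>The singular values decrease, so the amplification is worst at m = N; Bessel
    bounds the sum of the squared noise coefficients by 1.\<close>
  have e2: "L2n W q \<le> 2 * pi * \<delta> / s N"
  proof (rule power2_le_imp_le)
    have "(L2n W q)\<^sup>2 = (\<Sum>m\<le>N. (cmod (k m))\<^sup>2)"
      unfolding q_def by (rule L2_orthonormal_norm_sum[OF phi_orthonormal]) simp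
    also have "\<dots> \<le> (\<Sum>m\<le>N. (2 * pi * \<delta> / s N)\<^sup>2 * (cmod (L2_inner U \<xi> (G m)))\<^sup>2)"
    proof (rule sum_mono)
      fix m assume "m \<in> {..N}"
      then have "2 * pi * \<delta> / s m \<le> 2 * pi * \<delta> / s N"
        using s_antimono[of m N] s_pos[of m] s_pos[of N] \<delta> by (intro divide_left_mono) auto
      moreover have "0 \<le> 2 * pi * \<delta> / s m" using s_pos[of m] \<delta> by simp
      ultimately have "(2 * pi * \<delta> / s m)\<^sup>2 \<le> (2 * pi * \<delta> / s N)\<^sup>2" by (intro power_mono)
      then show "(cmod (k m))\<^sup>2 \<le> (2 * pi * \<delta> / s N)\<^sup>2 * (cmod (L2_inner U \<xi> (G m)))\<^sup>2"
        unfolding k_def norm_mult norm_of_real power_mult_distrib power2_abs by (rule mult_right_mono) simp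
    qed
    also have "\<dots> \<le> (2 * pi * \<delta> / s N)\<^sup>2 * 1"
      unfolding sum_distrib_left[symmetric]
    proof (rule mult_left_mono)
      have "(\<Sum>m\<le>N. (cmod (L2_inner U \<xi> (G m)))\<^sup>2) \<le> (L2n U \<xi>)\<^sup>2"
        by (rule L2_Bessel_le[OF G_orthonormal _ \<xi>(1)]) simp
      also have "\<dots> \<le> 1" using \<xi>(2) by (simp add: power_le_one)
      finally show "(\<Sum>m\<le>N. (cmod (L2_inner U \<xi> (G m)))\<^sup>2) \<le> 1" .
    qed simp
    finally show "(L2n W q)\<^sup>2 \<le> (2 * pi * \<delta> / s N)\<^sup>2" by simp
  qed (use \<delta> s_pos[of N] in simp)
  have FLl: "F \<in> L2 lborel" by (rule L2_cosh_L2[OF FL])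
  define v where "v = fourier_inv F"
  have v: "v \<in> L2 lborel" "AE t in lborel. fourier v t = F t"
    unfolding v_def by (rule fourier_inv_props[OF FLl])+
  let ?c = "complex_of_real (- (2 * pi))"
  have diff: "(\<lambda>x. h x + ?c * v x) \<in> L2 lborel" by (intro L2_add L2_cmult h v)
  \<comment> \<open>f x is h (x0 - x), so the error is, up to sign, the reflection of h - 2 \<pi> v
    and has the same norm.\<close>
  have fa: "fa x - f x = - 1 * (h (x0 - x) + ?c * v (x0 - x))" for x
    by (simp add: fa_def f_approx_def h_def v_def F_def)
  show "(\<lambda>x. fa x - f x) \<in> L2 lborel"
    unfolding fa by (intro L2_cmult L2_reflect[OF diff])
  have "L2n lborel (\<lambda>x. fa x - f x) = L2n lborel (\<lambda>x. h x + ?c * v x)"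
    unfolding fa L2n_cmult L2n_reflect[OF diff] by simp
  also have "\<dots> = L2n lborel (\<lambda>t. fourier h t + ?c * fourier v t) / sqrt (2 * pi)"
    unfolding L2n_fourier_lin[OF h v(1)] by simp
  also have "\<dots> \<le> (2 * pi * \<delta> / s N + M / \<eta>) / sqrt (2 * pi)"
  proof (rule divide_right_mono)
    have HF: "(\<lambda>t. (H t - p t) - q t) \<in> L2 W" by (intro L2_diff H pL qL)
    have "L2n lborel (\<lambda>t. fourier h t + ?c * fourier v t) = L2n lborel (\<lambda>t. (H t - p t) - q t)"
    proof (rule L2n_cong_AE)
      show "AE t in lborel. fourier h t + ?c * fourier v t = (H t - p t) - q t"
        using v(2)
      proof eventually_elim
        fix t assume "fourier v t = F t"
        then show "fourier h t + ?c * fourier v t = (H t - p t) - q t"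
          using Feq[of t] by (simp add: H_def algebra_simps)
      qed
    qed (intro L2_measurable L2_add L2_cmult fourier_L2 h v L2_cosh_L2[OF HF])+
    also have "\<dots> \<le> L2n W (\<lambda>t. (H t - p t) - q t)" by (rule L2_cosh_L2[OF HF])
    also have "\<dots> \<le> L2n W (\<lambda>t. H t - p t) + L2n W q" by (intro L2n_triangle_diff L2_diff H pL qL)
    finally show "L2n lborel (\<lambda>t. fourier h t + ?c * fourier v t) \<le> 2 * pi * \<delta> / s N + M / \<eta>"
      using e1 e2 by linarith
  qed simp
  finally show "L2n lborel (\<lambda>x. fa x - f x) \<le> (2 * pi * \<delta> / s N + M / \<eta>) / sqrt (2 * pi)" .
qed

lemma worst_error_bound:
  assumes \<delta>: "\<delta> \<ge> 0" and M: "M \<ge> 0" and om: "\<eta> > 0" "\<And>m. m > N \<Longrightarrow> \<eta> \<le> \<omega> m"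
  shows "worst_error b c x0 \<rho> g \<omega> M N \<delta> \<le> ennreal ((2 * pi * \<delta> / s N + M / \<eta>) / sqrt (2 * pi))"
  unfolding worst_error_def
proof (rule SUP_least, clarify)
  fix f \<xi>
  assume f: "f \<in> source_set b c x0 \<rho> g \<omega> M" and \<xi>: "L2_norm U \<xi> \<le> 1"
  \<comment> \<open>\<open>L2_norm\<close> is infinite outside the space, so the bound 1 carries
    membership with it.\<close>
  have \<xi>L: "\<xi> \<in> L2 U" using \<xi> by (auto simp: L2_norm_def top_unique split: if_splits)
  then have "L2n U \<xi> \<le> 1" using \<xi> by (simp add: L2_norm_eq)
  have f': "f \<in> L2 lborel" "fourier f \<in> L2 W"
    "(\<Sum>m. ennreal ((\<omega> m)\<^sup>2 * (cmod (L2_inner W (fourier (\<lambda>x. f (x0 - x))) (\<phi> m)))\<^sup>2)) \<le> ennreal (M\<^sup>2)"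
    using f by (simp_all add: source_set_def)
  note E = approximation_error[OF f' \<xi>L \<open>L2n U \<xi> \<le> 1\<close> \<delta> M om]
  show "L2_norm lborel (\<lambda>x. f_approx b c x0 \<rho> g N (observed c x0 \<delta> f \<xi>) x - f x)
      \<le> ennreal ((2 * pi * \<delta> / s N + M / \<eta>) / sqrt (2 * pi))"
  proof (subst L2_norm_eq)
    show "(\<lambda>x. f_approx b c x0 \<rho> g N (observed c x0 \<delta> f \<xi>) x - f x) \<in> L2 lborel"
      by (rule E(1))
    show "ennreal (L2n lborel (\<lambda>x. f_approx b c x0 \<rho> g N (observed c x0 \<delta> f \<xi>) x - f x))
        \<le> ennreal ((2 * pi * \<delta> / s N + M / \<eta>) / sqrt (2 * pi))"
      by (rule ennreal_leI) (rule E(2))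
  qed
qed

text \<open>Singular values are square roots of eigenvalues, which halves the exponent 2 \<beta> to
  \<beta>.\<close>

lemma inverse_sing_val_bound: "\<exists>K>0. \<forall>N. 1 / s N \<le> K * exp (beta_fun (c / b) * real N)"
proof -
  obtain C where C: "C > 0" "\<And>N. C * exp (- 2 * beta_fun (c / b) * real N) \<le> \<rho> N"
    using rho_lower_bound by blast
  show ?thesis
  proof (intro exI[of _ "sqrt (c / C)"] conjI allI)
    show "sqrt (c / C) > 0" using C c_pos by simp
    fix N
    let ?e = "exp (beta_fun (c / b) * real N)"
    have "(1 / s N)\<^sup>2 = c / \<rho> N" unfolding power_divide s_sq by simp
    also have "\<dots> \<le> c / (C * exp (- 2 * beta_fun (c / b) * real N))"
      using C rho_pos[of N] c_pos by (intro divide_left_mono) auto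
    also have "\<dots> = (sqrt (c / C) * ?e)\<^sup>2"
      using C c_pos by (simp add: power_mult_distrib exp_minus field_simps flip: exp_double)
    finally show "1 / s N \<le> sqrt (c / C) * ?e"
      by (rule power2_le_imp_le) (use C c_pos in simp)
  qed
qed

end

section \<open>The choice of the truncation level\<close>

lemma beta_fun_pos:
  assumes "a > 0"
  shows "beta_fun a > 0"
proof (cases "a \<le> 0.12059")
  case True
  have "1 * 1 \<le> (exp 1)\<^sup>2 * pi" using pi_gt3 by (intro mult_mono) (auto simp: one_le_power)
  then have "2 * a < 7 * (exp 1)\<^sup>2 * pi" using True by simp
  then have "1 < 7 * (exp 1)\<^sup>2 * pi / (2 * a)" using assms by simp
  then show ?thesis using True by (simp add: beta_fun_def)
qed (use assms in \<open>simp add: beta_fun_def\<close>)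

lemma bigo_at_0I:
  assumes le: "\<forall>\<^sub>F \<delta> in at_right 0. E \<delta> \<le> ennreal (B \<delta>)"
    and B: "\<forall>\<^sub>F \<delta> in at_right 0. 0 \<le> B \<delta>" "B \<in> O[at_right 0](r)"
  shows "bigo_at_0 E r"
  unfolding bigo_at_0_def
proof
  show "\<forall>\<^sub>F \<delta> in at_right 0. E \<delta> < \<infinity>"
    using le by eventually_elim (auto simp: less_top intro: le_less_trans)
  have "(\<lambda>\<delta>. enn2real (E \<delta>)) \<in> O[at_right 0](B)"
  proof (rule bigoI[of _ 1])
    show "\<forall>\<^sub>F \<delta> in at_right 0. norm (enn2real (E \<delta>)) \<le> 1 * norm (B \<delta>)"
      using le B(1) by eventually_elim (use enn2real_mono[of _ "ennreal _"] in fastforce)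
  qed
  then show "(\<lambda>\<delta>. enn2real (E \<delta>)) \<in> O[at_right 0](r)"
    using B(2) landau_o.big_trans by blast
qed

lemma eventually_at_right_0_less_1: "\<forall>\<^sub>F \<delta> in at_right (0::real). 0 < \<delta> \<and> \<delta> < 1"
  unfolding eventually_at_right_field by (rule exI[of _ 1]) simp

theorem theorem6:
  fixes b c x0 M :: real and \<rho> :: "nat \<Rightarrow> real" and g :: "nat \<Rightarrow> real \<Rightarrow> real"
  assumes "b > 0" and "c > 0" and "M > 0"
    and "eigensystem (c / b) \<rho> g"
  shows "(\<forall>\<sigma> > 1 / 2.
            bigo_at_0
              (\<lambda>\<delta>. worst_error b c x0 \<rho> g (\<lambda>m. real m powr \<sigma>) M
                     (nat \<lfloor>ln (1 / \<delta>) / (2 * beta_fun (c / b))\<rfloor>) \<delta>)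
              (\<lambda>\<delta>. (- ln \<delta>) powr (- \<sigma>))) \<and>
         (\<forall>\<kappa> > 0.
            bigo_at_0
              (\<lambda>\<delta>. worst_error b c x0 \<rho> g (\<lambda>m. exp (\<kappa> * real m)) M
                     (nat \<lfloor>ln (1 / \<delta>) / (\<kappa> + beta_fun (c / b))\<rfloor>) \<delta>)
              (\<lambda>\<delta>. \<delta> powr (\<kappa> / (\<kappa> + beta_fun (c / b)))))"
proof -
  interpret qop_eigensystem b c \<rho> g by standard fact+
  define \<beta> where "\<beta> = beta_fun (c / b)"
  have \<beta>: "\<beta> > 0" unfolding \<beta>_def by (rule beta_fun_pos[OF ratio_pos])
  obtain K where K: "K > 0" "\<And>N. 1 / sing_val c \<rho> N \<le> K * exp (\<beta> * real N)"
    using inverse_sing_val_bound unfolding \<beta>_def by blast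
  \<comment> \<open>y is the real level of which N will be the floor. Since \<beta> > 0 the noise
    term may be evaluated at y, and \<eta> will be the weight at y.\<close>
  have bound: "worst_error b c x0 \<rho> g \<omega> M N \<delta> \<le> ennreal (2 * pi * K * (\<delta> * exp (\<beta> * y)) + M / \<eta>)"
    if \<delta>: "\<delta> > 0" and N: "real N \<le> y" and om: "\<eta> > 0" "\<And>m. m > N \<Longrightarrow> \<eta> \<le> \<omega> m" for \<omega> N \<delta> \<eta> y
  proof -
    let ?B = "2 * pi * \<delta> / sing_val c \<rho> N + M / \<eta>"
    have B0: "0 \<le> ?B" using \<delta> om(1) s_pos[of N] assms(3) by simp
    have "worst_error b c x0 \<rho> g \<omega> M N \<delta> \<le> ennreal (?B / sqrt (2 * pi))"
      using \<delta> assms(3) om by (intro worst_error_bound) auto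
    also have "\<dots> \<le> ennreal (2 * pi * K * (\<delta> * exp (\<beta> * y)) + M / \<eta>)"
    proof (rule ennreal_leI)
      have "1 \<le> sqrt (2 * pi)" using pi_gt3 by simp
      then have "?B / sqrt (2 * pi) \<le> ?B / 1" using B0 by (intro divide_left_mono) auto
      also have "2 * pi * \<delta> / sing_val c \<rho> N = 2 * pi * \<delta> * (1 / sing_val c \<rho> N)" by simp
      also have "\<dots> \<le> 2 * pi * \<delta> * (K * exp (\<beta> * y))"
      proof (intro mult_left_mono order_trans[OF K(2)])
        show "exp (\<beta> * real N) \<le> exp (\<beta> * y)" using N \<beta> by simp
      qed (use \<delta> K in auto)
      finally show "?B / sqrt (2 * pi) \<le> 2 * pi * K * (\<delta> * exp (\<beta> * y)) + M / \<eta>" by (simp add: mult_ac)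
    qed
    finally show ?thesis .
  qed
  \<comment> \<open>The second inequality gives m >= N + 1 > y for every m > N, so the weight at y
    is below all weights in the truncation error.\<close>
  have floor: "real (nat \<lfloor>y\<rfloor>) \<le> y" "y < real (nat \<lfloor>y\<rfloor>) + 1" if "y \<ge> 0" for y :: real
    using that by linarith+
  show ?thesis
  proof (intro conjI allI impI)
    fix \<sigma> :: real assume \<sigma>: "\<sigma> > 1 / 2"
    \<comment> \<open>At this level the noise contributes only the order of sqrt \<delta>, smaller
      than any power of 1 / ln (1 / \<delta>); the truncation term decides the rate.\<close>
    let ?B = "\<lambda>\<delta>::real. 2 * pi * K * \<delta> powr (1 / 2) + M * (2 * \<beta>) powr \<sigma> * (- ln \<delta>) powr (- \<sigma>)"
    show "bigo_at_0 (\<lambda>\<delta>. worst_error b c x0 \<rho> g (\<lambda>m. real m powr \<sigma>) M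
        (nat \<lfloor>ln (1 / \<delta>) / (2 * beta_fun (c / b))\<rfloor>) \<delta>) (\<lambda>\<delta>. (- ln \<delta>) powr (- \<sigma>))"
    proof (rule bigo_at_0I[where B="?B"])
      show "\<forall>\<^sub>F \<delta> in at_right 0. worst_error b c x0 \<rho> g (\<lambda>m. real m powr \<sigma>) M
          (nat \<lfloor>ln (1 / \<delta>) / (2 * beta_fun (c / b))\<rfloor>) \<delta> \<le> ennreal (?B \<delta>)"
        using eventually_at_right_0_less_1
      proof eventually_elim
        fix \<delta> :: real assume \<delta>: "0 < \<delta> \<and> \<delta> < 1"
        define L where "L = - ln \<delta>"
        have L: "L > 0" using \<delta> by (simp add: L_def)
        define y where "y = L / (2 * \<beta>)"
        have y: "y > 0" using L \<beta> by (simp add: y_def)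
        define N where "N = nat \<lfloor>y\<rfloor>"
        have N: "real N \<le> y" "y < real N + 1" using floor[of y] y by (auto simp: N_def)
        have "worst_error b c x0 \<rho> g (\<lambda>m. real m powr \<sigma>) M N \<delta> \<le>
            ennreal (2 * pi * K * (\<delta> * exp (\<beta> * y)) + M / y powr \<sigma>)"
        proof (rule bound)
          show "y powr \<sigma> \<le> real m powr \<sigma>" if "m > N" for m
            using that N y \<sigma> by (intro powr_mono2) auto
        qed (use \<delta> N y in auto)
        also have "\<delta> * exp (\<beta> * y) = \<delta> powr (1 / 2)"
        proof -
          have "\<delta> = exp (- L)" using \<delta> by (simp add: L_def)
          then have "\<delta> * exp (\<beta> * y) = exp (- L + \<beta> * y)" by (simp only: exp_add)
          also have "- L + \<beta> * y = 1 / 2 * ln \<delta>" using \<beta> by (simp add: y_def L_def)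
          finally show ?thesis using \<delta> by (simp add: powr_def)
        qed
        also have "M / y powr \<sigma> = M * (2 * \<beta>) powr \<sigma> * L powr (- \<sigma>)"
          using L \<beta> by (simp add: y_def powr_divide powr_minus field_simps)
        finally show "worst_error b c x0 \<rho> g (\<lambda>m. real m powr \<sigma>) M
            (nat \<lfloor>ln (1 / \<delta>) / (2 * beta_fun (c / b))\<rfloor>) \<delta> \<le> ennreal (?B \<delta>)"
          using \<delta> by (simp add: N_def y_def L_def \<beta>_def ln_div)
      qed
      show "\<forall>\<^sub>F \<delta> in at_right 0. 0 \<le> ?B \<delta>"
        using K assms(3) by (intro always_eventually allI add_nonneg_nonneg mult_nonneg_nonneg) auto
      have "(\<lambda>\<delta>::real. \<delta> powr (1 / 2)) \<in> O[at_right 0](\<lambda>\<delta>. (- ln \<delta>) powr (- \<sigma>))"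
        by real_asymp
      then show "?B \<in> O[at_right 0](\<lambda>\<delta>. (- ln \<delta>) powr (- \<sigma>))"
        using K assms(3) \<beta> by (intro sum_in_bigo) simp_all
    qed
  next
    fix \<kappa> :: real assume \<kappa>: "\<kappa> > 0"
    \<comment> \<open>The level y balances \<delta> exp (\<beta> y) against exp (- \<kappa> y): both
      equal \<delta> to the power \<tau>.\<close>
    define \<tau> where "\<tau> = \<kappa> / (\<kappa> + \<beta>)"
    let ?B = "\<lambda>\<delta>::real. (2 * pi * K + M) * \<delta> powr \<tau>"
    show "bigo_at_0 (\<lambda>\<delta>. worst_error b c x0 \<rho> g (\<lambda>m. exp (\<kappa> * real m)) M
        (nat \<lfloor>ln (1 / \<delta>) / (\<kappa> + beta_fun (c / b))\<rfloor>) \<delta>) (\<lambda>\<delta>. \<delta> powr (\<kappa> / (\<kappa> + beta_fun (c / b))))"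
    proof (rule bigo_at_0I[where B="?B"])
      show "\<forall>\<^sub>F \<delta> in at_right 0. worst_error b c x0 \<rho> g (\<lambda>m. exp (\<kappa> * real m)) M
          (nat \<lfloor>ln (1 / \<delta>) / (\<kappa> + beta_fun (c / b))\<rfloor>) \<delta> \<le> ennreal (?B \<delta>)"
        using eventually_at_right_0_less_1
      proof eventually_elim
        fix \<delta> :: real assume \<delta>: "0 < \<delta> \<and> \<delta> < 1"
        define L where "L = - ln \<delta>"
        have L: "L > 0" using \<delta> by (simp add: L_def)
        define y where "y = L / (\<kappa> + \<beta>)"
        have y: "y > 0" using L \<beta> \<kappa> by (simp add: y_def)
        define N where "N = nat \<lfloor>y\<rfloor>"
        have N: "real N \<le> y" "y < real N + 1" using floor[of y] y by (auto simp: N_def)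
        have "worst_error b c x0 \<rho> g (\<lambda>m. exp (\<kappa> * real m)) M N \<delta> \<le>
            ennreal (2 * pi * K * (\<delta> * exp (\<beta> * y)) + M / exp (\<kappa> * y))"
        proof (rule bound)
          show "exp (\<kappa> * y) \<le> exp (\<kappa> * real m)" if "m > N" for m
            using that N \<kappa> by simp
        qed (use \<delta> N in auto)
        also have "\<delta> * exp (\<beta> * y) = \<delta> powr \<tau>"
        proof -
          have "\<delta> = exp (- L)" using \<delta> by (simp add: L_def)
          then have "\<delta> * exp (\<beta> * y) = exp (- L + \<beta> * y)" by (simp only: exp_add)
          also have "- L + \<beta> * y = \<tau> * ln \<delta>" using \<beta> \<kappa> by (simp add: y_def L_def \<tau>_def field_simps)
          finally show ?thesis using \<delta> by (simp add: powr_def)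
        qed
        also have "M / exp (\<kappa> * y) = M * \<delta> powr \<tau>"
        proof -
          have "- (\<kappa> * y) = \<tau> * ln \<delta>" by (simp add: y_def L_def \<tau>_def)
          then have "\<delta> powr \<tau> = exp (- (\<kappa> * y))" using \<delta> by (simp add: powr_def)
          then show ?thesis by (simp add: exp_minus divide_inverse)
        qed
        finally show "worst_error b c x0 \<rho> g (\<lambda>m. exp (\<kappa> * real m)) M
            (nat \<lfloor>ln (1 / \<delta>) / (\<kappa> + beta_fun (c / b))\<rfloor>) \<delta> \<le> ennreal (?B \<delta>)"
          using \<delta> by (simp add: N_def y_def L_def \<beta>_def ln_div distrib_right)
      qed
      show "\<forall>\<^sub>F \<delta> in at_right 0. 0 \<le> ?B \<delta>"
        using K assms(3) by (intro always_eventually allI mult_nonneg_nonneg) auto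
      show "?B \<in> O[at_right 0](\<lambda>\<delta>. \<delta> powr (\<kappa> / (\<kappa> + beta_fun (c / b))))"
        using K assms(3) by (simp add: \<tau>_def \<beta>_def)
    qed
  qed
qed

end
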